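(* Let $J$ be a $\sigma$-invariant nilpotent subalgebra of $A$, and let $P=1+J$. Then the sets - $\mathcal{X}=\{X(\lambda):\lambda\in C_J(\sigma)^\circ\}$, - $\mathrm{SCh}(C_P(\sigma))=\{\sigma_\lambda:\lambda\in C_J(\sigma)^\circ\}$, and - $\mathrm{SCl}(C_P(\sigma))=\{\hat K\cap C_P(\sigma):\hat K\in\mathrm{SCl}_\sigma(P)\}$ have the same cardinality.
   Context: Let $k$ be a finite field of odd characteristic $p$ and $A$ a finite-dimensional associative $k$-algebra with identity, endowed with an involution $\sigma$: an additive map $\sigma:A\to A$ with $\sigma(ab)=\sigma(b)\sigma(a)$ and $\sigma^2=\mathrm{id}$, such that $\sigma(k\cdot 1)=k\cdot 1$ ($\sigma$ need not be $k$-linear). A subalgebra of $A$ is a multiplicatively closed $k$-subspace (it need not contain $1$). For a $\sigma$-invariant nilpotent subalgebra $J$, $P=1+J$ is a finite $p$-group (an algebra group). The group $\langle\sigma\rangle$ acts on $P$ by $x^\sigma=\sigma(x^{-1})$ and on $J$ by $a^\sigma=-\sigma(a)$. Put $C_P(\sigma)=\{x\in P: x^\sigma=x\}$ and $C_J(\sigma)=\{a\in J:a^\sigma=a\}$. The map $\Psi:P\to J$, $\Psi(x)=(x-1)(x+1)^{-1}$, is a bijection, inverse to the Cayley transform $\Phi(a)=(1+a)(1-a)^{-1}$. A superclass of $P$ is a set $1+PaP$ with $a\in J$, where $PaP=\{xay:x,y\in P\}$; $\mathrm{SCl}_\sigma(P)$ is the set of superclasses $\hat K$ of $P$ with $\hat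 K^\sigma=\hat K$. $J^\circ$ is the group of linear characters $\lambda:J^+\to\mathbb{C}^\times$ of the additive group of $J$. $P$ acts on $J^\circ$ on the left and on the right by $(x\lambda)(a)=\lambda(x^{-1}a)$, $(\lambda x)(a)=\lambda(ax^{-1})$. Put $\lambda^\sigma(a)=\lambda(a^\sigma)$. The dual group $C_J(\sigma)^\circ$ of $C_J(\sigma)^+$ is identified (via restriction) with $\{\lambda\in J^\circ:\lambda^\sigma=\lambda\}$. For $\lambda\in J^\circ$ the supercharacter $\hat\xi_\lambda$ of $P$ is $\hat\xi_\lambda(x)=\frac{|P\lambda|}{|P\lambda P|}\sum_{\mu\in P\lambda P}\mu(\Psi(x))$, $x\in P$. $\mathrm{Irr}_\sigma(P)$ is the set of irreducible complex characters $\hat\chi$ of $P$ with $\hat\chi(x^\sigma)=\hat\chi(x)$ for all $x$. The Glauberman correspondence is the bijection $\pi_P:\mathrm{Irr}_\sigma(P)\to\mathrm{Irr}(C_P(\sigma))$ sending $\hat\chi$ to the unique irreducible constituent of the restriction $\hat\chi_{C_P(\sigma)}$ with odd multiplicity. For $\lambda\in C_J(\sigma)^\circ$, $X(\lambda)$ is the set of all $\chi\in\mathrm{Irr}(C_P(\sigma))$ whose Glauberman correspondent $\hat\chi=\pi_P^{-1}(\chi)$ is a constituent of $\hat\xi_\lambda$, and $\sigma_\lambda=\sum_{\chi\in X(\lambda)}\chi(1)\chi$. *)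

theory Defs
  imports
    "HOL-Algebra.Group"
    "Jordan_Normal_Form.VS_Connect"
begin

section \<open>Complex characters of a finite group\<close>

definition representation :: "('g, 'm) monoid_scheme \<Rightarrow> nat \<Rightarrow> ('g \<Rightarrow> complex mat) \<Rightarrow> bool"
  where "representation G n \<rho> \<longleftrightarrow> \<rho> \<in> hom G (units_of (ring_mat TYPE(complex) n ()))"

definition irreducible_representation ::
    "('g, 'm) monoid_scheme \<Rightarrow> nat \<Rightarrow> ('g \<Rightarrow> complex mat) \<Rightarrow> bool"
  where "irreducible_representation G n \<rho> \<longleftrightarrow> representation G n \<rho> \<and> n > 0 \<and>
    (\<forall>W. VectorSpace.subspace class_ring W (module_vec TYPE(complex) n) \<and>
         (\<forall>g\<in>carrier G. \<forall>w\<in>W. \<rho> g *\<^sub>v w \<in> W)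
       \<longrightarrow> W = {0\<^sub>v n} \<or> W = carrier_vec n)"

text \<open>
  Characters, and all other functions on a group \<open>G\<close>, are extensional: they are \<open>undefined\<close>
  outside \<open>carrier G\<close>. So equality of functions is equality on \<open>G\<close>, and the cardinality of a set of
  functions is the intended one.
\<close>

definition character_of :: "('g, 'm) monoid_scheme \<Rightarrow> nat \<Rightarrow> ('g \<Rightarrow> complex mat) \<Rightarrow> 'g \<Rightarrow> complex"
  where "character_of G n \<rho> = (\<lambda>g\<in>carrier G. \<Sum>i<n. \<rho> g $$ (i, i))"

definition Irr :: "('g, 'm) monoid_scheme \<Rightarrow> ('g \<Rightarrow> complex) set"
  where "Irr G = {character_of G n \<rho> | n \<rho>. irreducible_representation G n \<rho>}"

text \<open>
  The usual inner product of complex functions on \<open>G\<close>. For a character \<open>\<psi>\<close> and an irreducible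
  character \<open>\<chi>\<close>, \<open>char_inner G \<psi> \<chi>\<close> is the multiplicity of \<open>\<chi>\<close> in \<open>\<psi>\<close>.
\<close>

definition char_inner :: "('g, 'm) monoid_scheme \<Rightarrow> ('g \<Rightarrow> complex) \<Rightarrow> ('g \<Rightarrow> complex) \<Rightarrow> complex"
  where "char_inner G \<phi> \<psi> = (\<Sum>g\<in>carrier G. \<phi> g * cnj (\<psi> g)) / of_nat (card (carrier G))"

definition constituent :: "('g, 'm) monoid_scheme \<Rightarrow> ('g \<Rightarrow> complex) \<Rightarrow> ('g \<Rightarrow> complex) \<Rightarrow> bool"
  where "constituent G \<chi> \<psi> \<longleftrightarrow> \<chi> \<in> Irr G \<and> char_inner G \<psi> \<chi> \<noteq> 0"


section \<open>Algebras with involution\<close>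

locale finite_dimensional_algebra = vector_space scale
  for scale :: "'k::field \<Rightarrow> 'a::ring_1 \<Rightarrow> 'a" +
  assumes scale_mult_left: "scale c (a * b) = scale c a * b"
    and scale_mult_right: "scale c (a * b) = a * scale c b"
    and finite_dimensional: "\<exists>B. finite B \<and> span B = UNIV"

definition algebra_involution :: "('k::field \<Rightarrow> 'a::ring_1 \<Rightarrow> 'a) \<Rightarrow> ('a \<Rightarrow> 'a) \<Rightarrow> bool"
  where "algebra_involution scale \<sigma> \<longleftrightarrow>
    (\<forall>a b. \<sigma> (a + b) = \<sigma> a + \<sigma> b) \<and>
    (\<forall>a b. \<sigma> (a * b) = \<sigma> b * \<sigma> a) \<and>
    (\<forall>a. \<sigma> (\<sigma> a) = a) \<and>
    \<sigma> ` range (\<lambda>c. scale c 1) = range (\<lambda>c. scale c 1)"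

definition subalgebra :: "('k::field \<Rightarrow> 'a::ring_1 \<Rightarrow> 'a) \<Rightarrow> 'a set \<Rightarrow> bool"
  where "subalgebra scale J \<longleftrightarrow> module.subspace scale J \<and> (\<forall>a\<in>J. \<forall>b\<in>J. a * b \<in> J)"

definition nilpotent_set :: "'a::ring_1 set \<Rightarrow> bool"
  where "nilpotent_set J \<longleftrightarrow> (\<exists>n. \<forall>as. length as = n \<and> set as \<subseteq> J \<longrightarrow> prod_list as = 0)"

text \<open>Two-sided inverse; meaningful only for units.\<close>

definition unit_inv :: "'a::monoid_mult \<Rightarrow> 'a"
  where "unit_inv x = (THE y. x * y = 1 \<and> y * x = 1)"


section \<open>Algebra groups and the action of the involution\<close>

definition mult_group :: "'a::monoid_mult set \<Rightarrow> 'a monoid"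
  where "mult_group S = \<lparr>carrier = S, mult = (*), one = 1\<rparr>"

definition one_plus :: "'a::ring_1 set \<Rightarrow> 'a set"
  where "one_plus J = {1 + a | a. a \<in> J}"

definition act_P :: "('a::ring_1 \<Rightarrow> 'a) \<Rightarrow> 'a \<Rightarrow> 'a"
  where "act_P \<sigma> x = \<sigma> (unit_inv x)"

definition act_J :: "('a::ring_1 \<Rightarrow> 'a) \<Rightarrow> 'a \<Rightarrow> 'a"
  where "act_J \<sigma> a = - \<sigma> a"

definition C_P :: "('a::ring_1 \<Rightarrow> 'a) \<Rightarrow> 'a set \<Rightarrow> 'a set"
  where "C_P \<sigma> J = {x \<in> one_plus J. act_P \<sigma> x = x}"

definition C_J :: "('a::ring_1 \<Rightarrow> 'a) \<Rightarrow> 'a set \<Rightarrow> 'a set"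
  where "C_J \<sigma> J = {a \<in> J. act_J \<sigma> a = a}"

definition Psi :: "'a::ring_1 \<Rightarrow> 'a"
  where "Psi x = (x - 1) * unit_inv (x + 1)"


section \<open>Superclasses\<close>

definition superclass :: "'a::ring_1 set \<Rightarrow> 'a \<Rightarrow> 'a set"
  where "superclass J a = {1 + x * a * y | x y. x \<in> one_plus J \<and> y \<in> one_plus J}"

definition SCl_inv :: "('a::ring_1 \<Rightarrow> 'a) \<Rightarrow> 'a set \<Rightarrow> 'a set set"
  where "SCl_inv \<sigma> J = {superclass J a | a. a \<in> J \<and> act_P \<sigma> ` superclass J a = superclass J a}"


section \<open>Linear characters of the additive group and supercharacters\<close>

definition dual_group :: "'a::ring_1 set \<Rightarrow> ('a \<Rightarrow> complex) set"
  where "dual_group J = {\<kappa> \<in> J \<rightarrow>\<^sub>E (UNIV - {0}). \<forall>a\<in>J. \<forall>b\<in>J. \<kappa> (a + b) = \<kappa> a * \<kappa> b}"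

definition act_dual :: "('a::ring_1 \<Rightarrow> 'a) \<Rightarrow> 'a set \<Rightarrow> ('a \<Rightarrow> complex) \<Rightarrow> 'a \<Rightarrow> complex"
  where "act_dual \<sigma> J \<kappa> = (\<lambda>a\<in>J. \<kappa> (act_J \<sigma> a))"

text \<open>
  The dual group of \<open>C\<^sub>J(\<sigma>)\<close>, identified via restriction with the group of
  \<open>\<sigma>\<close>-invariant characters of \<open>J\<close>; lemma \<open>bij_betw_restrict_dual_CJ\<close> below justifies this.
\<close>

definition dual_CJ :: "('a::ring_1 \<Rightarrow> 'a) \<Rightarrow> 'a set \<Rightarrow> ('a \<Rightarrow> complex) set"
  where "dual_CJ \<sigma> J = {\<kappa> \<in> dual_group J. act_dual \<sigma> J \<kappa> = \<kappa>}"

lemma bij_betw_restrict_dual_CJ: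
  fixes scale :: "'k::{field,finite} \<Rightarrow> 'a::ring_1 \<Rightarrow> 'a"
  assumes odd: "odd CHAR('k)"
    and alg: "finite_dimensional_algebra scale"
    and inv: "algebra_involution scale \<sigma>"
    and sub: "subalgebra scale J"
    and sJ: "\<sigma> ` J = J"
  shows "bij_betw (\<lambda>\<kappa>. restrict \<kappa> (C_J \<sigma> J)) (dual_CJ \<sigma> J) (dual_group (C_J \<sigma> J))"
proof -
  interpret finite_dimensional_algebra scale by (rule alg)
  have J: "subspace J" using sub by (simp add: subalgebra_def)
  define t where "t = act_J \<sigma>"
  have \<sigma>_add: "\<sigma> (a + b) = \<sigma> a + \<sigma> b" and \<sigma>_\<sigma>: "\<sigma> (\<sigma> a) = a" for a b
    using inv by (auto simp: algebra_involution_def)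
  have \<sigma>_0: "\<sigma> 0 = 0" using \<sigma>_add[of 0 0] by simp
  have \<sigma>_minus: "\<sigma> (- a) = - \<sigma> a" for a
    using \<sigma>_add[of a "- a"] \<sigma>_0 by (simp add: add_eq_0_iff)
  have t_add: "t (a + b) = t a + t b" and t_t: "t (t a) = a" and t_minus: "t (- a) = - t a" for a b
    by (simp_all add: t_def act_J_def \<sigma>_add \<sigma>_minus \<sigma>_\<sigma>)
  have tJ: "t a \<in> J" if "a \<in> J" for a
    using that sJ subspace_neg[OF J] by (auto simp: t_def act_J_def)
  have two: "(2::'k) \<noteq> 0"
  proof
    assume "(2::'k) = 0"
    then have "of_nat 2 = (0::'k)" by simp
    then have dvd2: "CHAR('k) dvd 2" by (simp only: of_nat_eq_0_iff_char_dvd)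
    then have "CHAR('k) \<le> 2" by (rule dvd_imp_le) simp
    moreover have "CHAR('k) \<noteq> 1" by simp
    ultimately show False using odd by (metis One_nat_def dvd2 dvd_0_left_iff even_numeral le_antisym less_2_cases_iff nless_le)
  qed
  define h where "h = scale (1/2)"
  have hh: "h a + h a = a" for a
    using two by (simp add: h_def scale_left_distrib[symmetric])
  have h_add: "h (a + b) = h a + h b" for a b by (simp add: h_def scale_right_distrib)
  have hJ: "h a \<in> J" if "a \<in> J" for a using that J by (simp add: h_def subspace_scale)
  have half_unique: "b = h a" if "b + b = a" for a b
  proof -
    have "h a = h b + h b" using that h_add by auto
    then show ?thesis using hh by simp
  qed
  have t_h: "t (h a) = h (t a)" for a
    by (rule half_unique) (metis hh t_add)
  have addJ: "a + b \<in> J" if "a \<in> J" "b \<in> J" for a b using that J by (simp add: subspace_add)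
  define C where "C = C_J \<sigma> J"
  have C_iff: "a \<in> C \<longleftrightarrow> a \<in> J \<and> t a = a" for a by (simp add: C_def C_J_def t_def)
  have projC: "h a + t (h a) \<in> C" if "a \<in> J" for a
    using that by (simp add: C_iff hJ tJ addJ t_add t_t add.commute)
  have val: "\<kappa> a = \<kappa> (h a + t (h a))" if "\<kappa> \<in> dual_CJ \<sigma> J" "a \<in> J" for \<kappa> a
  proof -
    have mult: "\<kappa> (b + c) = \<kappa> b * \<kappa> c" if "b \<in> J" "c \<in> J" for b c
      using \<open>\<kappa> \<in> dual_CJ \<sigma> J\<close> that by (auto simp: dual_CJ_def dual_group_def)
    have fix_t: "\<kappa> (t b) = \<kappa> b" if "b \<in> J" for b
      using \<open>\<kappa> \<in> dual_CJ \<sigma> J\<close> that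
      by (auto simp: dual_CJ_def act_dual_def t_def dest!: fun_cong[of _ _ b])
    have "\<kappa> a = \<kappa> (h a) * \<kappa> (h a)"
      using mult[of "h a" "h a"] hJ that by (simp add: hh)
    also have "\<dots> = \<kappa> (h a) * \<kappa> (t (h a))" using fix_t hJ that by simp
    also have "\<dots> = \<kappa> (h a + t (h a))" using mult hJ tJ that by simp
    finally show ?thesis .
  qed
  have "inj_on (\<lambda>\<kappa>. restrict \<kappa> C) (dual_CJ \<sigma> J)"
  proof (rule inj_onI)
    fix \<kappa> \<mu> assume \<kappa>\<mu>: "\<kappa> \<in> dual_CJ \<sigma> J" "\<mu> \<in> dual_CJ \<sigma> J" "restrict \<kappa> C = restrict \<mu> C"
    have "\<kappa> a = \<mu> a" if "a \<in> J" for a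
      using val[OF \<kappa>\<mu>(1) that] val[OF \<kappa>\<mu>(2) that] projC[OF that] \<kappa>\<mu>(3)
      by (metis restrict_apply')
    then show "\<kappa> = \<mu>" using \<kappa>\<mu>(1,2)
      by (auto simp: dual_CJ_def dual_group_def intro: PiE_ext)
  qed
  moreover have "(\<lambda>\<kappa>. restrict \<kappa> C) ` dual_CJ \<sigma> J = dual_group C"
  proof (intro equalityI subsetI)
    fix \<nu> assume "\<nu> \<in> (\<lambda>\<kappa>. restrict \<kappa> C) ` dual_CJ \<sigma> J"
    then obtain \<kappa> where l: "\<kappa> \<in> dual_group J" "\<nu> = restrict \<kappa> C" by (auto simp: dual_CJ_def)
    have "a + b \<in> C" if "a \<in> C" "b \<in> C" for a b using that by (simp add: C_iff addJ t_add)
    then show "\<nu> \<in> dual_group C" using l by (auto simp: dual_group_def C_iff)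
  next
    fix \<nu> assume \<nu>: "\<nu> \<in> dual_group C"
    define \<kappa> where "\<kappa> = (\<lambda>a\<in>J. \<nu> (h a + t (h a)))"
    have \<nu>_mult: "\<nu> (a + b) = \<nu> a * \<nu> b" if "a \<in> C" "b \<in> C" for a b
      using \<nu> that by (auto simp: dual_group_def)
    have "\<kappa> \<in> dual_group J"
      unfolding dual_group_def
    proof (intro CollectI conjI ballI)
      show "\<kappa> \<in> J \<rightarrow>\<^sub>E UNIV - {0}" using \<nu> projC by (auto simp: \<kappa>_def dual_group_def)
    next
      fix a b assume ab: "a \<in> J" "b \<in> J"
      have "h (a + b) + t (h (a + b)) = (h a + t (h a)) + (h b + t (h b))"
        by (simp add: h_add t_add algebra_simps)
      then show "\<kappa> (a + b) = \<kappa> a * \<kappa> b"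
        using \<nu>_mult[OF projC[OF ab(1)] projC[OF ab(2)]] ab by (simp add: \<kappa>_def addJ)
    qed
    moreover have "act_dual \<sigma> J \<kappa> = \<kappa>"
      using tJ by (auto simp: act_dual_def \<kappa>_def t_def[symmetric] t_h[symmetric] t_t add.commute
          intro!: restrict_ext)
    moreover have "restrict \<kappa> C = \<nu>"
    proof
      fix a
      have "h a + t (h a) = a" if "a \<in> C" using that by (simp add: t_h C_iff hh)
      then show "restrict \<kappa> C a = \<nu> a"
        using \<nu> by (auto simp: \<kappa>_def C_iff dual_group_def PiE_def extensional_def)
    qed
    ultimately show "\<nu> \<in> (\<lambda>\<kappa>. restrict \<kappa> C) ` dual_CJ \<sigma> J"
      by (auto simp: dual_CJ_def)
  qed
  ultimately show ?thesis by (simp add: bij_betw_def C_def)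
qed

definition left_act :: "'a::ring_1 set \<Rightarrow> 'a \<Rightarrow> ('a \<Rightarrow> complex) \<Rightarrow> 'a \<Rightarrow> complex"
  where "left_act J x \<kappa> = (\<lambda>a\<in>J. \<kappa> (unit_inv x * a))"

definition right_act :: "'a::ring_1 set \<Rightarrow> ('a \<Rightarrow> complex) \<Rightarrow> 'a \<Rightarrow> 'a \<Rightarrow> complex"
  where "right_act J \<kappa> x = (\<lambda>a\<in>J. \<kappa> (a * unit_inv x))"

definition left_orbit :: "'a::ring_1 set \<Rightarrow> ('a \<Rightarrow> complex) \<Rightarrow> ('a \<Rightarrow> complex) set"
  where "left_orbit J \<kappa> = {left_act J x \<kappa> | x. x \<in> one_plus J}"

definition double_orbit :: "'a::ring_1 set \<Rightarrow> ('a \<Rightarrow> complex) \<Rightarrow> ('a \<Rightarrow> complex) set"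
  where "double_orbit J \<kappa> =
    {right_act J (left_act J x \<kappa>) y | x y. x \<in> one_plus J \<and> y \<in> one_plus J}"

definition supercharacter :: "'a::ring_1 set \<Rightarrow> ('a \<Rightarrow> complex) \<Rightarrow> 'a \<Rightarrow> complex"
  where "supercharacter J \<kappa> = (\<lambda>x\<in>one_plus J.
    of_nat (card (left_orbit J \<kappa>)) / of_nat (card (double_orbit J \<kappa>)) *
    (\<Sum>\<mu>\<in>double_orbit J \<kappa>. \<mu> (Psi x)))"


section \<open>The Glauberman correspondence and the sets \<open>X(\<kappa>)\<close>\<close>

definition Irr_inv :: "('a::ring_1 \<Rightarrow> 'a) \<Rightarrow> 'a set \<Rightarrow> ('a \<Rightarrow> complex) set"
  where "Irr_inv \<sigma> J =
    {\<chi> \<in> Irr (mult_group (one_plus J)). \<forall>x\<in>one_plus J. \<chi> (act_P \<sigma> x) = \<chi> x}"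

definition glauberman :: "('a::ring_1 \<Rightarrow> 'a) \<Rightarrow> 'a set \<Rightarrow> ('a \<Rightarrow> complex) \<Rightarrow> 'a \<Rightarrow> complex"
  where "glauberman \<sigma> J \<chi> = (THE \<theta>. \<theta> \<in> Irr (mult_group (C_P \<sigma> J)) \<and>
    (\<exists>m::nat. odd m \<and> char_inner (mult_group (C_P \<sigma> J)) (restrict \<chi> (C_P \<sigma> J)) \<theta> = of_nat m))"

definition X_set :: "('a::ring_1 \<Rightarrow> 'a) \<Rightarrow> 'a set \<Rightarrow> ('a \<Rightarrow> complex) \<Rightarrow> ('a \<Rightarrow> complex) set"
  where "X_set \<sigma> J \<kappa> = {\<chi> \<in> Irr (mult_group (C_P \<sigma> J)).
    constituent (mult_group (one_plus J))
      (inv_into (Irr_inv \<sigma> J) (glauberman \<sigma> J) \<chi>) (supercharacter J \<kappa>)}"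

definition sigma_char :: "('a::ring_1 \<Rightarrow> 'a) \<Rightarrow> 'a set \<Rightarrow> ('a \<Rightarrow> complex) \<Rightarrow> 'a \<Rightarrow> complex"
  where "sigma_char \<sigma> J \<kappa> = (\<lambda>x\<in>C_P \<sigma> J. \<Sum>\<chi>\<in>X_set \<sigma> J \<kappa>. \<chi> 1 * \<chi> x)"

definition X_sets :: "('a::ring_1 \<Rightarrow> 'a) \<Rightarrow> 'a set \<Rightarrow> ('a \<Rightarrow> complex) set set"
  where "X_sets \<sigma> J = {X_set \<sigma> J \<kappa> | \<kappa>. \<kappa> \<in> dual_CJ \<sigma> J}"

definition SCh_CP :: "('a::ring_1 \<Rightarrow> 'a) \<Rightarrow> 'a set \<Rightarrow> ('a \<Rightarrow> complex) set"
  where "SCh_CP \<sigma> J = {sigma_char \<sigma> J \<kappa> | \<kappa>. \<kappa> \<in> dual_CJ \<sigma> J}"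

definition SCl_CP :: "('a::ring_1 \<Rightarrow> 'a) \<Rightarrow> 'a set \<Rightarrow> 'a set set"
  where "SCl_CP \<sigma> J = {K \<inter> C_P \<sigma> J | K. K \<in> SCl_inv \<sigma> J}"

end

theory Submission
  imports Defs "Jordan_Normal_Form.Spectral_Radius" "HOL-Algebra.Multiplicative_Group"
begin

text \<open>
  Write \<open>O\<close> for a \<open>P\<close>-\<open>P\<close>-orbit on the dual group of \<open>J\<close> and put \<open>f\<^sub>O(x) = \<Sum>\<mu>\<in>O. \<mu>((x - 1)/2)\<close>. Up to a scalar
  this is a supercharacter, because \<open>\<Psi>(x) = ((x - 1)/2) w\<close> for some \<open>w \<in> P\<close>. A direct computation
  shows that the functions \<open>f\<^sub>O / |P|\<close> are orthogonal central idempotents for convolution, so supercharacters of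
  different orbits have disjoint sets of constituents, and \<open>|O|\<close> is the sum of \<open>\<chi>(1)\<^sup>2\<close> over the
  constituents \<open>\<chi>\<close> belonging to \<open>O\<close>. As \<open>|O|\<close> is odd, a \<open>\<sigma>\<close>-stable \<open>O\<close> has an odd number of constituents of odd
  degree, hence a \<open>\<sigma>\<close>-invariant one. So the sets \<open>X(\<lambda>)\<close> are nonempty and correspond to the
  \<open>\<sigma>\<close>-stable orbits \<open>O\<close>. In the same way the sets in \<open>SCl(C\<^sub>P(\<sigma>))\<close> correspond to the
  \<open>\<sigma>\<close>-stable \<open>P\<close>-\<open>P\<close>-orbits on \<open>J\<close>. Both kinds of orbits are counted by averaging numbers of fixed
  points over the coset of \<open>\<sigma>\<close>, and an additive map fixes as many characters of \<open>J\<close> as elements.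

  The Glauberman correspondence for an involution \<open>\<tau>\<close> of a group \<open>G\<close> of odd order is obtained by
  extending a \<open>\<tau>\<close>-invariant irreducible representation by a matrix \<open>S\<close> with \<open>S\<^sup>2 = 1\<close>. The
  functions \<open>c \<mapsto> tr(S R(c))\<close> on the fixed points are orthonormal virtual characters, so they are
  irreducible characters up to sign, and they are congruent modulo \<open>2\<close> to the restrictions.
\<close>


section \<open>Matrices\<close>

text \<open>The orbit sums need a form that is additive in the group element. Hence
  \<open>half (z - 1)\<close> instead of \<open>Psi z\<close>: then
  \<open>z * unit_inv y - 1\<close>, once halved, is a difference of two such shifts times an
  element of \<open>P\<close>, which an orbit sum ignores, and the convolution reduces to
  orthogonality of additive characters. A central idempotent acts on an irreducible representation
  as 0 or 1; this is why a constituent belongs to one orbit and why its pairing with the orbit sum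
  has a forced value. \<open>\<sigma>\<close> reverses products, so it exchanges the two sides of a
  \<open>P\<close>-\<open>P\<close>-orbit. It normalises the two-sided action, and every element of
  its coset acts on \<open>J\<close> by an additive map and on the dual by composition with the
  inverse of that map. So the numbers of fixed points agree element by element. In the semidirect
  product of \<open>G\<close> with \<open>\<tau>\<close>, \<open>S\<close> represents
  \<open>\<tau>\<close>, and \<open>tr(S R(g))\<close> is a character value on the coset of
  \<open>\<tau>\<close>. Odd order makes every element of that coset conjugate under
  \<open>G\<close> to some \<open>\<tau> c\<close> with \<open>c\<close> fixed, so orthogonality on
  the coset descends to the fixed points.\<close>

definition trace :: "'a::comm_monoid_add mat \<Rightarrow> 'a"
  where "trace A = (\<Sum>i<dim_row A. A $$ (i, i))"

lemma mult_mat_entry: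
  assumes "A \<in> carrier_mat n m" "B \<in> carrier_mat m k" "i < n" "j < k"
  shows "(A * B) $$ (i, j) = (\<Sum>l<m. A $$ (i, l) * B $$ (l, j))"
  using assms by (simp add: scalar_prod_def lessThan_atLeast0)

lemma mult_vec_entry:
  assumes "A \<in> carrier_mat n m" "v \<in> carrier_vec m" "i < n"
  shows "(A *\<^sub>v v) $ i = (\<Sum>l<m. A $$ (i, l) * v $ l)"
  using assms by (simp add: scalar_prod_def lessThan_atLeast0)

lemma trace_mult_commute:
  fixes A B :: "'a::comm_semiring_0 mat"
  assumes "A \<in> carrier_mat n m" "B \<in> carrier_mat m n"
  shows "trace (A * B) = trace (B * A)"
proof -
  have "trace (A * B) = (\<Sum>i<n. \<Sum>l<m. A $$ (i, l) * B $$ (l, i))"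
    using assms by (simp add: trace_def mult_mat_entry[of A n m B n] del: index_mult_mat(1))
  also have "\<dots> = (\<Sum>l<m. \<Sum>i<n. B $$ (l, i) * A $$ (i, l))"
    by (subst sum.swap) (simp add: mult.commute)
  also have "\<dots> = trace (B * A)"
    using assms by (simp add: trace_def mult_mat_entry[of B m n A m] del: index_mult_mat(1))
  finally show ?thesis .
qed

lemma trace_add:
  assumes "A \<in> carrier_mat n n" "B \<in> carrier_mat n n"
  shows "trace (A + B) = trace A + trace B"
  using assms by (simp add: trace_def sum.distrib)

lemma trace_minus:
  fixes A B :: "'a::ab_group_add mat"
  assumes "A \<in> carrier_mat n n" "B \<in> carrier_mat n n"
  shows "trace (A - B) = trace A - trace B"
  using assms by (simp add: trace_def sum_subtractf)

lemma trace_smult: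
  fixes A :: "'a::comm_semiring_0 mat"
  assumes "A \<in> carrier_mat n n"
  shows "trace (c \<cdot>\<^sub>m A) = c * trace A"
  using assms by (simp add: trace_def sum_distrib_left)

text \<open>If \<open>n < r\<close>, padding both factors with zeros gives square matrices whose
  product is still the identity. Square one-sided inverses are two-sided, but row \<open>n\<close>
  of the padded \<open>V\<close> is zero.\<close>

lemma right_inverse_mat_dim_le:
  fixes U V :: "'a::field mat"
  assumes U: "U \<in> carrier_mat r n" and V: "V \<in> carrier_mat n r" and UV: "U * V = 1\<^sub>m r"
  shows "r \<le> n"
proof (rule ccontr)
  assume "\<not> r \<le> n"
  then have nr: "n < r" by simp
  define U' where "U' = mat r r (\<lambda>(i, j). if j < n then U $$ (i, j) else 0)"
  define V' where "V' = mat r r (\<lambda>(i, j). if i < n then V $$ (i, j) else 0)"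
  have c: "U' \<in> carrier_mat r r" "V' \<in> carrier_mat r r" by (simp_all add: U'_def V'_def)
  have "U' * V' = 1\<^sub>m r"
  proof (rule eq_matI)
    fix i j assume "i < dim_row (1\<^sub>m r :: 'a mat)" "j < dim_col (1\<^sub>m r :: 'a mat)"
    then have ij: "i < r" "j < r" by auto
    have "(U' * V') $$ (i, j) = (\<Sum>l<r. U' $$ (i, l) * V' $$ (l, j))"
      by (rule mult_mat_entry[OF c ij])
    also have "\<dots> = (\<Sum>l<r. if l < n then U $$ (i, l) * V $$ (l, j) else 0)"
      using ij by (intro sum.cong) (auto simp: U'_def V'_def)
    also have "\<dots> = (\<Sum>l<n. U $$ (i, l) * V $$ (l, j))"
      using nr by (intro sum.mono_neutral_cong_right) auto
    also have "\<dots> = (1\<^sub>m r :: 'a mat) $$ (i, j)"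
      using mult_mat_entry[OF U V ij] UV by simp
    finally show "(U' * V') $$ (i, j) = (1\<^sub>m r :: 'a mat) $$ (i, j)" .
  qed (use c in auto)
  then have "V' * U' = 1\<^sub>m r" by (rule mat_mult_left_right_inverse[OF c])
  then have "(V' * U') $$ (n, n) = 1" using nr by simp
  moreover have "(V' * U') $$ (n, n) = 0"
    unfolding mult_mat_entry[OF c(2,1) nr nr] using nr by (simp add: V'_def)
  ultimately show False by simp
qed

section \<open>Subspaces of complex column vectors\<close>

abbreviation vec_subspace :: "nat \<Rightarrow> complex vec set \<Rightarrow> bool"
  where "vec_subspace n W \<equiv> VectorSpace.subspace class_ring W (module_vec TYPE(complex) n)"

lemma vec_subspace_iff:
  "vec_subspace n W \<longleftrightarrow> W \<subseteq> carrier_vec n \<and> 0\<^sub>v n \<in> W \<and>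
    (\<forall>v\<in>W. \<forall>w\<in>W. v + w \<in> W) \<and> (\<forall>c. \<forall>v\<in>W. c \<cdot>\<^sub>v v \<in> W)"
  unfolding VectorSpace.subspace_def LinearCombinations.submodule_def
  by (auto simp: vec_vs vec_module module_vec_simps class_ring_simps)

lemma vec_subspace_minus:
  assumes "vec_subspace n W" "v \<in> W" "w \<in> W"
  shows "v - w \<in> W"
proof -
  have "v + (-1) \<cdot>\<^sub>v w \<in> W" using assms by (auto simp: vec_subspace_iff)
  moreover have "v + (-1) \<cdot>\<^sub>v w = v - w"
    using assms by (intro eq_vecI) (auto simp: vec_subspace_iff)
  ultimately show ?thesis by simp
qed

lemma vec_subspace_image:
  assumes "A \<in> carrier_mat n m"
  shows "vec_subspace n ((*\<^sub>v) A ` carrier_vec m)"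
  unfolding vec_subspace_iff
proof (intro conjI ballI allI)
  show "(*\<^sub>v) A ` carrier_vec m \<subseteq> carrier_vec n" using assms by auto
  have "A *\<^sub>v 0\<^sub>v m = 0\<^sub>v n" using assms by (intro eq_vecI) auto
  then show "0\<^sub>v n \<in> (*\<^sub>v) A ` carrier_vec m" by (metis imageI zero_carrier_vec)
next
  fix v w assume "v \<in> (*\<^sub>v) A ` carrier_vec m" "w \<in> (*\<^sub>v) A ` carrier_vec m"
  then obtain v' w' where "v' \<in> carrier_vec m" "w' \<in> carrier_vec m" "v = A *\<^sub>v v'" "w = A *\<^sub>v w'" by auto
  then show "v + w \<in> (*\<^sub>v) A ` carrier_vec m"
    using assms by (intro image_eqI[of _ _ "v' + w'"]) (auto simp: mult_add_distrib_mat_vec)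
next
  fix c v assume "v \<in> (*\<^sub>v) A ` carrier_vec m"
  then obtain v' where "v' \<in> carrier_vec m" "v = A *\<^sub>v v'" by auto
  then show "c \<cdot>\<^sub>v v \<in> (*\<^sub>v) A ` carrier_vec m"
    using assms by (intro image_eqI[of _ _ "c \<cdot>\<^sub>v v'"]) (auto simp: mult_mat_vec)
qed

lemma vec_subspace_kernel:
  assumes "A \<in> carrier_mat n m"
  shows "vec_subspace m {v \<in> carrier_vec m. A *\<^sub>v v = 0\<^sub>v n}"
  unfolding vec_subspace_iff using assms by (auto simp: mult_add_distrib_mat_vec mult_mat_vec)

text \<open>
  A subspace of dimension \<open>r\<close> is encoded by a matrix \<open>V\<close> whose columns are a basis together with a
  left inverse \<open>U\<close>; then \<open>V U\<close> is a projection onto the subspace.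
\<close>

lemma vec_subspace_basis:
  assumes W: "vec_subspace n W"
  obtains r U V where "U \<in> carrier_mat r n" "V \<in> carrier_mat n r" "U * V = 1\<^sub>m r"
    "\<And>v. v \<in> carrier_vec r \<Longrightarrow> V *\<^sub>v v \<in> W" "\<And>w. w \<in> W \<Longrightarrow> V *\<^sub>v (U *\<^sub>v w) = w"
proof -
  \<comment> \<open>\<open>Q r\<close> says that \<open>W\<close> contains \<open>r\<close>
    independent vectors, with \<open>U\<close> as dual functionals. Since \<open>r\<close> is at
    most \<open>n\<close>, there is a largest such \<open>r\<close>, and maximality forces the
    columns of \<open>V\<close> to span \<open>W\<close>.\<close>
  define Q where "Q r \<longleftrightarrow> (\<exists>U V. U \<in> carrier_mat r n \<and> V \<in> carrier_mat n r \<and> U * V = 1\<^sub>m r \<and>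
    (\<forall>v\<in>carrier_vec r. V *\<^sub>v v \<in> W))" for r
  have WD: "W \<subseteq> carrier_vec n" "0\<^sub>v n \<in> W" "\<And>v w. v \<in> W \<Longrightarrow> w \<in> W \<Longrightarrow> v + w \<in> W"
    "\<And>c v. v \<in> W \<Longrightarrow> c \<cdot>\<^sub>v v \<in> W"
    using W by (auto simp: vec_subspace_iff)
  have "Q 0"
    unfolding Q_def
  proof (intro exI conjI ballI)
    show "0\<^sub>m 0 n \<in> carrier_mat 0 n" "0\<^sub>m n 0 \<in> carrier_mat n 0" by auto
    show "0\<^sub>m 0 n * 0\<^sub>m n 0 = (1\<^sub>m 0 :: complex mat)" by (intro eq_matI) auto
    fix v :: "complex vec" assume "v \<in> carrier_vec 0"
    then have "0\<^sub>m n 0 *\<^sub>v v = 0\<^sub>v n" by (intro eq_vecI) (auto simp: scalar_prod_def)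
    then show "0\<^sub>m n 0 *\<^sub>v v \<in> W" using WD by simp
  qed
  moreover have bound: "\<forall>r. Q r \<longrightarrow> r \<le> n" by (auto simp: Q_def dest: right_inverse_mat_dim_le)
  ultimately have QG: "Q (Greatest Q)" by (blast intro: GreatestI_ex_nat)
  define r where "r = Greatest Q"
  obtain U V where U: "U \<in> carrier_mat r n" and V: "V \<in> carrier_mat n r" and UV: "U * V = 1\<^sub>m r"
    and VW: "\<And>v. v \<in> carrier_vec r \<Longrightarrow> V *\<^sub>v v \<in> W"
    using QG unfolding r_def[symmetric] Q_def by blast
  have "V *\<^sub>v (U *\<^sub>v w) = w" if w: "w \<in> W" for w
  proof (rule ccontr)
    assume ne: "V *\<^sub>v (U *\<^sub>v w) \<noteq> w"
    have wc: "w \<in> carrier_vec n" using w WD by auto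
    define x where "x = w - V *\<^sub>v (U *\<^sub>v w)"
    have xW: "x \<in> W" unfolding x_def using vec_subspace_minus[OF W w] VW U wc by simp
    have xc: "x \<in> carrier_vec n" using xW WD by auto
    have UVU: "U *\<^sub>v (V *\<^sub>v (U *\<^sub>v w)) = U *\<^sub>v w"
      using assoc_mult_mat_vec[OF U V, of "U *\<^sub>v w"] U wc UV by simp
    have Ux: "U *\<^sub>v x = 0\<^sub>v r"
      unfolding x_def using U V wc UVU by (subst mult_minus_distrib_mat_vec[OF U]) auto
    have "x \<noteq> 0\<^sub>v n"
    proof
      assume "x = 0\<^sub>v n"
      then have "w = V *\<^sub>v (U *\<^sub>v w)" unfolding x_def
        using wc V U by (intro eq_vecI) (auto simp: vec_eq_iff)
      then show False using ne by simp
    qed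
    then obtain i where i: "i < n" "x $ i \<noteq> 0" using xc by (metis carrier_vecD eq_vecI index_zero_vec)
    \<comment> \<open>This \<open>P\<close> kills the columns of \<open>V\<close> and fixes
      \<open>x\<close>. Row \<open>i\<close> of \<open>P\<close> divided by \<open>x $ i\<close> is
      therefore a functional that is zero on the old basis and one at \<open>x\<close>; it becomes
      the new row of \<open>U'\<close>.\<close>
    define P where "P = 1\<^sub>m n - V * U"
    have P: "P \<in> carrier_mat n n" unfolding P_def by (rule minus_carrier_mat[OF mult_carrier_mat[OF V U]])
    have "P * V = 1\<^sub>m n * V - V * U * V" unfolding P_def
      by (rule minus_mult_distrib_mat) (use U V in auto)
    also have "V * U * V = V * (U * V)" using U V by simp
    finally have PV: "P * V = 0\<^sub>m n r" using UV U V by simp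
    have "P *\<^sub>v x = 1\<^sub>m n *\<^sub>v x - V * U *\<^sub>v x" unfolding P_def
      by (rule minus_mult_distrib_mat_vec) (use U V xc in auto)
    also have "V * U *\<^sub>v x = V *\<^sub>v (U *\<^sub>v x)" using U V xc by simp
    also have "\<dots> = 0\<^sub>v n" using Ux V by (intro eq_vecI) auto
    finally have Px: "P *\<^sub>v x = x" using xc by simp
    define U' where "U' = mat (Suc r) n (\<lambda>(a, b). if a < r then U $$ (a, b) else P $$ (i, b) / x $ i)"
    define V' where "V' = mat n (Suc r) (\<lambda>(b, c). if c < r then V $$ (b, c) else x $ b)"
    have c: "U' \<in> carrier_mat (Suc r) n" "V' \<in> carrier_mat n (Suc r)" by (simp_all add: U'_def V'_def)
    have "U' * V' = 1\<^sub>m (Suc r)"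
    proof (rule eq_matI)
      fix a b assume "a < dim_row (1\<^sub>m (Suc r) :: complex mat)" "b < dim_col (1\<^sub>m (Suc r) :: complex mat)"
      then have ab: "a < Suc r" "b < Suc r" by auto
      have eq: "(U' * V') $$ (a, b) = (\<Sum>l<n. U' $$ (a, l) * V' $$ (l, b))"
        by (rule mult_mat_entry[OF c ab])
      consider "a < r" "b < r" | "a < r" "b = r" | "a = r" "b < r" | "a = r" "b = r" using ab by linarith
      then show "(U' * V') $$ (a, b) = (1\<^sub>m (Suc r) :: complex mat) $$ (a, b)"
      proof cases
        case 1
        have "(U * V) $$ (a, b) = (\<Sum>l<n. U $$ (a, l) * V $$ (l, b))"
          by (rule mult_mat_entry[OF U V 1])
        then show ?thesis using 1 UV unfolding eq by (simp add: U'_def V'_def)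
      next
        case 2
        have "(U *\<^sub>v x) $ a = (\<Sum>l<n. U $$ (a, l) * x $ l)"
          by (rule mult_vec_entry[OF U xc 2(1)])
        then show ?thesis using 2 Ux unfolding eq by (simp add: U'_def V'_def)
      next
        case 3
        have "(P * V) $$ (i, b) = (\<Sum>l<n. P $$ (i, l) * V $$ (l, b))"
          by (rule mult_mat_entry[OF P V i(1) 3(2)])
        then show ?thesis using 3 PV i unfolding eq
          by (simp add: U'_def V'_def sum_divide_distrib[symmetric])
      next
        case 4
        have "(P *\<^sub>v x) $ i = (\<Sum>l<n. P $$ (i, l) * x $ l)"
          by (rule mult_vec_entry[OF P xc i(1)])
        then show ?thesis using 4 Px i unfolding eq
          by (simp add: U'_def V'_def sum_divide_distrib[symmetric])
      qed
    qed (use c in auto)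
    moreover have "V' *\<^sub>v v \<in> W" if v: "v \<in> carrier_vec (Suc r)" for v
    proof -
      have vc: "vec r (($) v) \<in> carrier_vec r" by simp
      have "V' *\<^sub>v v = V *\<^sub>v vec r (($) v) + v $ r \<cdot>\<^sub>v x"
      proof (rule eq_vecI)
        fix j assume "j < dim_vec (V *\<^sub>v vec r (($) v) + v $ r \<cdot>\<^sub>v x)"
        then have j: "j < n" using xc by simp
        show "(V' *\<^sub>v v) $ j = (V *\<^sub>v vec r (($) v) + v $ r \<cdot>\<^sub>v x) $ j"
          unfolding mult_vec_entry[OF c(2) v j]
          using j V xc mult_vec_entry[OF V vc j] by (simp add: V'_def)
      qed (use c V xc in auto)
      then show ?thesis using VW[OF vc] xW WD by simp
    qed
    ultimately have "Q (Suc r)" unfolding Q_def using c by blast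
    then have "Suc r \<le> r" unfolding r_def using bound by (blast intro: Greatest_le_nat)
    then show False by simp
  qed
  then show ?thesis using that U V UV VW by blast
qed


section \<open>Representations and Schur's lemma\<close>

text \<open>Matrices of all sizes share one type, so an empty sum has no size of its own; the
  arguments \<open>n\<close> and \<open>m\<close> fix it.\<close>

definition mat_sum :: "nat \<Rightarrow> nat \<Rightarrow> ('i \<Rightarrow> 'a::comm_monoid_add mat) \<Rightarrow> 'i set \<Rightarrow> 'a mat"
  where "mat_sum n m F S = mat n m (\<lambda>(i, j). \<Sum>s\<in>S. F s $$ (i, j))"

lemma mat_sum_carrier [simp]: "mat_sum n m F S \<in> carrier_mat n m"
  by (simp add: mat_sum_def)

lemma mat_sum_index [simp]: "i < n \<Longrightarrow> j < m \<Longrightarrow> mat_sum n m F S $$ (i, j) = (\<Sum>s\<in>S. F s $$ (i, j))"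
  by (simp add: mat_sum_def)

lemma mat_sum_dim [simp]: "dim_row (mat_sum n m F S) = n" "dim_col (mat_sum n m F S) = m"
  by (simp_all add: mat_sum_def)

lemma mult_mat_sum:
  fixes B :: "'a::semiring_0 mat"
  assumes "B \<in> carrier_mat k n" "\<And>s. s \<in> S \<Longrightarrow> F s \<in> carrier_mat n m"
  shows "B * mat_sum n m F S = mat_sum k m (\<lambda>s. B * F s) S"
proof (rule eq_matI)
  fix i j assume "i < dim_row (mat_sum k m (\<lambda>s. B * F s) S)" "j < dim_col (mat_sum k m (\<lambda>s. B * F s) S)"
  then have ij: "i < k" "j < m" by (simp_all add: mat_sum_def)
  have "(B * mat_sum n m F S) $$ (i, j) = (\<Sum>l<n. \<Sum>s\<in>S. B $$ (i, l) * F s $$ (l, j))"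
    using ij by (simp add: mult_mat_entry[OF assms(1) mat_sum_carrier] sum_distrib_left del: index_mult_mat(1))
  also have "\<dots> = (\<Sum>s\<in>S. (B * F s) $$ (i, j))"
    by (subst sum.swap) (simp add: mult_mat_entry[OF assms ij] del: index_mult_mat(1))
  finally show "(B * mat_sum n m F S) $$ (i, j) = mat_sum k m (\<lambda>s. B * F s) S $$ (i, j)"
    using ij by simp
qed (use assms in \<open>auto simp: mat_sum_def\<close>)

lemma mat_sum_mult:
  fixes B :: "'a::semiring_0 mat"
  assumes "\<And>s. s \<in> S \<Longrightarrow> F s \<in> carrier_mat n m" "B \<in> carrier_mat m k"
  shows "mat_sum n m F S * B = mat_sum n k (\<lambda>s. F s * B) S"
proof (rule eq_matI)
  fix i j assume "i < dim_row (mat_sum n k (\<lambda>s. F s * B) S)" "j < dim_col (mat_sum n k (\<lambda>s. F s * B) S)"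
  then have ij: "i < n" "j < k" by (simp_all add: mat_sum_def)
  have "(mat_sum n m F S * B) $$ (i, j) = (\<Sum>l<m. \<Sum>s\<in>S. F s $$ (i, l) * B $$ (l, j))"
    using ij by (simp add: mult_mat_entry[OF mat_sum_carrier assms(2)] sum_distrib_right del: index_mult_mat(1))
  also have "\<dots> = (\<Sum>s\<in>S. (F s * B) $$ (i, j))"
    by (subst sum.swap) (simp add: mult_mat_entry[OF assms ij] del: index_mult_mat(1))
  finally show "(mat_sum n m F S * B) $$ (i, j) = mat_sum n k (\<lambda>s. F s * B) S $$ (i, j)"
    using ij by simp
qed (use assms in \<open>auto simp: mat_sum_def\<close>)

lemma mat_sum_cong: "(\<And>s. s \<in> S \<Longrightarrow> F s = F' s) \<Longrightarrow> mat_sum n m F S = mat_sum n m F' S"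
  by (simp add: mat_sum_def)

lemma trace_mat_sum:
  assumes "\<And>s. s \<in> S \<Longrightarrow> F s \<in> carrier_mat n n"
  shows "trace (mat_sum n n F S) = (\<Sum>s\<in>S. trace (F s))"
proof -
  have "trace (mat_sum n n F S) = (\<Sum>s\<in>S. \<Sum>i<n. F s $$ (i, i))"
    by (subst sum.swap) (simp add: trace_def mat_sum_def)
  also have "\<dots> = (\<Sum>s\<in>S. trace (F s))"
    using assms by (intro sum.cong refl) (metis carrier_matD(1) trace_def)
  finally show ?thesis .
qed

lemma mat_sum_mult_vec_index:
  assumes "\<And>s. s \<in> S \<Longrightarrow> F s \<in> carrier_mat n m" "v \<in> carrier_vec m" "i < n"
  shows "(mat_sum n m F S *\<^sub>v v) $ i = (\<Sum>s\<in>S. (F s *\<^sub>v v) $ i :: 'a::semiring_0)"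
proof -
  have "(mat_sum n m F S *\<^sub>v v) $ i = (\<Sum>l<m. \<Sum>s\<in>S. F s $$ (i, l) * v $ l)"
    using assms by (simp add: mult_vec_entry[OF mat_sum_carrier assms(2)] sum_distrib_right del: index_mult_mat_vec)
  also have "\<dots> = (\<Sum>s\<in>S. (F s *\<^sub>v v) $ i)"
    by (subst sum.swap) (simp add: mult_vec_entry[OF assms(1) assms(2,3)] del: index_mult_mat_vec)
  finally show ?thesis .
qed

lemma mat_sum_mult_vec_in_subspace:
  assumes W: "vec_subspace n W" and "finite S" and "\<And>s. s \<in> S \<Longrightarrow> F s \<in> carrier_mat n m"
    and "v \<in> carrier_vec m" and "\<And>s. s \<in> S \<Longrightarrow> F s *\<^sub>v v \<in> W"
  shows "mat_sum n m F S *\<^sub>v v \<in> W"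
  using assms(2,3,5)
proof (induction S rule: finite_induct)
  case empty
  have "mat_sum n m F {} *\<^sub>v v = 0\<^sub>v n"
    using assms(4) by (intro eq_vecI) (auto simp: mat_sum_def scalar_prod_def)
  then show ?case using W by (simp add: vec_subspace_iff)
next
  case (insert x S)
  have "mat_sum n m F (insert x S) *\<^sub>v v = F x *\<^sub>v v + mat_sum n m F S *\<^sub>v v"
  proof (rule eq_vecI)
    fix i assume "i < dim_vec (F x *\<^sub>v v + mat_sum n m F S *\<^sub>v v)"
    then have i: "i < n" by (simp add: mat_sum_def)
    have e1: "(mat_sum n m F (insert x S) *\<^sub>v v) $ i = (\<Sum>s\<in>insert x S. (F s *\<^sub>v v) $ i)"
      by (rule mat_sum_mult_vec_index) (use insert.prems(1) assms(4) i in auto)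
    have e2: "(mat_sum n m F S *\<^sub>v v) $ i = (\<Sum>s\<in>S. (F s *\<^sub>v v) $ i)"
      by (rule mat_sum_mult_vec_index) (use insert.prems(1) assms(4) i in auto)
    have "(F x *\<^sub>v v + mat_sum n m F S *\<^sub>v v) $ i = (F x *\<^sub>v v) $ i + (mat_sum n m F S *\<^sub>v v) $ i"
      by (rule index_add_vec(1)) (simp add: i)
    then show "(mat_sum n m F (insert x S) *\<^sub>v v) $ i = (F x *\<^sub>v v + mat_sum n m F S *\<^sub>v v) $ i"
      unfolding e1 e2 using insert.hyps by (simp del: index_mult_mat_vec)
  qed (use insert.prems in \<open>auto simp: mat_sum_def\<close>)
  then show ?case using insert W by (auto simp: vec_subspace_iff)
qed

lemma mat_eq_of_mult_vec_eq:
  fixes A B :: "'a::comm_semiring_1 mat"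
  assumes A: "A \<in> carrier_mat n m" and B: "B \<in> carrier_mat n m"
    and "\<And>v. v \<in> carrier_vec m \<Longrightarrow> A *\<^sub>v v = B *\<^sub>v v"
  shows "A = B"
proof (rule eq_matI)
  fix i j assume "i < dim_row B" "j < dim_col B"
  then have ij: "i < n" "j < m" using B by auto
  have "(A *\<^sub>v unit_vec m j) $ i = (B *\<^sub>v unit_vec m j) $ i" using assms(3) by simp
  then show "A $$ (i, j) = B $$ (i, j)" using A B ij by simp
qed (use A B in auto)

lemma zero_mat_mult_vec: "v \<in> carrier_vec m \<Longrightarrow> 0\<^sub>m n m *\<^sub>v v = (0\<^sub>v n :: 'a::semiring_0 vec)"
  by (intro eq_vecI) auto

lemma surj_mat_right_inverse:
  assumes A: "(A :: 'a::semiring_1 mat) \<in> carrier_mat n m" and surj: "(*\<^sub>v) A ` carrier_vec m = carrier_vec n"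
  obtains B where "B \<in> carrier_mat m n" "A * B = 1\<^sub>m n"
proof -
  have "\<forall>j. \<exists>v. v \<in> carrier_vec m \<and> A *\<^sub>v v = unit_vec n j"
    using surj by (metis (mono_tags, lifting) imageE unit_vec_carrier)
  then obtain f where f: "\<And>j. f j \<in> carrier_vec m" "\<And>j. A *\<^sub>v f j = unit_vec n j" by metis
  define B where "B = mat m n (\<lambda>(i, j). f j $ i)"
  have B: "B \<in> carrier_mat m n" by (simp add: B_def)
  have "A * B = 1\<^sub>m n"
  proof (rule eq_matI)
    fix i j assume "i < dim_row (1\<^sub>m n :: 'a mat)" "j < dim_col (1\<^sub>m n :: 'a mat)"
    then have ij: "i < n" "j < n" by auto
    have "(A * B) $$ (i, j) = (A *\<^sub>v f j) $ i"
      using ij unfolding mult_mat_entry[OF A B ij] mult_vec_entry[OF A f(1) ij(1)]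
      by (simp add: B_def)
    then show "(A * B) $$ (i, j) = (1\<^sub>m n :: 'a mat) $$ (i, j)"
      using ij unfolding f(2) by (simp add: unit_vec_def)
  qed (use A B in auto)
  then show ?thesis using that B by blast
qed

section \<open>Matrix representations of a finite group\<close>

locale finite_group = group G for G (structure) +
  assumes finite_carrier [simp]: "finite (carrier G)"
begin

abbreviation "rep \<equiv> representation G"

abbreviation "irrep \<equiv> irreducible_representation G"

lemma representationI:
  assumes "\<And>g. g \<in> carrier G \<Longrightarrow> R g \<in> carrier_mat n n"
    and "\<And>g h. g \<in> carrier G \<Longrightarrow> h \<in> carrier G \<Longrightarrow> R (g \<otimes> h) = R g * R h"
    and "R \<one> = 1\<^sub>m n"
  shows "rep n R"
  unfolding representation_def
proof (rule homI)
  fix g assume g: "g \<in> carrier G"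
  have "R g * R (inv g) = 1\<^sub>m n" "R (inv g) * R g = 1\<^sub>m n"
    using assms(2)[OF g inv_closed[OF g]] assms(2)[OF inv_closed[OF g] g] g assms(3) by simp_all
  then show "R g \<in> carrier (units_of (ring_mat TYPE(complex) n ()))"
    using assms(1)[OF g] assms(1)[OF inv_closed[OF g]]
    by (auto simp: units_of_carrier Units_def ring_mat_simps)
qed (use assms in \<open>auto simp: units_of_mult ring_mat_simps\<close>)

context
  fixes n R
  assumes R: "rep n R"
begin

lemma rep_carrier: "g \<in> carrier G \<Longrightarrow> R g \<in> carrier_mat n n"
  using R by (auto simp: representation_def hom_def units_of_carrier Units_def ring_mat_simps)

lemma rep_mult: "g \<in> carrier G \<Longrightarrow> h \<in> carrier G \<Longrightarrow> R (g \<otimes> h) = R g * R h"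
  using R by (auto simp: representation_def hom_def units_of_mult ring_mat_simps)

text \<open>Membership in \<open>hom\<close> asks for closure and multiplicativity, not for the
  unit. As \<open>R \<one>\<close> is idempotent and invertible, it is the identity.\<close>

lemma rep_one: "R \<one> = 1\<^sub>m n"
proof -
  have "R \<one> \<in> Units (ring_mat TYPE(complex) n ())"
    using R by (auto simp: representation_def hom_def units_of_carrier)
  then obtain B where B: "B \<in> carrier_mat n n" "B * R \<one> = 1\<^sub>m n"
    by (auto simp: Units_def ring_mat_simps)
  have "R \<one> * R \<one> = R \<one>" using rep_mult[of \<one> \<one>] by simp
  then have "B * (R \<one> * R \<one>) = B * R \<one>" by simp
  moreover have "B * (R \<one> * R \<one>) = (B * R \<one>) * R \<one>"
    using assoc_mult_mat[OF B(1) rep_carrier rep_carrier] by simp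
  ultimately show ?thesis using B(2) rep_carrier[of \<one>] by simp
qed

lemma rep_inv_left: "g \<in> carrier G \<Longrightarrow> R (inv g) * R g = 1\<^sub>m n"
  using rep_mult[of "inv g" g] rep_one by simp

lemma rep_inv_right: "g \<in> carrier G \<Longrightarrow> R g * R (inv g) = 1\<^sub>m n"
  using rep_mult[of g "inv g"] rep_one by simp

lemma character_of_eq_trace: "g \<in> carrier G \<Longrightarrow> character_of G n R g = trace (R g)"
  using rep_carrier[of g] by (simp add: character_of_def trace_def)

end

lemma irreducibleD:
  assumes "irrep n R"
  shows "rep n R" "n > 0"
    "\<And>W. vec_subspace n W \<Longrightarrow> (\<And>g w. g \<in> carrier G \<Longrightarrow> w \<in> W \<Longrightarrow> R g *\<^sub>v w \<in> W) \<Longrightarrow>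
      W = {0\<^sub>v n} \<or> W = carrier_vec n"
  using assms by (auto simp: irreducible_representation_def)

lemma sum_left_mult:
  assumes "h \<in> carrier G"
  shows "(\<Sum>g\<in>carrier G. f (h \<otimes> g)) = (\<Sum>g\<in>carrier G. f g)"
  by (rule sum.reindex_bij_witness[of _ "\<lambda>g. inv h \<otimes> g" "\<lambda>g. h \<otimes> g"])
    (use assms in \<open>auto simp: m_assoc[symmetric]\<close>)

lemma sum_right_mult:
  assumes "h \<in> carrier G"
  shows "(\<Sum>g\<in>carrier G. f (g \<otimes> h)) = (\<Sum>g\<in>carrier G. f g)"
  by (rule sum.reindex_bij_witness[of _ "\<lambda>g. g \<otimes> inv h" "\<lambda>g. g \<otimes> h"])
    (use assms in \<open>auto simp: m_assoc\<close>)

section \<open>Intertwiners and Schur's lemma\<close>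

definition average :: "nat \<Rightarrow> ('a \<Rightarrow> complex mat) \<Rightarrow> nat \<Rightarrow> ('a \<Rightarrow> complex mat) \<Rightarrow> complex mat \<Rightarrow> complex mat"
  where "average n R m R' A = mat_sum n m (\<lambda>g. R g * A * R' (inv g)) (carrier G)"

lemma average_carrier [simp]: "average n R m R' A \<in> carrier_mat n m"
  by (simp add: average_def)

text \<open>The summand at \<open>g\<close> multiplied by \<open>R h\<close> on the left is the
  summand at \<open>h \<otimes> g\<close> multiplied by \<open>R' h\<close> on the right, and
  translation by \<open>h\<close> permutes the group.\<close>

lemma average_intertwines:
  assumes R: "rep n R" and R': "rep m R'"
    and A: "A \<in> carrier_mat n m" and h: "h \<in> carrier G"
  shows "R h * average n R m R' A = average n R m R' A * R' h"
proof -
  note c = rep_carrier[OF R] rep_carrier[OF R']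
  have cF: "R g * A * R' k \<in> carrier_mat n m" if "g \<in> carrier G" "k \<in> carrier G" for g k
    using c(1)[OF that(1)] c(2)[OF that(2)] A by (meson mult_carrier_mat)
  let ?F = "\<lambda>g. R g * A * R' (inv g) * R' h"
  have "R h * average n R m R' A = mat_sum n m (\<lambda>g. R h * (R g * A * R' (inv g))) (carrier G)"
    unfolding average_def by (rule mult_mat_sum) (use c h A cF in auto)
  also have "\<dots> = mat_sum n m (\<lambda>g. ?F (h \<otimes> g)) (carrier G)"
  proof (rule mat_sum_cong)
    fix g assume g: "g \<in> carrier G"
    have X: "R h * R g * A \<in> carrier_mat n m"
      by (rule mult_carrier_mat[OF mult_carrier_mat[OF c(1)[OF h] c(1)[OF g]] A])
    have "?F (h \<otimes> g) = (R h * R g) * A * (R' (inv g) * R' (inv h)) * R' h"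
      using g h by (simp add: rep_mult[OF R] rep_mult[OF R'] inv_mult_group)
    also have "\<dots> = (R h * R g) * A * (R' (inv g) * (R' (inv h) * R' h))"
      using assoc_mult_mat[OF X mult_carrier_mat[OF c(2) c(2)] c(2)[OF h], of "inv g" "inv h"]
        assoc_mult_mat[OF c(2) c(2) c(2)[OF h], of "inv g" "inv h"] g h by simp
    also have "\<dots> = (R h * R g) * A * R' (inv g)"
      using c(2)[of "inv g"] g h by (simp add: rep_inv_left[OF R'])
    also have "\<dots> = R h * (R g * A * R' (inv g))"
      using c(1)[OF g] c(1)[OF h] c(2)[of "inv g"] g A
      by (simp add: assoc_mult_mat[of _ n n _ m _ m] assoc_mult_mat[of _ n n _ n _ m])
    finally show "R h * (R g * A * R' (inv g)) = ?F (h \<otimes> g)" ..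
  qed
  also have "\<dots> = mat_sum n m ?F (carrier G)"
    unfolding mat_sum_def using sum_left_mult[OF h, of "\<lambda>g. ?F g $$ _"] by (intro cong_mat) auto
  also have "\<dots> = average n R m R' A * R' h"
    unfolding average_def by (rule mat_sum_mult[symmetric]) (use c h cF in auto)
  finally show ?thesis .
qed

text \<open>The image of \<open>T\<close> is a nonzero invariant subspace for the irreducible
  \<open>R\<close>, so \<open>T\<close> is onto; preimages of the unit vectors are the columns of
  \<open>B\<close>.\<close>

lemma intertwiner_right_inverse:
  assumes R: "irrep n R" and R': "rep m R'"
    and T: "T \<in> carrier_mat n m" "T \<noteq> 0\<^sub>m n m"
    and int: "\<And>g. g \<in> carrier G \<Longrightarrow> R g * T = T * R' g"
  obtains B where "B \<in> carrier_mat m n" "T * B = 1\<^sub>m n"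
proof -
  note c = rep_carrier[OF irreducibleD(1)[OF R]] rep_carrier[OF R']
  let ?W = "(*\<^sub>v) T ` carrier_vec m"
  have "?W = {0\<^sub>v n} \<or> ?W = carrier_vec n"
  proof (rule irreducibleD(3)[OF R vec_subspace_image[OF T(1)]])
    fix g w assume g: "g \<in> carrier G" and "w \<in> ?W"
    then obtain v where v: "v \<in> carrier_vec m" "w = T *\<^sub>v v" by auto
    have "R g *\<^sub>v w = T *\<^sub>v (R' g *\<^sub>v v)"
      unfolding v(2) using assoc_mult_mat_vec[OF c(1)[OF g] T(1) v(1)] assoc_mult_mat_vec[OF T(1) c(2)[OF g] v(1)]
      by (simp only: int[OF g])
    then show "R g *\<^sub>v w \<in> ?W" using c(2)[OF g] v by auto
  qed
  moreover have "?W \<noteq> {0\<^sub>v n}"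
  proof
    assume W0: "?W = {0\<^sub>v n}"
    have "T = 0\<^sub>m n m"
    proof (rule mat_eq_of_mult_vec_eq[OF T(1)])
      fix v :: "complex vec" assume "v \<in> carrier_vec m"
      then have "T *\<^sub>v v = 0\<^sub>v n" and "0\<^sub>m n m *\<^sub>v v = 0\<^sub>v n"
        using W0 by (auto intro: zero_mat_mult_vec)
      then show "T *\<^sub>v v = 0\<^sub>m n m *\<^sub>v v" by simp
    qed simp
    then show False using T(2) by simp
  qed
  ultimately show ?thesis using surj_mat_right_inverse[OF T(1)] that by blast
qed

text \<open>The kernel of \<open>T\<close> is invariant under the irreducible \<open>R'\<close>, and
  it is not everything because \<open>T\<close> is nonzero.\<close>

lemma intertwiner_kernel_trivial:
  assumes R: "rep n R" and R': "irrep m R'"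
    and T: "T \<in> carrier_mat n m" "T \<noteq> 0\<^sub>m n m"
    and int: "\<And>g. g \<in> carrier G \<Longrightarrow> R g * T = T * R' g"
    and v: "v \<in> carrier_vec m" "T *\<^sub>v v = 0\<^sub>v n"
  shows "v = 0\<^sub>v m"
proof -
  note c = rep_carrier[OF R] rep_carrier[OF irreducibleD(1)[OF R']]
  let ?W = "{v \<in> carrier_vec m. T *\<^sub>v v = 0\<^sub>v n}"
  have "?W = {0\<^sub>v m} \<or> ?W = carrier_vec m"
  proof (rule irreducibleD(3)[OF R' vec_subspace_kernel[OF T(1)]])
    fix g w assume g: "g \<in> carrier G" and w: "w \<in> ?W"
    have "T *\<^sub>v (R' g *\<^sub>v w) = R g *\<^sub>v (T *\<^sub>v w)"
      using assoc_mult_mat_vec[OF c(1)[OF g] T(1), of w] assoc_mult_mat_vec[OF T(1) c(2)[OF g], of w] w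
      by (simp only: int[OF g]) simp
    also have "\<dots> = 0\<^sub>v n" using w c(1)[OF g] by (auto intro!: eq_vecI)
    finally show "R' g *\<^sub>v w \<in> ?W" using c(2)[OF g] w by auto
  qed
  moreover have "?W \<noteq> carrier_vec m"
  proof
    assume W: "?W = carrier_vec m"
    have "T = 0\<^sub>m n m"
    proof (rule mat_eq_of_mult_vec_eq[OF T(1)])
      fix v :: "complex vec" assume "v \<in> carrier_vec m"
      then have "T *\<^sub>v v = 0\<^sub>v n" and "0\<^sub>m n m *\<^sub>v v = 0\<^sub>v n"
        using W by (auto intro: zero_mat_mult_vec)
      then show "T *\<^sub>v v = 0\<^sub>m n m *\<^sub>v v" by simp
    qed simp
    then show False using T(2) by simp
  qed
  ultimately show ?thesis using v by auto
qed

text \<open>Irreducibility of \<open>R\<close> makes \<open>T\<close> onto, and irreducibility of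
  \<open>R'\<close> makes it one-to-one: from \<open>T (B T v - v) = 0\<close> the right inverse
  \<open>B\<close> is also a left inverse.\<close>

lemma schur_irreducible_same_degree:
  assumes R: "irrep n R" and R': "irrep m R'"
    and T: "T \<in> carrier_mat n m" "T \<noteq> 0\<^sub>m n m"
    and int: "\<And>g. g \<in> carrier G \<Longrightarrow> R g * T = T * R' g"
  shows "n = m"
proof -
  obtain B where B: "B \<in> carrier_mat m n" "T * B = 1\<^sub>m n"
    using intertwiner_right_inverse[OF R irreducibleD(1)[OF R'] T int] .
  have "B * T = 1\<^sub>m m"
  proof (rule mat_eq_of_mult_vec_eq)
    fix v :: "complex vec" assume v: "v \<in> carrier_vec m"
    have "T *\<^sub>v (B * T *\<^sub>v v - v) = T *\<^sub>v (B * T *\<^sub>v v) - T *\<^sub>v v"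
      by (rule mult_minus_distrib_mat_vec) (use T B v in auto)
    also have "T *\<^sub>v (B * T *\<^sub>v v) = (T * B) *\<^sub>v (T *\<^sub>v v)" using T B(1) v by simp
    finally have "T *\<^sub>v (B * T *\<^sub>v v - v) = 0\<^sub>v n" using B v T(1) by simp
    moreover have c: "B * T *\<^sub>v v \<in> carrier_vec m" using T B v by auto
    ultimately have z: "B * T *\<^sub>v v - v = 0\<^sub>v m"
      using intertwiner_kernel_trivial[OF irreducibleD(1)[OF R] R' T int, of "B * T *\<^sub>v v - v"] v
      by simp
    show "B * T *\<^sub>v v = 1\<^sub>m m *\<^sub>v v"
    proof (rule eq_vecI)
      fix i assume "i < dim_vec (1\<^sub>m m *\<^sub>v v)"
      then have i: "i < m" by simp
      have "(B * T *\<^sub>v v - v) $ i = 0" using z i by simp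
      then show "(B * T *\<^sub>v v) $ i = (1\<^sub>m m *\<^sub>v v) $ i" using i v c by (simp del: index_mult_mat_vec)
    qed (use B v in auto)
  qed (use T B in auto)
  then show ?thesis using right_inverse_mat_dim_le[OF T(1) B] right_inverse_mat_dim_le[OF B(1) T(1)] by simp
qed

lemma schur_invertible:
  assumes R: "irrep n R" and R': "rep n R'"
    and T: "T \<in> carrier_mat n n" "T \<noteq> 0\<^sub>m n n"
    and int: "\<And>g. g \<in> carrier G \<Longrightarrow> R g * T = T * R' g"
  obtains B where "B \<in> carrier_mat n n" "T * B = 1\<^sub>m n" "B * T = 1\<^sub>m n"
    "\<And>g. g \<in> carrier G \<Longrightarrow> trace (R g) = trace (R' g)"
proof -
  obtain B where B: "B \<in> carrier_mat n n" "T * B = 1\<^sub>m n"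
    using intertwiner_right_inverse[OF R R' T int] .
  have BT: "B * T = 1\<^sub>m n" by (rule mat_mult_left_right_inverse[OF T(1) B])
  have "trace (R g) = trace (R' g)" if g: "g \<in> carrier G" for g
  proof -
    note c = rep_carrier[OF irreducibleD(1)[OF R] g] rep_carrier[OF R' g]
    have "R g = R g * T * B" using c T(1) B by simp
    also have "\<dots> = T * (R' g * B)" unfolding int[OF g] using c T(1) B(1) by simp
    finally have "trace (R g) = trace (R' g * B * T)"
      using trace_mult_commute[of T n n "R' g * B"] c T(1) B(1) by simp
    then show ?thesis using c T(1) B(1) BT by simp
  qed
  then show ?thesis using that B BT by blast
qed

text \<open>Over the complex numbers \<open>T\<close> has an eigenvalue \<open>c\<close>. Then
  \<open>T - c\<close> is an intertwiner with a nonzero kernel, hence zero.\<close>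

lemma schur_scalar:
  assumes R: "irrep n R" and T: "T \<in> carrier_mat n n"
    and int: "\<And>g. g \<in> carrier G \<Longrightarrow> R g * T = T * R g"
  obtains c where "T = c \<cdot>\<^sub>m 1\<^sub>m n"
proof -
  note rc = rep_carrier[OF irreducibleD(1)[OF R]]
  have "spectrum T \<noteq> {}" using spectrum_non_empty[OF T] irreducibleD(2)[OF R] by simp
  then obtain c where "eigenvalue T c" by (auto simp: spectrum_def)
  then obtain v where v: "v \<in> carrier_vec n" "v \<noteq> 0\<^sub>v n" "T *\<^sub>v v = c \<cdot>\<^sub>v v"
    using T by (auto simp: eigenvalue_def eigenvector_def)
  define S where "S = T - c \<cdot>\<^sub>m 1\<^sub>m n"
  have S: "S \<in> carrier_mat n n" unfolding S_def by (intro minus_carrier_mat) simp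
  have intS: "R g * S = S * R g" if g: "g \<in> carrier G" for g
  proof -
    have "R g * S = R g * T - R g * (c \<cdot>\<^sub>m 1\<^sub>m n)"
      unfolding S_def by (rule mult_minus_distrib_mat) (use rc[OF g] T in auto)
    also have "R g * (c \<cdot>\<^sub>m 1\<^sub>m n) = c \<cdot>\<^sub>m 1\<^sub>m n * R g"
      using rc[OF g] mult_smult_distrib[OF rc[OF g] one_carrier_mat, of c]
        mult_smult_assoc_mat[OF one_carrier_mat rc[OF g], of c] by simp
    also have "R g * T - c \<cdot>\<^sub>m 1\<^sub>m n * R g = S * R g"
      unfolding S_def int[OF g] by (rule minus_mult_distrib_mat[symmetric]) (use rc[OF g] T in auto)
    finally show ?thesis .
  qed
  have "S *\<^sub>v v = T *\<^sub>v v - (c \<cdot>\<^sub>m 1\<^sub>m n) *\<^sub>v v"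
    unfolding S_def by (rule minus_mult_distrib_mat_vec) (use T v in auto)
  also have "(c \<cdot>\<^sub>m 1\<^sub>m n) *\<^sub>v v = c \<cdot>\<^sub>v v"
    using v(1) by (intro eq_vecI) auto
  finally have "S *\<^sub>v v = 0\<^sub>v n" using v by simp
  then have "S = 0\<^sub>m n n"
    using intertwiner_kernel_trivial[OF irreducibleD(1)[OF R] R S _ intS v(1)] v(2) by blast
  have "T = c \<cdot>\<^sub>m 1\<^sub>m n"
  proof (rule eq_matI)
    fix i j assume "i < dim_row (c \<cdot>\<^sub>m 1\<^sub>m n)" "j < dim_col (c \<cdot>\<^sub>m 1\<^sub>m n)"
    then have ij: "i < n" "j < n" by auto
    have "S $$ (i, j) = 0" using \<open>S = 0\<^sub>m n n\<close> ij by simp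
    then show "T $$ (i, j) = (c \<cdot>\<^sub>m 1\<^sub>m n) $$ (i, j)" using ij T by (simp add: S_def)
  qed (use T in auto)
  then show ?thesis by (rule that)
qed

end


section \<open>Orthogonality, complete reducibility and the regular character\<close>

lemma trace_one: "trace (1\<^sub>m n :: 'b::semiring_1 mat) = of_nat n"
  by (simp add: trace_def)

lemma sum_list_eq_sum_count:
  fixes f :: "'a \<Rightarrow> 'b::semiring_1"
  assumes "finite X" "set xs \<subseteq> X"
  shows "(\<Sum>x\<leftarrow>xs. f x) = (\<Sum>x\<in>X. of_nat (count_list xs x) * f x)"
  using assms(2)
proof (induction xs)
  case (Cons y xs)
  have "(\<Sum>x\<in>X. of_nat (count_list (y # xs) x) * f x) =
      (\<Sum>x\<in>X. (if x = y then f x else 0) + of_nat (count_list xs x) * f x)"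
    by (intro sum.cong) (auto simp: distrib_right)
  also have "\<dots> = f y + (\<Sum>x\<in>X. of_nat (count_list xs x) * f x)"
    using Cons.prems assms(1) by (simp add: sum.distrib sum.delta)
  finally show ?case using Cons by simp
qed simp

context finite_group
begin

lemma card_carrier_pos: "card (carrier G) > 0"
  using one_closed by (auto simp: card_gt_0_iff)

lemma carrier_nonempty [simp]: "carrier G \<noteq> {}"
  using one_closed by blast

section \<open>Orthogonality of matrix coefficients\<close>

definition unit_mat :: "nat \<Rightarrow> nat \<Rightarrow> nat \<Rightarrow> nat \<Rightarrow> complex mat"
  where "unit_mat n m j k = mat n m (\<lambda>(a, b). if a = j \<and> b = k then 1 else 0)"

lemma unit_mat_carrier [simp]: "unit_mat n m j k \<in> carrier_mat n m"
  by (simp add: unit_mat_def)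

text \<open>This is how Schur's lemma becomes a statement about coefficients: the entries of the
  intertwiner obtained from an elementary matrix are the sums in the orthogonality
  relations.\<close>

lemma average_elementary:
  assumes R: "rep n R" and R': "rep m R'"
    and "i < n" "j < n" "k < m" "l < m"
  shows "average n R m R' (unit_mat n m j k) $$ (i, l) =
    (\<Sum>g\<in>carrier G. R g $$ (i, j) * R' (inv g) $$ (k, l))"
  unfolding average_def mat_sum_index[OF assms(3,6)]
proof (rule sum.cong)
  fix g assume g: "g \<in> carrier G"
  let ?E = "unit_mat n m j k"
  have c: "R g \<in> carrier_mat n n" "R' (inv g) \<in> carrier_mat m m" "?E \<in> carrier_mat n m"
    using g rep_carrier[OF R] rep_carrier[OF R'] by auto
  have "(R g * ?E * R' (inv g)) $$ (i, l) = (\<Sum>b<m. (R g * ?E) $$ (i, b) * R' (inv g) $$ (b, l))"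
    by (rule mult_mat_entry[OF mult_carrier_mat[OF c(1,3)] c(2) assms(3,6)])
  also have "\<dots> = (\<Sum>b<m. if b = k then R g $$ (i, j) * R' (inv g) $$ (k, l) else 0)"
  proof (rule sum.cong)
    fix b assume "b \<in> {..<m}"
    then have b: "b < m" by simp
    have "(R g * ?E) $$ (i, b) = (\<Sum>a<n. R g $$ (i, a) * ?E $$ (a, b))"
      by (rule mult_mat_entry[OF c(1,3) assms(3) b])
    also have "\<dots> = (\<Sum>a<n. if a = j then (if b = k then R g $$ (i, j) else 0) else 0)"
      using b by (intro sum.cong) (auto simp: unit_mat_def)
    finally show "(R g * ?E) $$ (i, b) * R' (inv g) $$ (b, l) =
      (if b = k then R g $$ (i, j) * R' (inv g) $$ (k, l) else 0)"
      using assms(4) by (simp add: sum.delta)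
  qed simp
  finally show "(R g * ?E * R' (inv g)) $$ (i, l) = R g $$ (i, j) * R' (inv g) $$ (k, l)"
    using assms(5) by (simp add: sum.delta)
qed simp

lemma schur_orthogonality_distinct:
  assumes R: "irrep n R" and R': "irrep m R'"
    and ne: "character_of G n R \<noteq> character_of G m R'"
    and idx: "i < n" "j < n" "k < m" "l < m"
  shows "(\<Sum>g\<in>carrier G. R g $$ (i, j) * R' (inv g) $$ (k, l)) = 0"
proof -
  note r = irreducibleD(1)[OF R] irreducibleD(1)[OF R']
  let ?E = "unit_mat n m j k"
  define T where "T = average n R m R' ?E"
  have T: "T \<in> carrier_mat n m" by (simp add: T_def)
  have int: "R g * T = T * R' g" if "g \<in> carrier G" for g
    unfolding T_def by (rule average_intertwines[OF r _ that]) simp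
  have "T = 0\<^sub>m n m"
  proof (rule ccontr)
    assume nz: "T \<noteq> 0\<^sub>m n m"
    have nm: "n = m" by (rule schur_irreducible_same_degree[OF R R' T nz int])
    obtain B where "\<And>g. g \<in> carrier G \<Longrightarrow> trace (R g) = trace (R' g)"
      using schur_invertible[OF R r(2)[folded nm] T[folded nm] nz[folded nm] int] by blast
    then have "character_of G n R = character_of G m R'"
      using character_of_eq_trace[OF r(1)] character_of_eq_trace[OF r(2)]
      by (auto simp: character_of_def fun_eq_iff)
    then show False using ne by simp
  qed
  then show ?thesis using average_elementary[OF r idx] idx unfolding T_def by simp
qed

lemma schur_orthogonality_same:
  assumes R: "irrep n R" and idx: "i < n" "j < n" "k < n" "l < n"
  shows "(\<Sum>g\<in>carrier G. R g $$ (i, j) * R (inv g) $$ (k, l)) =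
    (if i = l \<and> j = k then of_nat (card (carrier G)) / of_nat n else 0)"
proof -
  note r = irreducibleD(1)[OF R]
  let ?E = "unit_mat n n j k"
  define T where "T = average n R n R ?E"
  have T: "T \<in> carrier_mat n n" by (simp add: T_def)
  have int: "R g * T = T * R g" if "g \<in> carrier G" for g
    unfolding T_def by (rule average_intertwines[OF r r _ that]) simp
  obtain c where c: "T = c \<cdot>\<^sub>m 1\<^sub>m n" by (rule schur_scalar[OF R T int])
  have idxT: "T $$ (i', l') = (\<Sum>g\<in>carrier G. R g $$ (i', j) * R (inv g) $$ (k, l'))" if "i' < n" "l' < n" for i' l'
    unfolding T_def by (rule average_elementary[OF r r that(1) idx(2,3) that(2)])
  \<comment> \<open>The scalar is found from the trace: summing over the diagonal contracts
    \<open>R (inv g) * R g\<close> to the identity, which leaves \<open>|G|\<close> when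
    \<open>j = k\<close> and 0 otherwise.\<close>
  have "of_nat n * c = (\<Sum>i'<n. T $$ (i', i'))" unfolding c by simp
  also have "\<dots> = (\<Sum>i'<n. \<Sum>g\<in>carrier G. R (inv g) $$ (k, i') * R g $$ (i', j))"
    by (intro sum.cong) (auto simp: idxT mult.commute)
  also have "\<dots> = (\<Sum>g\<in>carrier G. \<Sum>i'<n. R (inv g) $$ (k, i') * R g $$ (i', j))"
    by (rule sum.swap)
  also have "\<dots> = (\<Sum>g\<in>carrier G. (R (inv g) * R g) $$ (k, j))"
    by (intro sum.cong refl, subst mult_mat_entry[OF rep_carrier[OF r] rep_carrier[OF r] idx(3,2)]) auto
  also have "\<dots> = (\<Sum>g\<in>carrier G. if j = k then 1 else 0)"
    using idx by (intro sum.cong) (auto simp: rep_inv_left[OF r])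
  finally have nc: "of_nat n * c = (if j = k then of_nat (card (carrier G)) else 0)" by simp
  have "n > 0" by (rule irreducibleD(2)[OF R])
  then have "c = (if j = k then of_nat (card (carrier G)) / of_nat n else 0)"
    using nc by (auto simp: field_simps)
  moreover have "T $$ (i, l) = (if i = l then c else 0)" using idx c by simp
  ultimately show ?thesis using idxT[OF idx(1,4)] by simp
qed

text \<open>The matrices \<open>S\<close> and \<open>S'\<close> are carried along so that one
  expansion serves ordinary characters (both the identity) as well as traces twisted by the matrix
  that extends a representation to an involution.\<close>

lemma trace_pairing:
  assumes R: "rep n R" and R': "rep m R'"
    and S: "S \<in> carrier_mat n n" and S': "S' \<in> carrier_mat m m"
  shows "(\<Sum>g\<in>carrier G. trace (S * R g) * trace (R' (inv g) * S')) =
    (\<Sum>i<n. \<Sum>j<n. \<Sum>k<m. \<Sum>l<m. S $$ (i, j) * S' $$ (l, k) *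
      (\<Sum>g\<in>carrier G. R g $$ (j, i) * R' (inv g) $$ (k, l)))" (is "?L = ?R")
proof -
  have tr: "trace (A * B) = (\<Sum>i<n. \<Sum>j<n. A $$ (i, j) * B $$ (j, i))"
    if "A \<in> carrier_mat n n" "B \<in> carrier_mat n n" for A B :: "complex mat" and n
    using that by (simp add: trace_def mult_mat_entry[of A n n B n] del: index_mult_mat(1))
  have "?L = (\<Sum>g\<in>carrier G. \<Sum>i<n. \<Sum>j<n. \<Sum>k<m. \<Sum>l<m.
      S $$ (i, j) * S' $$ (l, k) * (R g $$ (j, i) * R' (inv g) $$ (k, l)))"
  proof (rule sum.cong)
    fix g assume g: "g \<in> carrier G"
    show "trace (S * R g) * trace (R' (inv g) * S') = (\<Sum>i<n. \<Sum>j<n. \<Sum>k<m. \<Sum>l<m.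
      S $$ (i, j) * S' $$ (l, k) * (R g $$ (j, i) * R' (inv g) $$ (k, l)))"
      unfolding tr[OF S rep_carrier[OF R g]] tr[OF rep_carrier[OF R' inv_closed[OF g]] S']
        sum_distrib_right unfolding sum_distrib_left by (simp add: mult_ac)
  qed simp
  also have "\<dots> = ?R"
    unfolding sum_distrib_left
    by (simp only: sum.swap[where A = "carrier G" and B = "{..<n}"] sum.swap[where A = "carrier G" and B = "{..<m}"])
  finally show ?thesis .
qed

lemma twisted_orthogonality_distinct:
  assumes R: "irrep n R" and R': "irrep m R'"
    and ne: "character_of G n R \<noteq> character_of G m R'"
    and S: "S \<in> carrier_mat n n" and S': "S' \<in> carrier_mat m m"
  shows "(\<Sum>g\<in>carrier G. trace (S * R g) * trace (R' (inv g) * S')) = 0"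
  unfolding trace_pairing[OF irreducibleD(1)[OF R] irreducibleD(1)[OF R'] S S']
  by (intro sum.neutral ballI) (simp add: schur_orthogonality_distinct[OF R R' ne])

lemma twisted_orthogonality_same:
  assumes R: "irrep n R"
    and S: "S \<in> carrier_mat n n" and S': "S' \<in> carrier_mat n n"
  shows "(\<Sum>g\<in>carrier G. trace (S * R g) * trace (R (inv g) * S')) =
    of_nat (card (carrier G)) / of_nat n * trace (S * S')"
proof -
  note r = irreducibleD(1)[OF R]
  let ?c = "of_nat (card (carrier G)) / of_nat n :: complex"
  have "(\<Sum>g\<in>carrier G. trace (S * R g) * trace (R (inv g) * S')) =
    (\<Sum>i<n. \<Sum>j<n. \<Sum>k<n. \<Sum>l<n. if l = j then if k = i then S $$ (i, j) * S' $$ (j, i) * ?c else 0 else 0)"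
    unfolding trace_pairing[OF r r S S']
    by (intro sum.cong refl) (simp add: schur_orthogonality_same[OF R])
  also have "\<dots> = (\<Sum>i<n. \<Sum>j<n. S $$ (i, j) * S' $$ (j, i) * ?c)"
    by (intro sum.cong refl) (simp add: sum.delta)
  also have "\<dots> = ?c * (\<Sum>i<n. \<Sum>j<n. S $$ (i, j) * S' $$ (j, i))"
    by (simp add: sum_distrib_left mult.commute)
  also have "(\<Sum>i<n. \<Sum>j<n. S $$ (i, j) * S' $$ (j, i)) = trace (S * S')"
    using S S' by (simp add: trace_def mult_mat_entry[OF S S'] del: index_mult_mat(1))
  finally show ?thesis .
qed

text \<open>If every intertwiner is zero, the averages of all elementary matrices vanish, hence all
  sums of products of coefficients, and with them the pairing of the traces.\<close>

lemma exists_intertwiner: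
  assumes R: "rep n R" and R': "rep m R'"
    and nz: "(\<Sum>g\<in>carrier G. trace (R g) * trace (R' (inv g))) \<noteq> 0"
  obtains T where "T \<in> carrier_mat n m" "T \<noteq> 0\<^sub>m n m" "\<And>g. g \<in> carrier G \<Longrightarrow> R g * T = T * R' g"
proof (rule ccontr)
  assume neg: "\<not> thesis"
  note thesisI = that
  have z: "(\<Sum>g\<in>carrier G. R g $$ (i, j) * R' (inv g) $$ (k, l)) = 0"
    if idx: "i < n" "j < n" "k < m" "l < m" for i j k l
  proof -
    let ?T = "average n R m R' (unit_mat n m j k)"
    have int: "\<And>g. g \<in> carrier G \<Longrightarrow> R g * ?T = ?T * R' g"
      by (rule average_intertwines[OF R R']) auto
    have "?T = 0\<^sub>m n m"
    proof (rule ccontr)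
      assume "?T \<noteq> 0\<^sub>m n m"
      then have thesis by (rule thesisI[OF average_carrier _ int])
      then show False using neg by contradiction
    qed
    then show ?thesis using average_elementary[OF R R' idx] idx by simp
  qed
  have "(\<Sum>g\<in>carrier G. trace (R g) * trace (R' (inv g))) =
    (\<Sum>g\<in>carrier G. trace (1\<^sub>m n * R g) * trace (R' (inv g) * 1\<^sub>m m))"
    by (intro sum.cong refl)
      (simp add: left_mult_one_mat[OF rep_carrier[OF R]] right_mult_one_mat[OF rep_carrier[OF R']])
  also have "\<dots> = 0"
    unfolding trace_pairing[OF R R' one_carrier_mat one_carrier_mat]
    by (intro sum.neutral ballI) (simp add: z)
  finally show False using nz by simp
qed

section \<open>Irreducible characters\<close>

lemma IrrE:
  assumes "\<chi> \<in> Irr G"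
  obtains n R where "irrep n R" "\<chi> = character_of G n R"
    "\<And>g. g \<in> carrier G \<Longrightarrow> \<chi> g = trace (R g)"
proof -
  obtain n R where *: "irrep n R" "\<chi> = character_of G n R"
    using assms by (auto simp: Irr_def)
  show ?thesis by (rule that[OF *]) (simp add: * character_of_eq_trace[OF irreducibleD(1)[OF *(1)]])
qed

lemma character_one: "rep n R \<Longrightarrow> trace (R \<one>) = of_nat n"
  by (simp add: rep_one trace_one)

lemma Irr_degree:
  assumes "\<chi> \<in> Irr G"
  obtains n where "n > 0" "\<chi> \<one> = of_nat n"
  using assms by (elim IrrE) (metis character_one irreducibleD(1,2) one_closed)

lemma Irr_orthogonality:
  assumes "\<chi> \<in> Irr G" "\<chi>' \<in> Irr G"
  shows "(\<Sum>g\<in>carrier G. \<chi> g * \<chi>' (inv g)) = (if \<chi> = \<chi>' then of_nat (card (carrier G)) else 0)"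
proof -
  obtain n R where R: "irrep n R" "\<chi> = character_of G n R"
    "\<And>g. g \<in> carrier G \<Longrightarrow> \<chi> g = trace (R g)" using IrrE[OF assms(1)] by metis
  obtain m R' where R': "irrep m R'" "\<chi>' = character_of G m R'"
    "\<And>g. g \<in> carrier G \<Longrightarrow> \<chi>' g = trace (R' g)" using IrrE[OF assms(2)] by metis
  note r = irreducibleD(1)[OF R(1)] irreducibleD(1)[OF R'(1)]
  have eq: "(\<Sum>g\<in>carrier G. \<chi> g * \<chi>' (inv g)) =
    (\<Sum>g\<in>carrier G. trace (1\<^sub>m n * R g) * trace (R' (inv g) * 1\<^sub>m m))"
    by (intro sum.cong refl)
      (simp add: R(3) R'(3) left_mult_one_mat[OF rep_carrier[OF r(1)]] right_mult_one_mat[OF rep_carrier[OF r(2)]])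
  show ?thesis
  proof (cases "\<chi> = \<chi>'")
    case False
    then show ?thesis
      unfolding eq using twisted_orthogonality_distinct[OF R(1) R'(1) _ one_carrier_mat one_carrier_mat] R(2) R'(2)
      by simp
  next
    case True
    have "(\<Sum>g\<in>carrier G. \<chi> g * \<chi>' (inv g)) =
      (\<Sum>g\<in>carrier G. trace (1\<^sub>m n * R g) * trace (R (inv g) * 1\<^sub>m n))"
      by (intro sum.cong refl) (simp add: R(3) True[symmetric] left_mult_one_mat[OF rep_carrier[OF r(1)]]
          right_mult_one_mat[OF rep_carrier[OF r(1)]])
    also have "\<dots> = of_nat (card (carrier G)) / of_nat n * trace (1\<^sub>m n * 1\<^sub>m n :: complex mat)"
      by (rule twisted_orthogonality_same[OF R(1) one_carrier_mat one_carrier_mat])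
    also have "\<dots> = of_nat (card (carrier G))"
      using irreducibleD(2)[OF R(1)] by (simp add: trace_one)
    finally show ?thesis using True by simp
  qed
qed

text \<open>
  The conjugate of the contragredient representation has a character whose pairing with \<open>\<chi>\<close> is
  \<open>\<Sum>|\<chi>(g)|\<^sup>2 > 0\<close>, so by Schur's lemma the two representations are equivalent.
\<close>

lemma Irr_cnj:
  assumes "\<chi> \<in> Irr G" and g: "g \<in> carrier G"
  shows "cnj (\<chi> g) = \<chi> (inv g)"
proof -
  obtain n R where R: "irrep n R" "\<chi> = character_of G n R"
    "\<And>g. g \<in> carrier G \<Longrightarrow> \<chi> g = trace (R g)" using IrrE[OF assms(1)] by metis
  note r = irreducibleD(1)[OF R(1)]
  note rc = rep_carrier[OF r]
  define R' where "R' g = mat n n (\<lambda>(i, j). cnj (R (inv g) $$ (j, i)))" for g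
  have c': "R' g \<in> carrier_mat n n" for g by (simp add: R'_def)
  have r': "rep n R'"
  proof (rule representationI[OF c'])
    fix g h assume gh: "g \<in> carrier G" "h \<in> carrier G"
    show "R' (g \<otimes> h) = R' g * R' h"
    proof (rule eq_matI)
      fix i j assume "i < dim_row (R' g * R' h)" "j < dim_col (R' g * R' h)"
      then have ij: "i < n" "j < n" by (simp_all add: R'_def)
      have ih: "inv h \<in> carrier G" "inv g \<in> carrier G" using gh by auto
      have "R' (g \<otimes> h) $$ (i, j) = cnj ((R (inv h) * R (inv g)) $$ (j, i))"
        using gh ij by (simp add: R'_def inv_mult_group rep_mult[OF r] del: index_mult_mat(1))
      also have "\<dots> = (R' g * R' h) $$ (i, j)"
        unfolding mult_mat_entry[OF rc[OF ih(1)] rc[OF ih(2)] ij(2,1)] mult_mat_entry[OF c' c' ij]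
        using ij by (simp add: R'_def mult.commute)
      finally show "R' (g \<otimes> h) $$ (i, j) = (R' g * R' h) $$ (i, j)" .
    qed (simp_all add: R'_def)
  next
    show "R' \<one> = 1\<^sub>m n" by (rule eq_matI) (auto simp: R'_def rep_one[OF r])
  qed
  have tr': "trace (R' g) = cnj (\<chi> (inv g))" if "g \<in> carrier G" for g
    using that rc[of "inv g"] by (simp add: R(3) trace_def R'_def)
  have "(\<Sum>g\<in>carrier G. trace (R g) * trace (R' (inv g))) =
    of_real (\<Sum>g\<in>carrier G. (cmod (\<chi> g))\<^sup>2)"
    unfolding of_real_sum by (intro sum.cong refl) (simp add: tr' R(3)[symmetric] complex_norm_square[symmetric])
  moreover have "(\<Sum>g\<in>carrier G. (cmod (\<chi> g))\<^sup>2) > 0"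
  proof (rule sum_pos2[of _ \<one>])
    show "0 < (cmod (\<chi> \<one>))\<^sup>2" using Irr_degree[OF assms(1)] by (metis norm_of_nat of_nat_0_less_iff zero_less_power)
  qed auto
  ultimately have "(\<Sum>g\<in>carrier G. trace (R g) * trace (R' (inv g))) \<noteq> 0"
    by (metis less_irrefl of_real_eq_0_iff)
  then obtain T where "T \<in> carrier_mat n n" "T \<noteq> 0\<^sub>m n n" "\<And>g. g \<in> carrier G \<Longrightarrow> R g * T = T * R' g"
    using exists_intertwiner[OF r r'] by blast
  then have "trace (R (inv g)) = trace (R' (inv g))"
    using schur_invertible[OF R(1) r'] g inv_closed by metis
  then show ?thesis using tr'[of "inv g"] R(3)[of "inv g"] g by simp
qed

lemma char_inner_Irr:
  assumes "\<chi> \<in> Irr G"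
  shows "char_inner G f \<chi> = (\<Sum>g\<in>carrier G. f g * \<chi> (inv g)) / of_nat (card (carrier G))"
  unfolding char_inner_def by (intro arg_cong2[where f = "(/)"] sum.cong refl) (simp add: Irr_cnj[OF assms])

text \<open>The average of the conjugates of an arbitrary projection \<open>V * U\<close> onto
  \<open>W\<close> commutes with the group. It still maps into \<open>W\<close> and fixes it
  pointwise, because each conjugate does so by invariance of \<open>W\<close>.\<close>

lemma maschke_projection:
  assumes R: "rep n R" and W: "vec_subspace n W"
    and inv: "\<And>g w. g \<in> carrier G \<Longrightarrow> w \<in> W \<Longrightarrow> R g *\<^sub>v w \<in> W"
  obtains E where "E \<in> carrier_mat n n" "\<And>g. g \<in> carrier G \<Longrightarrow> R g * E = E * R g"
    "\<And>v. v \<in> carrier_vec n \<Longrightarrow> E *\<^sub>v v \<in> W" "\<And>w. w \<in> W \<Longrightarrow> E *\<^sub>v w = w"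
proof -
  obtain r U V where U: "U \<in> carrier_mat r n" and V: "V \<in> carrier_mat n r"
    and VW: "\<And>v. v \<in> carrier_vec r \<Longrightarrow> V *\<^sub>v v \<in> W" and fixW: "\<And>w. w \<in> W \<Longrightarrow> V *\<^sub>v (U *\<^sub>v w) = w"
    by (rule vec_subspace_basis[OF W], rule that) simp_all
  note rc = rep_carrier[OF R]
  have Wc: "W \<subseteq> carrier_vec n" using W by (simp add: vec_subspace_iff)
  define P where "P = V * U"
  have P: "P \<in> carrier_mat n n" using U V by (simp add: P_def)
  define A where "A = average n R n R P"
  have A: "A \<in> carrier_mat n n" by (simp add: A_def)
  let ?N = "of_nat (card (carrier G)) :: complex"
  have N: "?N \<noteq> 0" using card_carrier_pos by simp
  define E where "E = inverse ?N \<cdot>\<^sub>m A"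
  have E: "E \<in> carrier_mat n n" using A by (simp add: E_def)
  have Ev: "E *\<^sub>v v = inverse ?N \<cdot>\<^sub>v (A *\<^sub>v v)" if "v \<in> carrier_vec n" for v
    using that A by (intro eq_vecI) (auto simp: E_def)
  have term_carrier: "R g * P * R (inv g) \<in> carrier_mat n n" if "g \<in> carrier G" for g
    using mult_carrier_mat[OF mult_carrier_mat[OF rc[OF that] P] rc[of "inv g"]] that by simp
  have term_vec: "(R g * P * R (inv g)) *\<^sub>v v = R g *\<^sub>v (V *\<^sub>v (U *\<^sub>v (R (inv g) *\<^sub>v v)))"
    if g: "g \<in> carrier G" and v: "v \<in> carrier_vec n" for g v
    using assoc_mult_mat_vec[OF mult_carrier_mat[OF rc[OF g] P] rc[OF inv_closed[OF g]] v]
      assoc_mult_mat_vec[OF rc[OF g] P, of "R (inv g) *\<^sub>v v"]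
      assoc_mult_mat_vec[OF V U, of "R (inv g) *\<^sub>v v"] mult_mat_vec_carrier[OF rc[OF inv_closed[OF g]] v]
    by (simp only: P_def)
  show ?thesis
  proof (rule that[OF E])
    fix g assume g: "g \<in> carrier G"
    show "R g * E = E * R g"
      using average_intertwines[OF R R P g] unfolding E_def mult_smult_distrib[OF rc[OF g] A] mult_smult_assoc_mat[OF A rc[OF g]]
      by (simp only: A_def)
  next
    fix v :: "complex vec" assume v: "v \<in> carrier_vec n"
    have "A *\<^sub>v v \<in> W"
      unfolding A_def average_def
    proof (rule mat_sum_mult_vec_in_subspace[OF W finite_carrier term_carrier v])
      fix g assume g: "g \<in> carrier G"
      have "U *\<^sub>v (R (inv g) *\<^sub>v v) \<in> carrier_vec r" using U rc[OF inv_closed[OF g]] v by simp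
      then show "(R g * P * R (inv g)) *\<^sub>v v \<in> W"
        unfolding term_vec[OF g v] by (intro inv g VW)
    qed
    then show "E *\<^sub>v v \<in> W" unfolding Ev[OF v] using W by (auto simp: vec_subspace_iff)
  next
    fix w assume w: "w \<in> W"
    then have wc: "w \<in> carrier_vec n" using Wc by auto
    have t: "(R g * P * R (inv g)) *\<^sub>v w = w" if g: "g \<in> carrier G" for g
    proof -
      have "(R g * P * R (inv g)) *\<^sub>v w = R g *\<^sub>v (R (inv g) *\<^sub>v w)"
        unfolding term_vec[OF g wc] by (subst fixW) (use inv[of "inv g" w] g w in auto)
      also have "\<dots> = (R g * R (inv g)) *\<^sub>v w"
        by (rule assoc_mult_mat_vec[symmetric]) (use rc g wc in auto)
      finally show ?thesis using wc by (simp add: rep_inv_right[OF R g])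
    qed
    show "E *\<^sub>v w = w"
    proof (rule eq_vecI)
      fix i assume "i < dim_vec w"
      then have i: "i < n" using wc by simp
      have "(A *\<^sub>v w) $ i = (\<Sum>g\<in>carrier G. ((R g * P * R (inv g)) *\<^sub>v w) $ i)"
        unfolding A_def average_def by (rule mat_sum_mult_vec_index[OF term_carrier wc i])
      also have "\<dots> = ?N * w $ i" by (simp add: t del: index_mult_mat_vec)
      finally show "(E *\<^sub>v w) $ i = w $ i"
        unfolding Ev[OF wc] using i A N by (simp del: index_mult_mat_vec)
    qed (use E wc in auto)
  qed
qed

text \<open>This is the subrepresentation on the image of \<open>E\<close>, written in the basis
  \<open>V\<close> as \<open>R' g = U * (R g * V)\<close>. The two dimension clauses serve an
  induction on the degree: a summand of full degree forces \<open>E\<close> to be the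
  identity.\<close>

lemma idempotent_summand:
  assumes R: "rep n R" and E: "E \<in> carrier_mat n n" and EE: "E * E = E"
    and com: "\<And>g. g \<in> carrier G \<Longrightarrow> R g * E = E * R g"
  obtains r R' where "rep r R'" "\<And>g. g \<in> carrier G \<Longrightarrow> trace (R' g) = trace (E * R g)"
    "r \<le> n" "r = n \<Longrightarrow> E = 1\<^sub>m n"
proof -
  note rc = rep_carrier[OF R]
  let ?W = "(*\<^sub>v) E ` carrier_vec n"
  obtain r U V where U: "U \<in> carrier_mat r n" and V: "V \<in> carrier_mat n r" and UV: "U * V = 1\<^sub>m r"
    and VW: "\<And>v. v \<in> carrier_vec r \<Longrightarrow> V *\<^sub>v v \<in> ?W" and fixW: "\<And>w. w \<in> ?W \<Longrightarrow> V *\<^sub>v (U *\<^sub>v w) = w"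
    by (rule vec_subspace_basis[OF vec_subspace_image[OF E]], rule that) simp_all
  have VU: "V * U \<in> carrier_mat n n" using U V by simp
  have Efix: "E *\<^sub>v w = w" if "w \<in> ?W" for w
    using that E EE by (auto simp: assoc_mult_mat_vec[OF E E, symmetric])
  have EV: "E * V = V"
  proof (rule mat_eq_of_mult_vec_eq)
    fix v :: "complex vec" assume v: "v \<in> carrier_vec r"
    show "E * V *\<^sub>v v = V *\<^sub>v v" using Efix[OF VW[OF v]] E V v by simp
  qed (use E V in auto)
  have VUE: "V * U * E = E"
  proof (rule mat_eq_of_mult_vec_eq)
    fix v :: "complex vec" assume v: "v \<in> carrier_vec n"
    show "V * U * E *\<^sub>v v = E *\<^sub>v v"
      using fixW[of "E *\<^sub>v v"] v
      by (simp add: assoc_mult_mat_vec[OF VU E v] assoc_mult_mat_vec[OF V U mult_mat_vec_carrier[OF E v]])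
  qed (use E U V in auto)
  \<comment> \<open>\<open>V * U\<close> fixes the image of \<open>E\<close>, and
    \<open>R g * V = E * (R g * V)\<close> lies in that image because \<open>R g\<close> commutes
    with \<open>E\<close>. This makes \<open>R'\<close> multiplicative.\<close>
  have VUg: "V * U * (R g * V) = R g * V" if g: "g \<in> carrier G" for g
  proof -
    have gE: "R g * V = E * (R g * V)"
      by (metis EV com[OF g] assoc_mult_mat[OF rc[OF g] E V] assoc_mult_mat[OF E rc[OF g] V])
    have "V * U * (E * (R g * V)) = V * U * E * (R g * V)"
      by (rule assoc_mult_mat[symmetric]) (use U V E rc[OF g] in auto)
    then show ?thesis using gE VUE by simp
  qed
  define R' where "R' g = U * (R g * V)" for g
  have r': "rep r R'"
  proof (rule representationI)
    fix g assume g: "g \<in> carrier G"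
    show "R' g \<in> carrier_mat r r" unfolding R'_def using U V rc[OF g] by simp
  next
    fix g h assume g: "g \<in> carrier G" and h: "h \<in> carrier G"
    have hV: "R h * V \<in> carrier_mat n r" using rc[OF h] V by simp
    have "R' g * R' h = U * (R g * V * (U * (R h * V)))"
      unfolding R'_def by (rule assoc_mult_mat) (use U V rc[OF g] rc[OF h] in auto)
    also have "R g * V * (U * (R h * V)) = R g * (V * (U * (R h * V)))"
      by (rule assoc_mult_mat) (use U V rc[OF g] rc[OF h] in auto)
    also have "V * (U * (R h * V)) = R h * V"
      using VUg[OF h] assoc_mult_mat[OF V U hV] by simp
    also have "R g * (R h * V) = R (g \<otimes> h) * V"
      using assoc_mult_mat[OF rc[OF g] rc[OF h] V] by (simp add: rep_mult[OF R g h])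
    finally show "R' (g \<otimes> h) = R' g * R' h" by (simp add: R'_def)
  next
    show "R' \<one> = 1\<^sub>m r" using V UV by (simp add: R'_def rep_one[OF R])
  qed
  have tr: "trace (R' g) = trace (E * R g)" if g: "g \<in> carrier G" for g
  proof -
    have gc: "R g * V \<in> carrier_mat n r" using rc[OF g] V by simp
    have "trace (R' g) = trace (R g * V * U)"
      unfolding R'_def by (rule trace_mult_commute[OF U gc])
    also have "R g * V * U = R g * (V * U)" by (rule assoc_mult_mat[OF rc[OF g] V U])
    also have "\<dots> = R g * (E * V * U)" using EV by simp
    also have "\<dots> = R g * (E * (V * U))" using assoc_mult_mat[OF E V U] by simp
    also have "\<dots> = R g * E * (V * U)" by (rule assoc_mult_mat[OF rc[OF g] E VU, symmetric])
    also have "trace \<dots> = trace (V * U * (R g * E))"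
      by (rule trace_mult_commute[OF mult_carrier_mat[OF rc[OF g] E] VU])
    also have "V * U * (R g * E) = V * U * E * R g"
      unfolding com[OF g] by (rule assoc_mult_mat[OF VU E rc[OF g], symmetric])
    finally show ?thesis using VUE by simp
  qed
  have "E = 1\<^sub>m n" if "r = n"
  proof -
    have "V * U = 1\<^sub>m n" using mat_mult_left_right_inverse[OF U[unfolded that] V[unfolded that]] UV that by simp
    moreover have "E * (V * U) = V * U" using EV assoc_mult_mat[OF E V U] by simp
    ultimately show ?thesis using E by simp
  qed
  then show ?thesis using that r' tr right_inverse_mat_dim_le[OF U V UV] by blast
qed

text \<open>Induction on the degree: a proper invariant subspace gives a commuting idempotent
  \<open>E\<close>, and neither \<open>E\<close> nor \<open>1 - E\<close> is the identity, so both
  summands have smaller degree. The constituents form a list so that multiplicities are values of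
  \<open>count_list\<close>.\<close>

lemma character_decomposition:
  assumes "rep n R"
  shows "\<exists>xs. set xs \<subseteq> Irr G \<and> (\<forall>g\<in>carrier G. trace (R g) = (\<Sum>\<chi>\<leftarrow>xs. \<chi> g))"
  using assms
proof (induction n arbitrary: R rule: less_induct)
  case (less n)
  note R = less.prems and rc = rep_carrier[OF less.prems]
  consider "n = 0" | "irrep n R" | "n > 0" "\<not> irrep n R" by blast
  then show ?case
  proof cases
    case 1
    then have "\<forall>g\<in>carrier G. trace (R g) = (\<Sum>\<chi>\<leftarrow>[]. \<chi> g)"
      using carrier_matD(1)[OF rc] by (simp add: trace_def)
    then show ?thesis by (intro exI[of _ "[]"]) simp
  next
    case 2
    then have "character_of G n R \<in> Irr G" by (auto simp: Irr_def)
    then show ?thesis using character_of_eq_trace[OF R] by (intro exI[of _ "[character_of G n R]"]) simp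
  next
    case 3
    then obtain W where W: "vec_subspace n W" "\<And>g w. g \<in> carrier G \<Longrightarrow> w \<in> W \<Longrightarrow> R g *\<^sub>v w \<in> W"
      and ne: "W \<noteq> {0\<^sub>v n}" "W \<noteq> carrier_vec n"
      using R by (auto simp: irreducible_representation_def)
    have Wc: "W \<subseteq> carrier_vec n" "0\<^sub>v n \<in> W" using W(1) by (simp_all add: vec_subspace_iff)
    obtain E where E: "E \<in> carrier_mat n n" and com: "\<And>g. g \<in> carrier G \<Longrightarrow> R g * E = E * R g"
      and EW: "\<And>v. v \<in> carrier_vec n \<Longrightarrow> E *\<^sub>v v \<in> W" and Efix: "\<And>w. w \<in> W \<Longrightarrow> E *\<^sub>v w = w"
      by (rule maschke_projection[OF R W(1)], rule W(2), assumption+, rule that) simp_all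
    have EE: "E * E = E"
      by (rule mat_eq_of_mult_vec_eq[of _ n n]) (use E EW Efix in \<open>auto simp: assoc_mult_mat_vec[OF E E]\<close>)
    have E1: "E \<noteq> 1\<^sub>m n" using EW ne(2) Wc by (metis one_mult_mat_vec subsetI subset_antisym)
    define F where "F = 1\<^sub>m n - E"
    have F: "F \<in> carrier_mat n n" unfolding F_def by (rule minus_carrier_mat[OF E])
    have EF: "E * F = 0\<^sub>m n n" unfolding F_def
      using mult_minus_distrib_mat[OF E one_carrier_mat E] E EE by simp
    have FF: "F * F = F"
    proof -
      have "F * F = 1\<^sub>m n * F - E * F" 
        using minus_mult_distrib_mat[OF one_carrier_mat E F] by (simp add: F_def[symmetric])
      also have "\<dots> = F" unfolding EF using F by (intro eq_matI) auto
      finally show ?thesis .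
    qed
    have Fm: "F * R g = R g - E * R g" if "g \<in> carrier G" for g
      unfolding F_def using minus_mult_distrib_mat[OF one_carrier_mat E rc[OF that]] rc[OF that] by simp
    have comF: "R g * F = F * R g" if g: "g \<in> carrier G" for g
      unfolding Fm[OF g] com[OF g, symmetric] unfolding F_def
      using mult_minus_distrib_mat[OF rc[OF g] one_carrier_mat E] rc[OF g] by simp
    have F1: "F \<noteq> 1\<^sub>m n"
    proof
      assume "F = 1\<^sub>m n"
      then have E0: "E = 0\<^sub>m n n" using EF E by simp
      obtain w where "w \<in> W" "w \<noteq> 0\<^sub>v n" using ne(1) Wc by auto
      then show False using Efix[of w] Wc zero_mat_mult_vec[of w n n] unfolding E0 by auto
    qed
    obtain r1 R1 where 1: "rep r1 R1" "\<And>g. g \<in> carrier G \<Longrightarrow> trace (R1 g) = trace (E * R g)" "r1 < n"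
      using idempotent_summand[OF R E EE com] E1 by (metis le_neq_implies_less)
    obtain r2 R2 where 2: "rep r2 R2" "\<And>g. g \<in> carrier G \<Longrightarrow> trace (R2 g) = trace (F * R g)" "r2 < n"
      using idempotent_summand[OF R F FF comF] F1 by (metis le_neq_implies_less)
    obtain xs where xs: "set xs \<subseteq> Irr G" "\<forall>g\<in>carrier G. trace (R1 g) = (\<Sum>\<chi>\<leftarrow>xs. \<chi> g)"
      using less.IH[OF 1(3,1)] by blast
    obtain ys where ys: "set ys \<subseteq> Irr G" "\<forall>g\<in>carrier G. trace (R2 g) = (\<Sum>\<chi>\<leftarrow>ys. \<chi> g)"
      using less.IH[OF 2(3,1)] by blast
    have "trace (R g) = (\<Sum>\<chi>\<leftarrow>xs @ ys. \<chi> g)" if g: "g \<in> carrier G" for g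
    proof -
      have "trace (F * R g) = trace (R g) - trace (E * R g)"
        unfolding Fm[OF g] by (rule trace_minus) (use E rc[OF g] in auto)
      then show ?thesis using 1(2)[OF g] 2(2)[OF g] xs(2) ys(2) g by simp
    qed
    then show ?thesis using xs(1) ys(1) by (intro exI[of _ "xs @ ys"]) auto
  qed
qed

lemma sum_list_Irr_orthogonality:
  assumes "set xs \<subseteq> Irr G" "\<psi> \<in> Irr G"
  shows "(\<Sum>g\<in>carrier G. (\<Sum>\<chi>\<leftarrow>xs. \<chi> g) * \<psi> (inv g)) = of_nat (card (carrier G)) * of_nat (count_list xs \<psi>)"
  using assms(1)
proof (induction xs)
  case (Cons \<chi> xs)
  then show ?case using Irr_orthogonality[of \<chi> \<psi>] assms(2)
    by (simp add: sum.distrib distrib_right distrib_left)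
qed simp

text \<open>The regular representation has trace \<open>|G|\<close> at the unit and 0 elsewhere,
  since \<open>e i = g \<otimes> e i\<close> forces \<open>g = \<one>\<close>. Pairing with
  \<open>\<chi>\<close> shows that \<open>\<chi>\<close> occurs \<open>\<chi> \<one>\<close> times;
  this is positive, so the finite list of constituents contains every irreducible character.\<close>

lemma regular_character:
  shows finite_Irr: "finite (Irr G)"
    and sum_Irr_regular: "\<And>g. g \<in> carrier G \<Longrightarrow>
      (\<Sum>\<chi>\<in>Irr G. \<chi> \<one> * \<chi> g) = (if g = \<one> then of_nat (card (carrier G)) else 0)"
proof -
  define N where "N = card (carrier G)"
  obtain e where e: "bij_betw e {0..<N} (carrier G)"
    using ex_bij_betw_nat_finite[OF finite_carrier] unfolding N_def by blast
  have ec: "e i \<in> carrier G" if "i < N" for i using e that by (auto simp: bij_betw_def)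
  have einj: "e i = e j \<longleftrightarrow> i = j" if "i < N" "j < N" for i j
    using e that by (auto simp: bij_betw_def inj_on_def)
  have esurj: "\<exists>l<N. e l = x" if "x \<in> carrier G" for x using e that by (force simp: bij_betw_def)
  define R where "R g = mat N N (\<lambda>(i, j). if e i = g \<otimes> e j then 1 else 0 :: complex)" for g
  have c: "R g \<in> carrier_mat N N" for g by (simp add: R_def)
  have r: "rep N R"
  proof (rule representationI[OF c])
    fix g h assume gh: "g \<in> carrier G" "h \<in> carrier G"
    show "R (g \<otimes> h) = R g * R h"
    proof (rule eq_matI)
      fix i j assume "i < dim_row (R g * R h)" "j < dim_col (R g * R h)"
      then have ij: "i < N" "j < N" by (simp_all add: R_def)
      obtain k where k: "k < N" "e k = h \<otimes> e j" using esurj[of "h \<otimes> e j"] gh ec ij by auto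
      have "(R g * R h) $$ (i, j) = (\<Sum>l<N. R g $$ (i, l) * R h $$ (l, j))"
        by (rule mult_mat_entry[OF c c ij])
      also have "\<dots> = (\<Sum>l<N. if l = k then R g $$ (i, l) else 0)"
        using ij k(1) by (intro sum.cong) (auto simp: R_def k(2)[symmetric] einj)
      also have "\<dots> = R g $$ (i, k)" using k by (simp add: sum.delta)
      also have "\<dots> = R (g \<otimes> h) $$ (i, j)"
        using ij k gh ec by (simp add: R_def m_assoc)
      finally show "R (g \<otimes> h) $$ (i, j) = (R g * R h) $$ (i, j)" ..
    qed (simp_all add: R_def)
  next
    show "R \<one> = 1\<^sub>m N" by (rule eq_matI) (auto simp: R_def ec einj)
  qed
  have tr: "trace (R g) = (if g = \<one> then of_nat N else 0)" if g: "g \<in> carrier G" for g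
  proof -
    have "trace (R g) = (\<Sum>i<N. if g = \<one> then 1 else 0)"
      unfolding trace_def using g ec by (intro sum.cong) (auto simp: R_def r_cancel_one')
    then show ?thesis by simp
  qed
  obtain xs where xs: "set xs \<subseteq> Irr G" "\<And>g. g \<in> carrier G \<Longrightarrow> trace (R g) = (\<Sum>\<chi>\<leftarrow>xs. \<chi> g)"
    using character_decomposition[OF r] by blast
  have cnt: "of_nat (count_list xs \<chi>) = \<chi> \<one>" if \<chi>: "\<chi> \<in> Irr G" for \<chi>
  proof -
    have "of_nat N * of_nat (count_list xs \<chi>) = (\<Sum>g\<in>carrier G. trace (R g) * \<chi> (inv g))"
      using sum_list_Irr_orthogonality[OF xs(1) \<chi>] xs(2) by (simp add: N_def)
    also have "\<dots> = (\<Sum>g\<in>carrier G. if g = \<one> then of_nat N * \<chi> (inv g) else 0)"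
      by (intro sum.cong) (simp_all add: tr)
    also have "\<dots> = of_nat N * \<chi> \<one>" by (simp add: sum.delta)
    finally show ?thesis using card_carrier_pos by (simp add: N_def)
  qed
  have "\<chi> \<in> set xs" if \<chi>: "\<chi> \<in> Irr G" for \<chi>
  proof (rule ccontr)
    assume "\<chi> \<notin> set xs"
    then have "\<chi> \<one> = 0" using cnt[OF \<chi>] by (simp add: count_notin)
    then show False using Irr_degree[OF \<chi>] by (metis of_nat_eq_0_iff less_irrefl)
  qed
  then have Irr: "Irr G = set xs" using xs(1) by auto
  then show fin: "finite (Irr G)" by simp
  fix g assume g: "g \<in> carrier G"
  have "(\<Sum>\<chi>\<in>Irr G. \<chi> \<one> * \<chi> g) = (\<Sum>\<chi>\<in>Irr G. of_nat (count_list xs \<chi>) * \<chi> g)"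
    by (intro sum.cong) (simp_all add: cnt)
  also have "\<dots> = trace (R g)"
    unfolding xs(2)[OF g] by (rule sum_list_eq_sum_count[symmetric]) (use fin xs in auto)
  finally show "(\<Sum>\<chi>\<in>Irr G. \<chi> \<one> * \<chi> g) = (if g = \<one> then of_nat (card (carrier G)) else 0)"
    using tr[OF g] by (simp add: N_def)
qed

text \<open>The sum \<open>M\<close> of the matrices \<open>f g\<close> times
  \<open>R (inv g)\<close> commutes with the representation because \<open>f\<close> is constant on
  conjugacy classes, so it is a scalar \<open>c\<close>. Both sides equal
  \<open>c * \<chi> \<one> * \<chi> h\<close>.\<close>

lemma Irr_class_function_convolution:
  assumes \<chi>: "\<chi> \<in> Irr G" and f: "\<And>g h. g \<in> carrier G \<Longrightarrow> h \<in> carrier G \<Longrightarrow> f (h \<otimes> g \<otimes> inv h) = f g"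
    and h: "h \<in> carrier G"
  shows "(\<Sum>g\<in>carrier G. f g * \<chi> (h \<otimes> inv g)) * \<chi> \<one> = (\<Sum>g\<in>carrier G. f g * \<chi> (inv g)) * \<chi> h"
proof -
  obtain n R where R: "irrep n R" "\<chi> = character_of G n R"
    "\<And>g. g \<in> carrier G \<Longrightarrow> \<chi> g = trace (R g)" using IrrE[OF \<chi>] by metis
  note r = irreducibleD(1)[OF R(1)]
  note rc = rep_carrier[OF r]
  let ?F = "\<lambda>g. f g \<cdot>\<^sub>m R (inv g)"
  have F: "?F g \<in> carrier_mat n n" if "g \<in> carrier G" for g using rc that by simp
  define M where "M = mat_sum n n ?F (carrier G)"
  have M: "M \<in> carrier_mat n n" by (simp add: M_def)
  have "R x * M = M * R x" if x: "x \<in> carrier G" for x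
  proof -
    have "R x * M = mat_sum n n (\<lambda>g. R x * ?F g) (carrier G)"
      unfolding M_def by (rule mult_mat_sum[OF rc[OF x] F])
    also have "\<dots> = mat_sum n n (\<lambda>g. ?F (x \<otimes> g \<otimes> inv x) * R x) (carrier G)"
    proof (rule mat_sum_cong)
      fix g assume g: "g \<in> carrier G"
      have "R x * ?F g = f g \<cdot>\<^sub>m R (x \<otimes> inv g)"
        using mult_smult_distrib[OF rc[OF x] rc[of "inv g"]] g x by (simp add: rep_mult[OF r])
      also have "x \<otimes> inv g = inv (x \<otimes> g \<otimes> inv x) \<otimes> x"
        using g x by (simp add: inv_mult_group m_assoc)
      also have "f g \<cdot>\<^sub>m R \<dots> = ?F (x \<otimes> g \<otimes> inv x) * R x"
        using mult_smult_assoc_mat[OF rc[of "inv (x \<otimes> g \<otimes> inv x)"] rc[OF x]] g x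
        by (simp add: rep_mult[OF r] f)
      finally show "R x * ?F g = ?F (x \<otimes> g \<otimes> inv x) * R x" .
    qed
    also have "\<dots> = mat_sum n n (\<lambda>g. ?F g * R x) (carrier G)"
    proof -
      have "(\<Sum>g\<in>carrier G. k (x \<otimes> g \<otimes> inv x)) = (\<Sum>g\<in>carrier G. k g)" for k :: "'a \<Rightarrow> complex"
        using sum_left_mult[OF x, of "\<lambda>y. k (y \<otimes> inv x)"] sum_right_mult[of "inv x" k] x by simp
      from this[of "\<lambda>g. (?F g * R x) $$ _"] show ?thesis unfolding mat_sum_def by (intro cong_mat) auto
    qed
    also have "\<dots> = M * R x" unfolding M_def by (rule mat_sum_mult[symmetric, OF F rc[OF x]])
    finally show ?thesis .
  qed
  then obtain c where c: "M = c \<cdot>\<^sub>m 1\<^sub>m n" using schur_scalar[OF R(1) M] by blast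
  have tr: "(\<Sum>g\<in>carrier G. f g * \<chi> (x \<otimes> inv g)) = c * \<chi> x" if x: "x \<in> carrier G" for x
  proof -
    have "c * \<chi> x = trace (R x * M)"
      unfolding c using mult_smult_distrib[OF rc[OF x] one_carrier_mat, of c] rc[OF x]
      by (simp add: R(3)[OF x] trace_smult[OF rc[OF x]])
    also have "\<dots> = (\<Sum>g\<in>carrier G. trace (R x * ?F g))"
    proof -
      have "R x * M = mat_sum n n (\<lambda>g. R x * ?F g) (carrier G)"
        unfolding M_def by (rule mult_mat_sum[OF rc[OF x] F])
      then show ?thesis
        by (simp only:) (rule trace_mat_sum, rule mult_carrier_mat[OF rc[OF x] F])
    qed
    also have "\<dots> = (\<Sum>g\<in>carrier G. f g * \<chi> (x \<otimes> inv g))"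
    proof (rule sum.cong)
      fix g assume g: "g \<in> carrier G"
      then have "R x * ?F g = f g \<cdot>\<^sub>m R (x \<otimes> inv g)"
        using mult_smult_distrib[OF rc[OF x] rc[of "inv g"]] x by (simp add: rep_mult[OF r])
      then show "trace (R x * ?F g) = f g * \<chi> (x \<otimes> inv g)"
        using trace_smult[OF rc[of "x \<otimes> inv g"]] g x by (simp add: R(3))
    qed simp
    finally show ?thesis ..
  qed
  have "(\<Sum>g\<in>carrier G. f g * \<chi> (inv g)) = (\<Sum>g\<in>carrier G. f g * \<chi> (\<one> \<otimes> inv g))"
    by (intro sum.cong) auto
  then have "(\<Sum>g\<in>carrier G. f g * \<chi> (inv g)) = c * \<chi> \<one>" using tr[OF one_closed] by simp
  then show ?thesis using tr[OF h] by simp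
qed

end


section \<open>Additive characters, and twisted conjugacy in groups of odd order\<close>

context finite_group
begin

text \<open>By Schur's lemma each \<open>R g\<close> is a scalar, so the line spanned by the first
  unit vector, which is the image of \<open>A\<close>, is invariant and nonzero, hence the whole
  space.\<close>

lemma Irr_comm_degree_one:
  assumes comm: "\<And>x y. x \<in> carrier G \<Longrightarrow> y \<in> carrier G \<Longrightarrow> x \<otimes> y = y \<otimes> x"
    and R: "irrep n R"
  shows "n = 1"
proof -
  note r = irreducibleD(1)[OF R]
  note rc = rep_carrier[OF r]
  define A :: "complex mat" where "A = mat n 1 (\<lambda>(i, j). if i = 0 then 1 else 0)"
  have A: "A \<in> carrier_mat n 1" by (simp add: A_def)
  have n: "n > 0" by (rule irreducibleD(2)[OF R])
  let ?W = "(*\<^sub>v) A ` carrier_vec 1"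
  have "?W = {0\<^sub>v n} \<or> ?W = carrier_vec n"
  proof (rule irreducibleD(3)[OF R vec_subspace_image[OF A]])
    fix g w assume g: "g \<in> carrier G" and w: "w \<in> ?W"
    have wc: "w \<in> carrier_vec n" using w A by auto
    have "R h * R g = R g * R h" if "h \<in> carrier G" for h
      using comm[OF g that] rep_mult[OF r g that] rep_mult[OF r that g] by simp
    then obtain c where "R g = c \<cdot>\<^sub>m 1\<^sub>m n" using schur_scalar[OF R rc[OF g]] by blast
    then have "R g *\<^sub>v w = c \<cdot>\<^sub>v w" using wc by (intro eq_vecI) auto
    then show "R g *\<^sub>v w \<in> ?W" using vec_subspace_image[OF A] w by (auto simp: vec_subspace_iff)
  qed
  moreover have "?W \<noteq> {0\<^sub>v n}"
  proof
    assume "?W = {0\<^sub>v n}"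
    then have "A *\<^sub>v unit_vec 1 0 = 0\<^sub>v n" by (metis imageI singletonD unit_vec_carrier)
    then have "(A *\<^sub>v unit_vec 1 0) $ 0 = 0" using n by simp
    then show False using n by (simp add: A_def)
  qed
  ultimately obtain B where "B \<in> carrier_mat 1 n" "A * B = 1\<^sub>m n"
    using surj_mat_right_inverse[OF A] by blast
  then have "n \<le> 1" using right_inverse_mat_dim_le[OF A] by blast
  then show ?thesis using n by simp
qed

lemma Irr_comm_eq:
  assumes comm: "\<And>x y. x \<in> carrier G \<Longrightarrow> y \<in> carrier G \<Longrightarrow> x \<otimes> y = y \<otimes> x"
  shows "Irr G = {\<kappa> \<in> extensional (carrier G). \<kappa> \<one> = 1 \<and>
    (\<forall>x\<in>carrier G. \<forall>y\<in>carrier G. \<kappa> (x \<otimes> y) = \<kappa> x * \<kappa> y)}"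
proof (intro equalityI subsetI CollectI conjI ballI)
  fix \<chi> assume "\<chi> \<in> Irr G"
  then obtain n R where R: "irrep n R" "\<chi> = character_of G n R"
    "\<And>g. g \<in> carrier G \<Longrightarrow> \<chi> g = trace (R g)" using IrrE by metis
  note r = irreducibleD(1)[OF R(1)]
  have n: "n = 1" by (rule Irr_comm_degree_one[OF comm R(1)])
  have c: "R g \<in> carrier_mat 1 1" if "g \<in> carrier G" for g using rep_carrier[OF r that] n by simp
  have val: "\<chi> g = R g $$ (0, 0)" if "g \<in> carrier G" for g
    using R(3)[OF that] c[OF that] by (simp add: trace_def)
  show "\<chi> \<in> extensional (carrier G)" using R(2) by (simp add: character_of_def)
  show "\<chi> \<one> = 1" using val[OF one_closed] n by (simp add: rep_one[OF r])
  fix x y assume xy: "x \<in> carrier G" "y \<in> carrier G"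
  have "(R x * R y) $$ (0, 0) = (\<Sum>l<1. R x $$ (0, l) * R y $$ (l, 0))"
    by (rule mult_mat_entry[OF c c]) (use xy in auto)
  then show "\<chi> (x \<otimes> y) = \<chi> x * \<chi> y" using xy by (simp add: val rep_mult[OF r] del: index_mult_mat(1))
next
  fix \<kappa> :: "'a \<Rightarrow> complex" assume "\<kappa> \<in> {\<kappa> \<in> extensional (carrier G). \<kappa> \<one> = 1 \<and>
    (\<forall>x\<in>carrier G. \<forall>y\<in>carrier G. \<kappa> (x \<otimes> y) = \<kappa> x * \<kappa> y)}"
  then have \<kappa>: "\<kappa> \<in> extensional (carrier G)" "\<kappa> \<one> = 1"
    "\<And>x y. x \<in> carrier G \<Longrightarrow> y \<in> carrier G \<Longrightarrow> \<kappa> (x \<otimes> y) = \<kappa> x * \<kappa> y" by auto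
  define R :: "'a \<Rightarrow> complex mat" where "R g = mat 1 1 (\<lambda>_. \<kappa> g)" for g
  have c: "R g \<in> carrier_mat 1 1" for g by (simp add: R_def)
  have r: "rep 1 R"
    by (rule representationI[OF c]; rule eq_matI) (auto simp: R_def \<kappa> scalar_prod_def)
  have "irrep 1 R"
    unfolding irreducible_representation_def
  proof (intro conjI allI impI r)
    fix W assume "vec_subspace 1 W \<and> (\<forall>g\<in>carrier G. \<forall>w\<in>W. R g *\<^sub>v w \<in> W)"
    then have W: "W \<subseteq> carrier_vec 1" "0\<^sub>v 1 \<in> W" "\<And>c v. v \<in> W \<Longrightarrow> c \<cdot>\<^sub>v v \<in> W"
      by (auto simp: vec_subspace_iff)
    show "W = {0\<^sub>v 1} \<or> W = carrier_vec 1"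
    proof (cases "W = {0\<^sub>v 1}")
      case False
      then obtain w where w: "w \<in> W" "w \<noteq> 0\<^sub>v 1" using W(2) by auto
      have wc: "w \<in> carrier_vec 1" using w W by auto
      have w0: "w $ 0 \<noteq> 0"
      proof
        assume "w $ 0 = 0"
        then have "w = 0\<^sub>v 1" using wc by (intro eq_vecI) auto
        then show False using w by simp
      qed
      have "v \<in> W" if v: "v \<in> carrier_vec 1" for v
      proof -
        have "v = (v $ 0 / w $ 0) \<cdot>\<^sub>v w" using v wc w0 by (intro eq_vecI) auto
        then show ?thesis using W(3)[OF w(1)] by metis
      qed
      then show ?thesis using W(1) by auto
    qed simp
  qed simp
  moreover have "\<kappa> = character_of G 1 R"
    using \<kappa>(1) by (intro ext) (auto simp: character_of_def R_def extensional_def)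
  ultimately show "\<kappa> \<in> Irr G" unfolding Irr_def by blast
qed

end

section \<open>The dual of a finite additive group\<close>

definition additive_group :: "'a::ring_1 set \<Rightarrow> 'a monoid"
  where "additive_group J = \<lparr>carrier = J, monoid.mult = (+), one = 0\<rparr>"

locale finite_additive_subgroup =
  fixes J :: "'a::ring_1 set"
  assumes finite_J [simp]: "finite J" and zero_J [simp]: "0 \<in> J"
    and add_J [simp]: "\<And>a b. a \<in> J \<Longrightarrow> b \<in> J \<Longrightarrow> a + b \<in> J"
    and minus_J [simp]: "\<And>a. a \<in> J \<Longrightarrow> - a \<in> J"
begin

lemma diff_J [simp]: "a \<in> J \<Longrightarrow> b \<in> J \<Longrightarrow> a - b \<in> J"
  using add_J[of a "- b"] by simp

sublocale add: finite_group "additive_group J"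
  by unfold_locales
    (auto simp: additive_group_def Units_def add.assoc intro!: bexI[of _ "- _"])

text \<open>This carries finiteness, orthogonality and the regular character over to additive
  characters. For multiplicative maps, being nowhere zero, as in \<open>dual_group\<close>, and
  having value 1 at 0 are equivalent.\<close>

lemma dual_group_eq_Irr: "dual_group J = Irr (additive_group J)"
proof -
  have I: "Irr (additive_group J) = {\<kappa> \<in> extensional J. \<kappa> 0 = 1 \<and> (\<forall>x\<in>J. \<forall>y\<in>J. \<kappa> (x + y) = \<kappa> x * \<kappa> y)}"
    by (subst add.Irr_comm_eq) (auto simp: additive_group_def add.commute)
  show ?thesis
  proof (intro equalityI subsetI)
    fix \<kappa> assume \<kappa>: "\<kappa> \<in> dual_group J"
    have e: "\<kappa> \<in> extensional J" "\<forall>x\<in>J. \<forall>y\<in>J. \<kappa> (x + y) = \<kappa> x * \<kappa> y" and nz: "\<kappa> 0 \<noteq> 0"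
      using \<kappa> zero_J unfolding dual_group_def PiE_def Pi_def by simp_all
    have "\<kappa> (0 + 0) = \<kappa> 0 * \<kappa> 0" using e(2) zero_J by blast
    then have "\<kappa> 0 = 1" using nz by simp
    then show "\<kappa> \<in> Irr (additive_group J)" unfolding I using e by simp
  next
    fix \<kappa> assume "\<kappa> \<in> Irr (additive_group J)"
    then have e: "\<kappa> \<in> extensional J" "\<kappa> 0 = 1" "\<forall>x\<in>J. \<forall>y\<in>J. \<kappa> (x + y) = \<kappa> x * \<kappa> y"
      unfolding I by simp_all
    have "\<kappa> x \<noteq> 0" if "x \<in> J" for x
    proof
      assume "\<kappa> x = 0"
      moreover have "\<kappa> (x + - x) = \<kappa> x * \<kappa> (- x)" using e(3) that minus_J by blast
      ultimately show False using e(2) by simp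
    qed
    then show "\<kappa> \<in> dual_group J" unfolding dual_group_def PiE_def Pi_def using e by simp
  qed
qed

lemma dual_add: "\<kappa> \<in> dual_group J \<Longrightarrow> a \<in> J \<Longrightarrow> b \<in> J \<Longrightarrow> \<kappa> (a + b) = \<kappa> a * \<kappa> b"
  by (auto simp: dual_group_def)

lemma dual_extensional: "\<kappa> \<in> dual_group J \<Longrightarrow> \<kappa> \<in> extensional J"
  by (auto simp: dual_group_def PiE_def)

lemma dual_nonzero: "\<kappa> \<in> dual_group J \<Longrightarrow> a \<in> J \<Longrightarrow> \<kappa> a \<noteq> 0"
  by (auto simp: dual_group_def)

lemma dual_zero: "\<kappa> \<in> dual_group J \<Longrightarrow> \<kappa> 0 = 1"
  using dual_add[of \<kappa> 0 0] dual_nonzero[of \<kappa> 0] by simp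

lemma dual_diff: "\<kappa> \<in> dual_group J \<Longrightarrow> a \<in> J \<Longrightarrow> b \<in> J \<Longrightarrow> \<kappa> (a - b) = \<kappa> a * \<kappa> (- b)"
  using dual_add[of \<kappa> a "- b"] by simp

lemma finite_dual [simp]: "finite (dual_group J)"
  unfolding dual_group_eq_Irr by (rule add.finite_Irr)

lemma additive_group_inv: "a \<in> J \<Longrightarrow> inv\<^bsub>additive_group J\<^esub> a = - a"
  by (rule add.inv_equality) (auto simp: additive_group_def)

lemma dual_orthogonality:
  assumes "\<kappa> \<in> dual_group J" "\<mu> \<in> dual_group J"
  shows "(\<Sum>a\<in>J. \<kappa> a * \<mu> (- a)) = (if \<kappa> = \<mu> then of_nat (card J) else 0)"
proof -
  have "(\<Sum>a\<in>J. \<kappa> a * \<mu> (- a)) = (\<Sum>a\<in>carrier (additive_group J). \<kappa> a * \<mu> (inv\<^bsub>additive_group J\<^esub> a))"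
    by (intro sum.cong) (auto simp: additive_group_def additive_group_inv[unfolded additive_group_def])
  then show ?thesis
    using add.Irr_orthogonality[of \<kappa> \<mu>] assms unfolding dual_group_eq_Irr by (simp add: additive_group_def)
qed

lemma sum_dual:
  assumes "a \<in> J"
  shows "(\<Sum>\<kappa>\<in>dual_group J. \<kappa> a) = (if a = 0 then of_nat (card J) else 0)"
proof -
  have "(\<Sum>\<kappa>\<in>dual_group J. \<kappa> a) = (\<Sum>\<kappa>\<in>Irr (additive_group J). \<kappa> \<one>\<^bsub>additive_group J\<^esub> * \<kappa> a)"
    unfolding dual_group_eq_Irr[symmetric] by (intro sum.cong) (auto simp: additive_group_def dual_zero)
  then show ?thesis using add.sum_Irr_regular[of a] assms by (simp add: additive_group_def)
qed

end

section \<open>Groups of odd order with an involution, and twisted conjugation\<close>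

locale odd_group_involution = finite_group +
  fixes \<tau> :: "'a \<Rightarrow> 'a"
  assumes odd_card: "odd (card (carrier G))"
    and \<tau>_closed [simp]: "\<And>x. x \<in> carrier G \<Longrightarrow> \<tau> x \<in> carrier G"
    and \<tau>_mult: "\<And>x y. x \<in> carrier G \<Longrightarrow> y \<in> carrier G \<Longrightarrow> \<tau> (x \<otimes> y) = \<tau> x \<otimes> \<tau> y"
    and \<tau>_\<tau> [simp]: "\<And>x. x \<in> carrier G \<Longrightarrow> \<tau> (\<tau> x) = x"
begin

lemma \<tau>_one [simp]: "\<tau> \<one> = \<one>"
  using \<tau>_mult[of \<one> \<one>] by (metis \<tau>_closed l_cancel_one' one_closed r_one)

lemma \<tau>_inv: "x \<in> carrier G \<Longrightarrow> \<tau> (inv x) = inv (\<tau> x)"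
  using \<tau>_mult[of "inv x" x] by (intro inv_equality[symmetric]) auto

definition fixed where "fixed = {x \<in> carrier G. \<tau> x = x}"

definition fixed_group where "fixed_group = G\<lparr>carrier := fixed\<rparr>"

lemma fixed_subset: "x \<in> fixed \<Longrightarrow> x \<in> carrier G" and fixed_\<tau>: "x \<in> fixed \<Longrightarrow> \<tau> x = x"
  by (auto simp: fixed_def)

lemma fixed_subgroup: "subgroup fixed G"
  by (rule subgroupI) (auto simp: fixed_def \<tau>_mult \<tau>_inv intro!: exI[of _ \<one>])

sublocale fixed: finite_group fixed_group
  rewrites "carrier fixed_group = fixed" and "monoid.mult fixed_group = monoid.mult G" and "one fixed_group = one G"
proof -
  show "finite_group fixed_group"
    unfolding fixed_group_def finite_group_def finite_group_axioms_def
    using subgroup.subgroup_is_group[OF fixed_subgroup is_group]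
    by (auto intro: finite_subset[OF _ finite_carrier] simp: fixed_def)
qed (simp_all add: fixed_group_def)

lemma fixed_finite [simp]: "finite fixed"
  using finite_subset[OF _ finite_carrier] by (auto simp: fixed_def)

lemma fixed_inv: "x \<in> fixed \<Longrightarrow> inv\<^bsub>fixed_group\<^esub> x = inv x"
  unfolding fixed_group_def by (rule m_inv_consistent[OF fixed_subgroup])

lemma fixed_inv_closed [simp]: "x \<in> fixed \<Longrightarrow> inv x \<in> fixed"
  using subgroup.m_inv_closed[OF fixed_subgroup] .

lemma fixed_mult_closed [simp]: "x \<in> fixed \<Longrightarrow> y \<in> fixed \<Longrightarrow> x \<otimes> y \<in> fixed"
  using subgroup.m_closed[OF fixed_subgroup] .

text \<open>When the order is \<open>2 * k + 1\<close>, squaring is inverted by the power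
  \<open>k + 1\<close>.\<close>

lemma square_inj:
  assumes "x \<in> carrier G" "y \<in> carrier G" "x \<otimes> x = y \<otimes> y"
  shows "x = y"
proof -
  obtain k where k: "Coset.order G = 2 * k + 1" using odd_card by (auto simp: Coset.order_def elim: oddE)
  have "z = (z \<otimes> z) [^] (k + 1)" if z: "z \<in> carrier G" for z
  proof -
    have "(z \<otimes> z) [^] (k + 1) = (z [^] (2::nat)) [^] (k + 1)"
      using z by (simp add: numeral_2_eq_2 nat_pow_Suc)
    also have "\<dots> = z [^] (2 * (k + 1))" using z by (rule nat_pow_pow)
    also have "\<dots> = z [^] Coset.order G \<otimes> z" using z by (simp add: k nat_pow_mult[symmetric] m_assoc)
    also have "\<dots> = z" using z by (simp add: pow_order_eq_1)
    finally show ?thesis by simp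
  qed
  then show ?thesis using assms by metis
qed

text \<open>In the semidirect product with \<open>\<tau>\<close>, conjugating the coset element
  \<open>\<tau> c\<close> by \<open>x\<close> gives \<open>\<tau>\<close> times this
  element.\<close>

definition twisted_conj where "twisted_conj p = inv (\<tau> (fst p)) \<otimes> snd p \<otimes> fst p"

lemma twisted_conj_closed: "p \<in> carrier G \<times> fixed \<Longrightarrow> twisted_conj p \<in> carrier G"
  by (auto simp: twisted_conj_def fixed_subset)

text \<open>For \<open>g = inv (\<tau> x) \<otimes> c \<otimes> x\<close> the product
  \<open>\<tau> g \<otimes> g\<close> is the square of \<open>inv x \<otimes> c \<otimes> x\<close>.
  Square roots are unique, so \<open>g\<close> determines
  \<open>inv x \<otimes> c \<otimes> x\<close> and then \<open>inv (\<tau> x) \<otimes> x\<close>.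
  Two elements \<open>x\<close> and \<open>y\<close> that agree in the latter differ by a fixed
  factor \<open>z = y \<otimes> inv x\<close>.\<close>

lemma twisted_conj_fibre:
  assumes x: "x \<in> carrier G" and c: "c \<in> fixed"
  shows "{p \<in> carrier G \<times> fixed. twisted_conj p = twisted_conj (x, c)} =
    (\<lambda>z. (z \<otimes> x, z \<otimes> c \<otimes> inv z)) ` fixed" (is "?A = ?B")
proof (intro equalityI subsetI)
  fix p assume "p \<in> ?A"
  then obtain y d where p: "p = (y, d)" and y: "y \<in> carrier G" and d: "d \<in> fixed"
    and eq: "inv (\<tau> y) \<otimes> d \<otimes> y = inv (\<tau> x) \<otimes> c \<otimes> x"
    by (cases p) (auto simp: twisted_conj_def)
  have cd: "c \<in> carrier G" "d \<in> carrier G" "\<tau> c = c" "\<tau> d = d"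
    using c d by (auto simp: fixed_subset fixed_\<tau>)
  have sq: "\<tau> (inv (\<tau> u) \<otimes> e \<otimes> u) \<otimes> (inv (\<tau> u) \<otimes> e \<otimes> u) = (inv u \<otimes> e \<otimes> u) \<otimes> (inv u \<otimes> e \<otimes> u)"
    if "u \<in> carrier G" "e \<in> carrier G" "\<tau> e = e" for u e
  proof -
    have "\<tau> (inv (\<tau> u) \<otimes> e \<otimes> u) = inv u \<otimes> e \<otimes> \<tau> u" using that by (simp add: \<tau>_mult \<tau>_inv)
    then have "\<tau> (inv (\<tau> u) \<otimes> e \<otimes> u) \<otimes> (inv (\<tau> u) \<otimes> e \<otimes> u) = inv u \<otimes> e \<otimes> (\<tau> u \<otimes> inv (\<tau> u)) \<otimes> e \<otimes> u"
      using that by (simp add: m_assoc del: r_inv Units_r_inv)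
    also have "\<dots> = inv u \<otimes> e \<otimes> (u \<otimes> inv u) \<otimes> e \<otimes> u" using that by simp
    also have "\<dots> = (inv u \<otimes> e \<otimes> u) \<otimes> (inv u \<otimes> e \<otimes> u)" using that by (simp add: m_assoc del: r_inv Units_r_inv)
    finally show ?thesis .
  qed
  have eq1: "inv y \<otimes> d \<otimes> y = inv x \<otimes> c \<otimes> x"
    by (rule square_inj) (use sq[OF y cd(2,4)] sq[OF x cd(1,3)] eq x y cd in auto)
  have split: "inv (\<tau> u) \<otimes> e \<otimes> u = (inv (\<tau> u) \<otimes> u) \<otimes> (inv u \<otimes> e \<otimes> u)"
    if "u \<in> carrier G" "e \<in> carrier G" for u e
  proof -
    have "(inv (\<tau> u) \<otimes> u) \<otimes> (inv u \<otimes> e \<otimes> u) = inv (\<tau> u) \<otimes> (u \<otimes> inv u) \<otimes> e \<otimes> u"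
      using that by (simp add: m_assoc del: r_inv Units_r_inv)
    then show ?thesis using that by simp
  qed
  have "(inv (\<tau> y) \<otimes> y) \<otimes> (inv x \<otimes> c \<otimes> x) = (inv (\<tau> x) \<otimes> x) \<otimes> (inv x \<otimes> c \<otimes> x)"
    using eq split[OF y cd(2)] split[OF x cd(1)] eq1 by simp
  then have eq2: "inv (\<tau> y) \<otimes> y = inv (\<tau> x) \<otimes> x" using x y cd by simp
  define z where "z = y \<otimes> inv x"
  have zc: "z \<in> carrier G" using x y by (simp add: z_def)
  have "\<tau> y \<otimes> (inv (\<tau> y) \<otimes> y) \<otimes> inv x = \<tau> y \<otimes> (inv (\<tau> x) \<otimes> x) \<otimes> inv x" using eq2 by simp
  moreover have "\<tau> y \<otimes> (inv (\<tau> y) \<otimes> y) = y" using x y by (simp add: m_assoc[symmetric])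
  moreover have "\<tau> y \<otimes> (inv (\<tau> x) \<otimes> x) \<otimes> inv x = \<tau> y \<otimes> inv (\<tau> x)" using x y by (simp add: m_assoc)
  ultimately have "\<tau> z = z" using x y by (simp add: z_def \<tau>_mult \<tau>_inv)
  then have z: "z \<in> fixed" using zc by (simp add: fixed_def)
  have "z \<otimes> x = y" using x y by (simp add: z_def m_assoc)
  moreover have "z \<otimes> c \<otimes> inv z = d"
  proof -
    have "z \<otimes> c \<otimes> inv z = y \<otimes> (inv x \<otimes> c \<otimes> x) \<otimes> inv y"
      using x y cd by (simp add: z_def inv_mult_group m_assoc)
    also have "\<dots> = y \<otimes> (inv y \<otimes> d \<otimes> y) \<otimes> inv y" by (simp add: eq1)
    also have "\<dots> = (y \<otimes> inv y) \<otimes> d \<otimes> (y \<otimes> inv y)" using y cd by (simp add: m_assoc del: r_inv Units_r_inv)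
    finally show ?thesis using y cd by simp
  qed
  ultimately show "p \<in> ?B" using z p by (intro image_eqI[of _ _ z]) auto
next
  fix p assume "p \<in> ?B"
  then obtain z where z: "z \<in> fixed" and p: "p = (z \<otimes> x, z \<otimes> c \<otimes> inv z)" by auto
  have zc: "z \<in> carrier G" "\<tau> z = z" "c \<in> carrier G" using z c by (auto simp: fixed_subset fixed_\<tau>)
  have "twisted_conj p = inv (\<tau> x) \<otimes> (inv z \<otimes> z) \<otimes> c \<otimes> (inv z \<otimes> z) \<otimes> x"
    using zc x by (simp add: twisted_conj_def p \<tau>_mult inv_mult_group m_assoc del: l_inv Units_l_inv)
  also have "\<dots> = twisted_conj (x, c)" using zc x by (simp add: twisted_conj_def)
  finally show "p \<in> ?A" using p z zc x c by auto
qed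

lemma card_twisted_conj_fibre:
  assumes "g \<in> twisted_conj ` (carrier G \<times> fixed)"
  shows "card {p \<in> carrier G \<times> fixed. twisted_conj p = g} = card fixed"
proof -
  obtain x c where xc: "x \<in> carrier G" "c \<in> fixed" "g = twisted_conj (x, c)" using assms by auto
  have "inj_on (\<lambda>z. (z \<otimes> x, z \<otimes> c \<otimes> inv z)) fixed"
    using xc(1) by (intro inj_onI) (auto simp: fixed_subset)
  then show ?thesis unfolding xc(3) twisted_conj_fibre[OF xc(1,2)] by (rule card_image)
qed

text \<open>All nonempty fibres have \<open>card fixed\<close> elements and the domain has
  \<open>card (carrier G) * card fixed\<close>, so the image is as large as the group: every element
  is a twisted conjugate of a fixed point.\<close>

lemma sum_twisted_conj:
  fixes F :: "'a \<Rightarrow> complex"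
  shows "(\<Sum>p\<in>carrier G \<times> fixed. F (twisted_conj p)) = of_nat (card fixed) * (\<Sum>g\<in>carrier G. F g)"
proof -
  let ?D = "carrier G \<times> fixed"
  have fin: "finite ?D" by simp
  have gen: "(\<Sum>p\<in>?D. f (twisted_conj p)) = (\<Sum>g\<in>twisted_conj ` ?D. of_nat (card fixed) * f g)"
    for f :: "'a \<Rightarrow> complex"
  proof -
    have "(\<Sum>p\<in>?D. f (twisted_conj p)) =
        (\<Sum>g\<in>twisted_conj ` ?D. \<Sum>p\<in>{p \<in> ?D. twisted_conj p = g}. f (twisted_conj p))"
      by (rule sum.image_gen[OF fin])
    also have "\<dots> = (\<Sum>g\<in>twisted_conj ` ?D. of_nat (card fixed) * f g)"
      by (intro sum.cong refl) (simp add: card_twisted_conj_fibre)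
    finally show ?thesis .
  qed
  have "fixed \<noteq> {}" using subgroup.one_closed[OF fixed_subgroup] by auto
  moreover have "of_nat (card ?D) = (of_nat (card (twisted_conj ` ?D)) * of_nat (card fixed) :: complex)"
    using gen[of "\<lambda>_. 1"] by simp
  ultimately have "card (twisted_conj ` ?D) = card (carrier G)"
    by (simp add: card_cartesian_product flip: of_nat_mult)
  moreover have "twisted_conj ` ?D \<subseteq> carrier G" using twisted_conj_closed by auto
  ultimately have "twisted_conj ` ?D = carrier G" by (intro card_subset_eq) auto
  then show ?thesis unfolding gen by (simp add: sum_distrib_left)
qed

lemma sum_twisted_class_function:
  fixes F :: "'a \<Rightarrow> complex"
  assumes "\<And>x c. x \<in> carrier G \<Longrightarrow> c \<in> fixed \<Longrightarrow> F (inv (\<tau> x) \<otimes> c \<otimes> x) = F c"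
  shows "of_nat (card fixed) * (\<Sum>g\<in>carrier G. F g) = of_nat (card (carrier G)) * (\<Sum>c\<in>fixed. F c)"
proof -
  have "(\<Sum>p\<in>carrier G \<times> fixed. F (twisted_conj p)) = (\<Sum>p\<in>carrier G \<times> fixed. F (snd p))"
    by (intro sum.cong) (auto simp: twisted_conj_def assms)
  also have "\<dots> = (\<Sum>x\<in>carrier G. \<Sum>c\<in>fixed. F c)"
    unfolding sum.cartesian_product by (simp only: case_prod_unfold)
  finally show ?thesis unfolding sum_twisted_conj by simp
qed

end


section \<open>The Glauberman correspondence for an involution\<close>

text \<open>Meant for the coefficients of a virtual character of norm one, which is therefore an
  irreducible character up to sign.\<close>

lemma sum_squares_int_eq_one:
  fixes f :: "'a \<Rightarrow> int"
  assumes "finite A" "(\<Sum>a\<in>A. f a * f a) = 1"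
  obtains a where "a \<in> A" "odd (f a)" "\<And>b. b \<in> A \<Longrightarrow> b \<noteq> a \<Longrightarrow> f b = 0"
proof -
  have "\<exists>a\<in>A. f a \<noteq> 0"
  proof (rule ccontr)
    assume "\<not> (\<exists>a\<in>A. f a \<noteq> 0)"
    then have "(\<Sum>a\<in>A. f a * f a) = 0" by (intro sum.neutral) simp
    then show False using assms(2) by simp
  qed
  then obtain a where a: "a \<in> A" "f a \<noteq> 0" by blast
  have split: "f a * f a + (\<Sum>b\<in>A - {a}. f b * f b) = 1"
    using sum.remove[OF assms(1) a(1), of "\<lambda>b. f b * f b"] assms(2) by simp
  have nn: "(\<Sum>b\<in>A - {a}. f b * f b) \<ge> 0" by (intro sum_nonneg) simp
  have "f a * f a > 0" using a(2) by (simp flip: power2_eq_square)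
  then have 1: "f a * f a = 1" and z: "(\<Sum>b\<in>A - {a}. f b * f b) = 0" using split nn by linarith+
  have "\<forall>b\<in>A - {a}. f b * f b = 0"
    using z assms(1) by (subst (asm) sum_nonneg_eq_0_iff) auto
  moreover have "odd (f a)" using 1 by (metis even_mult_iff odd_one)
  ultimately show ?thesis using that a(1) by auto
qed

context odd_group_involution
begin

abbreviation "IrrC \<equiv> Irr fixed_group"

lemma fixed_representation: "rep n R \<Longrightarrow> representation fixed_group n R"
  by (rule fixed.representationI) (auto simp: rep_carrier rep_mult rep_one fixed_subset)

lemma fixed_Irr_orthogonality:
  "\<psi> \<in> IrrC \<Longrightarrow> \<psi>' \<in> IrrC \<Longrightarrow>
    (\<Sum>c\<in>fixed. \<psi> c * \<psi>' (inv c)) = (if \<psi> = \<psi>' then of_nat (card fixed) else 0)"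
  using fixed.Irr_orthogonality[of \<psi> \<psi>'] by (simp add: fixed_inv)

lemma representation_\<tau>: "rep n R \<Longrightarrow> rep n (\<lambda>x. R (\<tau> x))"
  by (rule representationI) (simp_all add: rep_carrier \<tau>_mult rep_mult rep_one)

text \<open>\<open>S\<close> is the value at \<open>\<tau>\<close> of an extension of
  \<open>R\<close> to the semidirect product of the group with \<open>\<tau>\<close>.\<close>

definition extended_rep where
  "extended_rep n R S \<longleftrightarrow> irrep n R \<and> S \<in> carrier_mat n n \<and> S * S = 1\<^sub>m n \<and>
    (\<forall>x\<in>carrier G. S * R x = R (\<tau> x) * S)"

text \<open>Invariance of \<open>\<chi>\<close> gives a nonzero intertwiner \<open>T\<close> between
  \<open>R\<close> and its twist by \<open>\<tau>\<close>. Since \<open>\<tau>\<close> is an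
  involution, \<open>T * T\<close> commutes with \<open>R\<close> and so is a nonzero scalar
  \<open>c\<close>; dividing \<open>T\<close> by a square root of \<open>c\<close> gives
  \<open>S\<close>.\<close>

lemma exists_extended_rep:
  assumes \<chi>: "\<chi> \<in> Irr G" "\<And>x. x \<in> carrier G \<Longrightarrow> \<chi> (\<tau> x) = \<chi> x"
  obtains n R S where "extended_rep n R S" "\<chi> = character_of G n R"
proof -
  obtain n R where R: "irrep n R" "\<chi> = character_of G n R"
    "\<And>g. g \<in> carrier G \<Longrightarrow> \<chi> g = trace (R g)" using IrrE[OF \<chi>(1)] by metis
  note r = irreducibleD(1)[OF R(1)]
  note rc = rep_carrier[OF r]
  define R' where "R' x = R (\<tau> x)" for x
  have r': "rep n R'" unfolding R'_def by (rule representation_\<tau>[OF r])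
  have "(\<Sum>g\<in>carrier G. trace (R g) * trace (R' (inv g))) = (\<Sum>g\<in>carrier G. \<chi> g * \<chi> (inv g))"
    by (intro sum.cong refl) (simp add: R'_def R(3)[symmetric] \<chi>(2))
  also have "\<dots> \<noteq> 0" using Irr_orthogonality[OF \<chi>(1) \<chi>(1)] by simp
  finally have nz: "(\<Sum>g\<in>carrier G. trace (R g) * trace (R' (inv g))) \<noteq> 0" .
  obtain T where T: "T \<in> carrier_mat n n" "T \<noteq> 0\<^sub>m n n"
    and int: "\<And>g. g \<in> carrier G \<Longrightarrow> R g * T = T * R' g"
    by (rule exists_intertwiner[OF r r' nz], rule that) simp_all
  obtain B where B: "B \<in> carrier_mat n n" "T * B = 1\<^sub>m n" by (rule schur_invertible[OF R(1) r' T int])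
  have TT: "T * T \<in> carrier_mat n n" using T by simp
  have "R g * (T * T) = T * T * R g" if g: "g \<in> carrier G" for g
  proof -
    have "R g * (T * T) = T * R (\<tau> g) * T"
      using assoc_mult_mat[OF rc[OF g] T(1) T(1)] int[OF g] by (simp add: R'_def)
    also have "\<dots> = T * (T * R g)"
      using assoc_mult_mat[OF T(1) rc[OF \<tau>_closed[OF g]] T(1)] int[OF \<tau>_closed[OF g]] g by (simp add: R'_def)
    finally show ?thesis using assoc_mult_mat[OF T(1) T(1) rc[OF g]] by simp
  qed
  then obtain c where c: "T * T = c \<cdot>\<^sub>m 1\<^sub>m n" using schur_scalar[OF R(1) TT] by blast
  have "c \<noteq> 0"
  proof
    assume "c = 0"
    then have "T * T = 0\<^sub>m n n" unfolding c by (intro eq_matI) auto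
    then have "T * T * B = 0\<^sub>m n n" using B by simp
    then have "T = 0\<^sub>m n n" using assoc_mult_mat[OF T(1) T(1) B(1)] B(2) T by simp
    then show False using T(2) by simp
  qed
  define d where "d = inverse (csqrt c)"
  have d: "d * d * c = 1" using \<open>c \<noteq> 0\<close> power2_csqrt[of c] by (simp add: d_def power2_eq_square[symmetric] power_inverse)
  define S where "S = d \<cdot>\<^sub>m T"
  have S: "S \<in> carrier_mat n n" using T by (simp add: S_def)
  have "S * S = (d * d) \<cdot>\<^sub>m (T * T)"
    unfolding S_def mult_smult_assoc_mat[OF T(1) smult_carrier_mat[OF T(1)]] mult_smult_distrib[OF T(1) T(1)]
    by (intro eq_matI) simp_all
  also have "\<dots> = 1\<^sub>m n" unfolding c using d by (intro eq_matI) (auto simp: mult.assoc)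
  finally have SS: "S * S = 1\<^sub>m n" .
  have "S * R x = R (\<tau> x) * S" if x: "x \<in> carrier G" for x
    unfolding S_def mult_smult_assoc_mat[OF T(1) rc[OF x]] mult_smult_distrib[OF rc[OF \<tau>_closed[OF x]] T(1)]
    using int[OF \<tau>_closed[OF x]] x by (simp add: R'_def)
  then have "extended_rep n R S" using R(1) S SS by (simp add: extended_rep_def)
  then show ?thesis using that R(2) by blast
qed

context
  fixes n R S
  assumes ext: "extended_rep n R S"
begin

lemma extended_repD:
  "irrep n R" "rep n R" "S \<in> carrier_mat n n" "S * S = 1\<^sub>m n"
  "x \<in> carrier G \<Longrightarrow> S * R x = R (\<tau> x) * S"
  using ext by (auto simp: extended_rep_def irreducible_representation_def)

text \<open>On the coset of \<open>\<tau>\<close> in the semidirect product this is invariance of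
  the trace under conjugation; it rests on
  \<open>S * R (inv (\<tau> x)) = R (inv x) * S\<close>.\<close>

lemma twisted_trace_conj:
  assumes x: "x \<in> carrier G" and g: "g \<in> carrier G"
  shows "trace (S * R (inv (\<tau> x) \<otimes> g \<otimes> x)) = trace (S * R g)"
proof -
  note r = extended_repD(2) and S = extended_repD(3)
  note rc = rep_carrier[OF r]
  have c: "R x \<in> carrier_mat n n" "R (inv x) \<in> carrier_mat n n" "R (inv (\<tau> x)) \<in> carrier_mat n n" "R g \<in> carrier_mat n n"
    using rc x g by auto
  have "S * R (inv (\<tau> x)) = R (inv x) * S"
    using extended_repD(5)[of "inv (\<tau> x)"] x by (simp add: \<tau>_inv)
  moreover have "R (inv (\<tau> x) \<otimes> g \<otimes> x) = R (inv (\<tau> x)) * (R g * R x)"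
    using x g c by (simp add: rep_mult[OF r])
  moreover have "S * (R (inv (\<tau> x)) * (R g * R x)) = S * R (inv (\<tau> x)) * (R g * R x)"
    by (rule assoc_mult_mat[OF S c(3) mult_carrier_mat[OF c(4,1)], symmetric])
  moreover have "R (inv x) * S * (R g * R x) = R (inv x) * (S * R g * R x)"
    by (simp only: assoc_mult_mat[OF c(2) S mult_carrier_mat[OF c(4,1)]] assoc_mult_mat[OF S c(4,1)])
  ultimately have "trace (S * R (inv (\<tau> x) \<otimes> g \<otimes> x)) = trace (R (inv x) * (S * R g * R x))"
    by simp
  also have "\<dots> = trace (S * R g * R x * R (inv x))"
    by (rule trace_mult_commute) (use S c in auto)
  also have "S * R g * R x * R (inv x) = S * R g * (R x * R (inv x))"
    by (rule assoc_mult_mat) (use S c in auto)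
  also have "\<dots> = S * R g" using S c by (simp add: rep_inv_right[OF r x])
  finally show ?thesis .
qed

text \<open>For \<open>e = 1\<close> and \<open>e = -1\<close> the matrix \<open>E\<close> is the
  projection onto an eigenspace of \<open>S\<close>. On fixed points \<open>S\<close> commutes with
  \<open>R\<close>, so each eigenspace is a representation of the fixed group.\<close>

lemma half_projection_decomposition:
  assumes e: "e * e = (1 :: complex)"
  shows "\<exists>xs. set xs \<subseteq> IrrC \<and>
    (\<forall>c\<in>fixed. (trace (R c) + e * trace (S * R c)) / 2 = (\<Sum>\<psi>\<leftarrow>xs. \<psi> c))"
proof -
  note r = extended_repD(2) and S = extended_repD(3)
  define E where "E = (1/2) \<cdot>\<^sub>m (1\<^sub>m n + e \<cdot>\<^sub>m S)"
  have E0: "1\<^sub>m n + e \<cdot>\<^sub>m S \<in> carrier_mat n n" using S by simp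
  have E: "E \<in> carrier_mat n n" using E0 by (simp add: E_def)
  have eS: "e \<cdot>\<^sub>m S \<in> carrier_mat n n" using S by simp
  have mE: "E * A = (1/2) \<cdot>\<^sub>m (A + e \<cdot>\<^sub>m (S * A))" if A: "A \<in> carrier_mat n n" for A
    using mult_smult_assoc_mat[OF E0 A, of "1/2"] add_mult_distrib_mat[OF one_carrier_mat eS A]
      mult_smult_assoc_mat[OF S A, of e] S A unfolding E_def by simp
  have Em: "A * E = (1/2) \<cdot>\<^sub>m (A + e \<cdot>\<^sub>m (A * S))" if A: "A \<in> carrier_mat n n" for A
    using mult_smult_distrib[OF A E0, of "1/2"] mult_add_distrib_mat[OF A one_carrier_mat eS]
      mult_smult_distrib[OF A S, of e] S A unfolding E_def by simp
  have scal: "e * (1 / 2 * (s + e * k)) = 1 / 2 * (k + e * s)" for s k :: complex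
  proof -
    have "e * (1 / 2 * (s + e * k)) = 1 / 2 * (e * s + e * e * k)" by (simp add: algebra_simps)
    then show ?thesis unfolding e by (simp add: add.commute)
  qed
  have "e \<cdot>\<^sub>m (S * E) = E"
    unfolding Em[OF S] extended_repD(4)
  proof (rule eq_matI)
    fix i j assume "i < dim_row E" "j < dim_col E"
    then have "i < n" "j < n" using E by auto
    then show "(e \<cdot>\<^sub>m (1 / 2 \<cdot>\<^sub>m (S + e \<cdot>\<^sub>m 1\<^sub>m n))) $$ (i, j) = E $$ (i, j)"
      using S scal[of "S $$ (i, j)" "1\<^sub>m n $$ (i, j)"] by (simp add: E_def)
  qed (use S E in auto)
  then have ES: "E * E = E"
    unfolding mE[OF E] using E by (intro eq_matI) auto
  have com: "R c * E = E * R c" if c: "c \<in> fixed" for c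
    using mE[OF rep_carrier[OF r]] Em[OF rep_carrier[OF r]] extended_repD(5)[of c] fixed_subset[OF c] fixed_\<tau>[OF c] by simp
  obtain k R' where k: "representation fixed_group k R'" "\<And>c. c \<in> fixed \<Longrightarrow> trace (R' c) = trace (E * R c)"
    by (rule fixed.idempotent_summand[OF fixed_representation[OF r] E ES], rule com, assumption, rule that, assumption) simp_all
  have tr: "trace (E * R c) = (trace (R c) + e * trace (S * R c)) / 2" if c: "c \<in> fixed" for c
  proof -
    have cc: "R c \<in> carrier_mat n n" by (rule rep_carrier[OF r fixed_subset[OF c]])
    then have "S * R c \<in> carrier_mat n n" using S by simp
    then show ?thesis using cc
      by (simp add: mE trace_smult[of _ n] trace_add[of _ n])
  qed
  show ?thesis using fixed.character_decomposition[OF k(1)] by (simp add: k(2) tr)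
qed

lemma twisted_decomposition:
  obtains xs ys where "set xs \<subseteq> IrrC" "set ys \<subseteq> IrrC"
    "\<And>c. c \<in> fixed \<Longrightarrow> trace (R c) = (\<Sum>\<psi>\<leftarrow>xs. \<psi> c) + (\<Sum>\<psi>\<leftarrow>ys. \<psi> c)"
    "\<And>c. c \<in> fixed \<Longrightarrow> trace (S * R c) = (\<Sum>\<psi>\<leftarrow>xs. \<psi> c) - (\<Sum>\<psi>\<leftarrow>ys. \<psi> c)"
proof -
  obtain xs where xs: "set xs \<subseteq> IrrC"
    "\<forall>c\<in>fixed. (trace (R c) + trace (S * R c)) / 2 = (\<Sum>\<psi>\<leftarrow>xs. \<psi> c)"
    using half_projection_decomposition[of 1] by auto
  obtain ys where ys: "set ys \<subseteq> IrrC"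
    "\<forall>c\<in>fixed. (trace (R c) - trace (S * R c)) / 2 = (\<Sum>\<psi>\<leftarrow>ys. \<psi> c)"
    using half_projection_decomposition[of "-1"] by auto
  show ?thesis
    by (rule that[OF xs(1) ys(1)]) (simp_all add: xs(2)[rule_format, symmetric] ys(2)[rule_format, symmetric] field_simps)
qed

end

text \<open>The product of the two twisted traces is constant on twisted classes, so its sum over
  the group collapses to the fixed points.\<close>

lemma twisted_fixed_orthogonality:
  assumes ext: "extended_rep n R S" and ext': "extended_rep m R' S'"
  shows "of_nat (card fixed) * (\<Sum>g\<in>carrier G. trace (S * R g) * trace (R' (inv g) * S')) =
    of_nat (card (carrier G)) * (\<Sum>c\<in>fixed. trace (S * R c) * trace (S' * R' (inv c)))"
proof -
  have eq: "trace (R' (inv g) * S') = trace (S' * R' (inv g))" if "g \<in> carrier G" for g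
    by (rule trace_mult_commute[OF rep_carrier[OF extended_repD(2)[OF ext']] extended_repD(3)[OF ext']]) (simp add: that)
  have "(\<Sum>g\<in>carrier G. trace (S * R g) * trace (R' (inv g) * S')) =
    (\<Sum>g\<in>carrier G. trace (S * R g) * trace (S' * R' (inv g)))"
    by (intro sum.cong refl) (simp add: eq)
  moreover have "trace (S * R (inv (\<tau> x) \<otimes> c \<otimes> x)) * trace (S' * R' (inv (inv (\<tau> x) \<otimes> c \<otimes> x))) =
    trace (S * R c) * trace (S' * R' (inv c))" if x: "x \<in> carrier G" and "c \<in> fixed" for x c
  proof -
    have c: "c \<in> carrier G" by (rule fixed_subset) fact
    \<comment> \<open>The inverse of the twisted conjugate of \<open>c\<close> by \<open>x\<close>
      is the twisted conjugate of \<open>inv c\<close> by \<open>\<tau> x\<close>, so the second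
      factor is invariant too.\<close>
    have "inv (inv (\<tau> x) \<otimes> c \<otimes> x) = inv (\<tau> (\<tau> x)) \<otimes> inv c \<otimes> \<tau> x"
      using x c by (simp add: inv_mult_group m_assoc)
    then show ?thesis
      using twisted_trace_conj[OF ext x c] twisted_trace_conj[OF ext', of "\<tau> x" "inv c"] x c by simp
  qed
  ultimately show ?thesis
    using sum_twisted_class_function[of "\<lambda>g. trace (S * R g) * trace (S' * R' (inv g))"] by simp
qed

text \<open>
  \<open>twisted_coeff \<chi> f\<close>: \<open>f\<close> lists the coefficients of the virtual character \<open>c \<mapsto> tr (S R(c))\<close> of
  the fixed point group. They agree modulo \<open>2\<close> with the multiplicities of the restriction of \<open>\<chi>\<close>,
  since the two are the difference and the sum of the characters on the eigenspaces of \<open>S\<close>.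
\<close>

definition twisted_coeff where
  "twisted_coeff \<chi> f \<longleftrightarrow> (\<exists>n R S. extended_rep n R S \<and> \<chi> = character_of G n R \<and>
    (\<forall>c\<in>fixed. trace (S * R c) = (\<Sum>\<psi>\<in>IrrC. of_int (f \<psi>) * \<psi> c)) \<and>
    (\<forall>\<psi>\<in>IrrC. \<exists>m::nat. char_inner fixed_group (restrict \<chi> fixed) \<psi> = of_nat m \<and> (odd m \<longleftrightarrow> odd (f \<psi>))))"

lemma exists_twisted_coeff:
  assumes \<chi>: "\<chi> \<in> Irr G" "\<And>x. x \<in> carrier G \<Longrightarrow> \<chi> (\<tau> x) = \<chi> x"
  obtains f where "twisted_coeff \<chi> f"
proof -
  obtain n R S where ext: "extended_rep n R S" and R: "\<chi> = character_of G n R"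
    by (rule exists_extended_rep[OF \<chi>])
  obtain xs ys where xy: "set xs \<subseteq> IrrC" "set ys \<subseteq> IrrC"
    "\<And>c. c \<in> fixed \<Longrightarrow> trace (R c) = (\<Sum>\<psi>\<leftarrow>xs. \<psi> c) + (\<Sum>\<psi>\<leftarrow>ys. \<psi> c)"
    "\<And>c. c \<in> fixed \<Longrightarrow> trace (S * R c) = (\<Sum>\<psi>\<leftarrow>xs. \<psi> c) - (\<Sum>\<psi>\<leftarrow>ys. \<psi> c)"
    by (rule twisted_decomposition[OF ext], rule that) simp_all
  define f where "f \<psi> = int (count_list xs \<psi>) - int (count_list ys \<psi>)" for \<psi>
  have "trace (S * R c) = (\<Sum>\<psi>\<in>IrrC. of_int (f \<psi>) * \<psi> c)" if "c \<in> fixed" for c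
    unfolding xy(4)[OF that] sum_list_eq_sum_count[OF fixed.finite_Irr xy(1)] sum_list_eq_sum_count[OF fixed.finite_Irr xy(2)]
    by (simp add: f_def sum_subtractf left_diff_distrib)
  moreover have "\<exists>m::nat. char_inner fixed_group (restrict \<chi> fixed) \<psi> = of_nat m \<and> (odd m \<longleftrightarrow> odd (f \<psi>))"
    if \<psi>: "\<psi> \<in> IrrC" for \<psi>
  proof (intro exI conjI)
    have "char_inner fixed_group (restrict \<chi> fixed) \<psi> =
      (\<Sum>c\<in>fixed. restrict \<chi> fixed c * \<psi> (inv\<^bsub>fixed_group\<^esub> c)) / of_nat (card fixed)"
      by (rule fixed.char_inner_Irr[OF \<psi>])
    also have "(\<Sum>c\<in>fixed. restrict \<chi> fixed c * \<psi> (inv\<^bsub>fixed_group\<^esub> c)) =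
      (\<Sum>c\<in>fixed. (\<Sum>\<psi>\<leftarrow>xs. \<psi> c) * \<psi> (inv\<^bsub>fixed_group\<^esub> c)) + (\<Sum>c\<in>fixed. (\<Sum>\<psi>\<leftarrow>ys. \<psi> c) * \<psi> (inv\<^bsub>fixed_group\<^esub> c))"
      unfolding sum.distrib[symmetric]
      by (intro sum.cong refl)
        (simp add: R character_of_eq_trace[OF extended_repD(2)[OF ext]] fixed_subset xy(3) distrib_right)
    also have "\<dots> = of_nat (card fixed) * of_nat (count_list xs \<psi> + count_list ys \<psi>)"
      using fixed.sum_list_Irr_orthogonality[OF xy(1) \<psi>] fixed.sum_list_Irr_orthogonality[OF xy(2) \<psi>]
      by (simp add: distrib_left)
    finally show "char_inner fixed_group (restrict \<chi> fixed) \<psi> = of_nat (count_list xs \<psi> + count_list ys \<psi>)"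
      by (rule trans) (use fixed.card_carrier_pos in simp)
    show "odd (count_list xs \<psi> + count_list ys \<psi>) \<longleftrightarrow> odd (f \<psi>)" by (simp add: f_def)
  qed
  ultimately have "twisted_coeff \<chi> f" unfolding twisted_coeff_def using ext R by blast
  then show ?thesis by (rule that)
qed

lemma sum_twisted_coeff:
  assumes "\<And>c. c \<in> fixed \<Longrightarrow> a c = (\<Sum>\<psi>\<in>IrrC. of_int (f \<psi>) * \<psi> c)"
    and "\<And>c. c \<in> fixed \<Longrightarrow> b c = (\<Sum>\<psi>\<in>IrrC. of_int (f' \<psi>) * \<psi> c)"
  shows "(\<Sum>c\<in>fixed. a c * b (inv c)) = of_nat (card fixed) * of_int (\<Sum>\<psi>\<in>IrrC. f \<psi> * f' \<psi>)"
proof -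
  let ?I = "IrrC"
  have "(\<Sum>c\<in>fixed. a c * b (inv c)) =
    (\<Sum>c\<in>fixed. \<Sum>\<psi>\<in>?I. \<Sum>\<psi>'\<in>?I. of_int (f \<psi> * f' \<psi>') * (\<psi> c * \<psi>' (inv c)))"
    by (intro sum.cong refl) (simp add: assms sum_product mult_ac)
  also have "\<dots> = (\<Sum>\<psi>\<in>?I. \<Sum>\<psi>'\<in>?I. of_int (f \<psi> * f' \<psi>') * (\<Sum>c\<in>fixed. \<psi> c * \<psi>' (inv c)))"
    unfolding sum_distrib_left
    by (simp only: sum.swap[where A = fixed and B = ?I])
  also have "\<dots> = (\<Sum>\<psi>\<in>?I. \<Sum>\<psi>'\<in>?I. if \<psi> = \<psi>' then of_int (f \<psi> * f' \<psi>) * of_nat (card fixed) else 0)"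
    by (intro sum.cong refl) (simp add: fixed_Irr_orthogonality)
  also have "\<dots> = of_nat (card fixed) * of_int (\<Sum>\<psi>\<in>?I. f \<psi> * f' \<psi>)"
    by (simp add: sum.delta fixed.finite_Irr sum_distrib_left mult.commute)
  finally show ?thesis .
qed

text \<open>The twisted orthogonality relation gives \<open>|G| / n\<close> times
  \<open>trace (S * S)\<close>, which is \<open>|G|\<close> because \<open>S * S\<close> is the
  identity. On the fixed points this says that the virtual character has norm one.\<close>

lemma twisted_coeff_norm:
  assumes "twisted_coeff \<chi> f"
  shows "(\<Sum>\<psi>\<in>IrrC. f \<psi> * f \<psi>) = 1"
proof -
  obtain n R S where ext: "extended_rep n R S"
    and f: "\<forall>c\<in>fixed. trace (S * R c) = (\<Sum>\<psi>\<in>IrrC. of_int (f \<psi>) * \<psi> c)"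
    using assms unfolding twisted_coeff_def by blast
  note S = extended_repD(3)[OF ext]
  have n: "n > 0" by (rule irreducibleD(2)[OF extended_repD(1)[OF ext]])
  have "(\<Sum>g\<in>carrier G. trace (S * R g) * trace (R (inv g) * S)) = of_nat (card (carrier G))"
    using twisted_orthogonality_same[OF extended_repD(1)[OF ext] S S] n
    by (simp add: extended_repD(4)[OF ext] trace_one)
  then have "of_nat (card fixed) * of_nat (card (carrier G)) =
    of_nat (card (carrier G)) * (\<Sum>c\<in>fixed. trace (S * R c) * trace (S * R (inv c)))"
    using twisted_fixed_orthogonality[OF ext ext] by simp
  also have "(\<Sum>c\<in>fixed. trace (S * R c) * trace (S * R (inv c))) =
    of_nat (card fixed) * of_int (\<Sum>\<psi>\<in>IrrC. f \<psi> * f \<psi>)"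
    by (rule sum_twisted_coeff) (use f in auto)
  finally have "of_int (\<Sum>\<psi>\<in>IrrC. f \<psi> * f \<psi>) = (1 :: complex)"
    using card_carrier_pos fixed.card_carrier_pos by simp
  then show ?thesis by (simp only: of_int_eq_1_iff)
qed

lemma twisted_coeff_orthogonal:
  assumes "twisted_coeff \<chi> f" "twisted_coeff \<chi>' f'" "\<chi> \<noteq> \<chi>'"
  shows "(\<Sum>\<psi>\<in>IrrC. f \<psi> * f' \<psi>) = 0"
proof -
  obtain n R S where ext: "extended_rep n R S" and R: "\<chi> = character_of G n R"
    and f: "\<forall>c\<in>fixed. trace (S * R c) = (\<Sum>\<psi>\<in>IrrC. of_int (f \<psi>) * \<psi> c)"
    using assms(1) unfolding twisted_coeff_def by blast
  obtain m R' S' where ext': "extended_rep m R' S'" and R': "\<chi>' = character_of G m R'"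
    and f': "\<forall>c\<in>fixed. trace (S' * R' c) = (\<Sum>\<psi>\<in>IrrC. of_int (f' \<psi>) * \<psi> c)"
    using assms(2) unfolding twisted_coeff_def by blast
  have "(\<Sum>g\<in>carrier G. trace (S * R g) * trace (R' (inv g) * S')) = 0"
    by (rule twisted_orthogonality_distinct[OF extended_repD(1)[OF ext] extended_repD(1)[OF ext'] _
          extended_repD(3)[OF ext] extended_repD(3)[OF ext']]) (use R R' assms(3) in simp)
  then have "(\<Sum>c\<in>fixed. trace (S * R c) * trace (S' * R' (inv c))) = 0"
    using twisted_fixed_orthogonality[OF ext ext'] card_carrier_pos by simp
  also have "(\<Sum>c\<in>fixed. trace (S * R c) * trace (S' * R' (inv c))) =
    of_nat (card fixed) * of_int (\<Sum>\<psi>\<in>IrrC. f \<psi> * f' \<psi>)"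
    by (rule sum_twisted_coeff) (use f f' in auto)
  finally have "of_int (\<Sum>\<psi>\<in>IrrC. f \<psi> * f' \<psi>) = (0 :: complex)"
    using fixed.card_carrier_pos by simp
  then show ?thesis by (simp only: of_int_eq_0_iff)
qed

definition odd_constituent where
  "odd_constituent \<chi> \<psi> \<longleftrightarrow> \<psi> \<in> IrrC \<and>
    (\<exists>m::nat. odd m \<and> char_inner fixed_group (restrict \<chi> fixed) \<psi> = of_nat m)"

lemma odd_constituent_iff:
  assumes "twisted_coeff \<chi> f" "\<psi> \<in> IrrC"
  shows "odd_constituent \<chi> \<psi> \<longleftrightarrow> odd (f \<psi>)"
proof -
  obtain m :: nat where "char_inner fixed_group (restrict \<chi> fixed) \<psi> = of_nat m" "odd m \<longleftrightarrow> odd (f \<psi>)"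
    using assms unfolding twisted_coeff_def by blast
  then show ?thesis using assms(2) by (auto simp: odd_constituent_def)
qed

lemma glauberman_unique:
  assumes \<chi>: "\<chi> \<in> Irr G" "\<And>x. x \<in> carrier G \<Longrightarrow> \<chi> (\<tau> x) = \<chi> x"
  shows "\<exists>!\<psi>. odd_constituent \<chi> \<psi>"
proof -
  obtain f where f: "twisted_coeff \<chi> f" by (rule exists_twisted_coeff[OF \<chi>])
  obtain \<psi> where \<psi>: "\<psi> \<in> IrrC" "odd (f \<psi>)"
    and z: "\<And>b. b \<in> IrrC \<Longrightarrow> b \<noteq> \<psi> \<Longrightarrow> f b = 0"
    by (rule sum_squares_int_eq_one[OF fixed.finite_Irr twisted_coeff_norm[OF f]], rule that) simp_all
  show ?thesis
  proof (rule ex1I[of _ \<psi>])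
    show "odd_constituent \<chi> \<psi>" using odd_constituent_iff[OF f \<psi>(1)] \<psi>(2) by simp
    fix \<psi>' assume o: "odd_constituent \<chi> \<psi>'"
    then have "\<psi>' \<in> IrrC" by (simp add: odd_constituent_def)
    then show "\<psi>' = \<psi>" using o odd_constituent_iff[OF f, of \<psi>'] z[of \<psi>'] by (cases "\<psi>' = \<psi>") auto
  qed
qed

text \<open>Coefficients of norm one vanish away from their single odd entry. With a common odd
  entry \<open>\<psi>\<close>, the inner product of the two twisted traces would be
  \<open>f \<psi> * f' \<psi>\<close>, a product of odd numbers, although distinct characters make
  it zero.\<close>

lemma glauberman_injective:
  assumes \<chi>: "\<chi> \<in> Irr G" "\<And>x. x \<in> carrier G \<Longrightarrow> \<chi> (\<tau> x) = \<chi> x"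
    and \<chi>': "\<chi>' \<in> Irr G" "\<And>x. x \<in> carrier G \<Longrightarrow> \<chi>' (\<tau> x) = \<chi>' x"
    and o: "odd_constituent \<chi> \<psi>" "odd_constituent \<chi>' \<psi>"
  shows "\<chi> = \<chi>'"
proof (rule ccontr)
  assume ne: "\<chi> \<noteq> \<chi>'"
  obtain f where f: "twisted_coeff \<chi> f" by (rule exists_twisted_coeff[OF \<chi>])
  obtain f' where f': "twisted_coeff \<chi>' f'" by (rule exists_twisted_coeff[OF \<chi>'])
  have \<psi>: "\<psi> \<in> IrrC" using o by (simp add: odd_constituent_def)
  have odd: "odd (f \<psi>)" "odd (f' \<psi>)" using o odd_constituent_iff[OF f \<psi>] odd_constituent_iff[OF f' \<psi>] by auto
  obtain \<psi>0 where "\<psi>0 \<in> IrrC" "odd (f \<psi>0)" and \<psi>0: "\<And>b. b \<in> IrrC \<Longrightarrow> b \<noteq> \<psi>0 \<Longrightarrow> f b = 0"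
    by (rule sum_squares_int_eq_one[OF fixed.finite_Irr twisted_coeff_norm[OF f]], rule that) simp_all
  have "\<psi>0 = \<psi>" using \<psi>0[OF \<psi>] odd(1) by (cases "\<psi>0 = \<psi>") auto
  then have "(\<Sum>b\<in>IrrC. f b * f' b) = (\<Sum>b\<in>IrrC. if b = \<psi> then f \<psi> * f' \<psi> else 0)"
    using \<psi>0 by (intro sum.cong) auto
  also have "\<dots> = f \<psi> * f' \<psi>" using \<psi> fixed.finite_Irr by (simp add: sum.delta)
  finally have "f \<psi> * f' \<psi> = 0" using twisted_coeff_orthogonal[OF f f' ne] by simp
  then show False using odd by auto
qed

end


section \<open>Orbits stable under an involution\<close>

lemma involution_fixed_point:
  assumes "finite A" "odd (card A)" "\<And>x. x \<in> A \<Longrightarrow> f x \<in> A" "\<And>x. x \<in> A \<Longrightarrow> f (f x) = x"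
  obtains x where "x \<in> A" "f x = x"
proof -
  have "\<exists>x\<in>A. f x = x"
    using assms
  proof (induction "card A" arbitrary: A rule: less_induct)
    case less
    have "A \<noteq> {}" using less.prems(2) by auto
    then obtain x where x: "x \<in> A" by blast
    show ?case
    proof (cases "f x = x")
      case False
      let ?B = "A - {x, f x}"
      have fx: "f x \<in> A" using less.prems(3) x by blast
      have "card ?B + card {x, f x} = card A"
        using less.prems(1) x fx by (metis Diff_partition card_Diff_subset card_mono empty_subsetI finite.emptyI
            finite.insertI insert_subset le_add_diff_inverse2)
      then have c: "card ?B + 2 = card A" using False by simp
      have "\<exists>y\<in>?B. f y = y"
      proof (rule less.hyps)
        show "card ?B < card A" using c by simp
        show "finite ?B" using less.prems(1) by simp
        show "odd (card ?B)" using c less.prems(2) by presburger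
        fix y assume y: "y \<in> ?B"
        show "f (f y) = y" using less.prems(4) y by blast
        show "f y \<in> ?B" using y less.prems(3,4) x by (metis Diff_iff insert_iff singletonD)
      qed
      then show ?thesis by blast
    qed (use x in blast)
  qed
  then show ?thesis using that by blast
qed

text \<open>Serves to compare families indexed by the same characters, or by the same elements of
  \<open>J\<close>, with the orbits that they determine.\<close>

lemma card_image_eq_of_same_kernel:
  assumes "\<And>x y. x \<in> A \<Longrightarrow> y \<in> A \<Longrightarrow> f x = f y \<longleftrightarrow> g x = g y"
  shows "card (f ` A) = card (g ` A)"
proof -
  have "bij_betw (\<lambda>z. g (inv_into A f z)) (f ` A) (g ` A)"
  proof (rule bij_betwI')
    fix u v assume uv: "u \<in> f ` A" "v \<in> f ` A"
    show "g (inv_into A f u) = g (inv_into A f v) \<longleftrightarrow> u = v"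
      using assms[OF inv_into_into[OF uv(1)] inv_into_into[OF uv(2)]] uv by (simp add: f_inv_into_f)
    show "g (inv_into A f u) \<in> g ` A" using inv_into_into[OF uv(1)] by blast
  next
    fix w assume "w \<in> g ` A"
    then obtain x where x: "x \<in> A" "w = g x" by blast
    then have fx: "f x \<in> f ` A" by blast
    have "g (inv_into A f (f x)) = g x"
      using assms[OF inv_into_into[OF fx] x(1)] f_inv_into_f[OF fx] by simp
    then show "\<exists>u\<in>f ` A. w = g (inv_into A f u)" using fx x(2) by metis
  qed
  then show ?thesis by (rule bij_betw_same_card)
qed

lemma card_filter_eq_sum: "finite A \<Longrightarrow> card {x \<in> A. P x} = (\<Sum>x\<in>A. if P x then 1 else 0)"
  by (simp add: sum.If_cases Int_def)

lemma even_sum_iff_card: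
  fixes f :: "'a \<Rightarrow> nat"
  assumes "finite A"
  shows "even (sum f A) \<longleftrightarrow> even (card {x \<in> A. odd (f x)})"
  using assms
proof (induction A rule: finite_induct)
  case (insert a A)
  have "{x \<in> insert a A. odd (f x)} = (if odd (f a) then insert a {x \<in> A. odd (f x)} else {x \<in> A. odd (f x)})"
    by auto
  then show ?case using insert by simp
qed simp

context finite_group
begin

text \<open>A class function acts on the representation by a scalar, so pairing with
  \<open>\<chi>\<close> turns convolution with it into a product, up to the factor
  \<open>\<chi> \<one>\<close>.\<close>

lemma Irr_pairing_convolution:
  assumes \<chi>: "\<chi> \<in> Irr G" and f: "\<And>g h. g \<in> carrier G \<Longrightarrow> h \<in> carrier G \<Longrightarrow> f (h \<otimes> g \<otimes> inv h) = f g"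
  shows "(\<Sum>g\<in>carrier G. f g * \<chi> (inv g)) * (\<Sum>g\<in>carrier G. f' g * \<chi> (inv g)) =
    \<chi> \<one> * (\<Sum>w\<in>carrier G. (\<Sum>y\<in>carrier G. f (w \<otimes> inv y) * f' y) * \<chi> (inv w))"
proof -
  let ?P = "\<Sum>g\<in>carrier G. f g * \<chi> (inv g)"
  have "?P * (\<Sum>y\<in>carrier G. f' y * \<chi> (inv y)) = (\<Sum>y\<in>carrier G. f' y * (?P * \<chi> (inv y)))"
    by (simp add: sum_distrib_left mult_ac)
  also have "\<dots> = (\<Sum>y\<in>carrier G. f' y * ((\<Sum>g\<in>carrier G. f g * \<chi> (inv y \<otimes> inv g)) * \<chi> \<one>))"
    by (intro sum.cong refl) (simp add: Irr_class_function_convolution[OF \<chi> f, symmetric])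
  also have "\<dots> = (\<Sum>y\<in>carrier G. f' y * ((\<Sum>w\<in>carrier G. f (w \<otimes> inv y) * \<chi> (inv w)) * \<chi> \<one>))"
  proof (intro sum.cong refl)
    fix y assume y: "y \<in> carrier G"
    have "(\<Sum>g\<in>carrier G. f g * \<chi> (inv y \<otimes> inv g)) =
      (\<Sum>w\<in>carrier G. f (w \<otimes> inv y) * \<chi> (inv y \<otimes> inv (w \<otimes> inv y)))"
      by (rule sum_right_mult[symmetric]) (simp add: y)
    also have "\<dots> = (\<Sum>w\<in>carrier G. f (w \<otimes> inv y) * \<chi> (inv w))"
      using y by (intro sum.cong refl) (simp add: inv_mult_group m_assoc[symmetric])
    finally show "f' y * ((\<Sum>g\<in>carrier G. f g * \<chi> (inv y \<otimes> inv g)) * \<chi> \<one>) =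
      f' y * ((\<Sum>w\<in>carrier G. f (w \<otimes> inv y) * \<chi> (inv w)) * \<chi> \<one>)" by simp
  qed
  also have "\<dots> = (\<Sum>y\<in>carrier G. \<Sum>w\<in>carrier G. \<chi> \<one> * (f (w \<otimes> inv y) * f' y * \<chi> (inv w)))"
    by (simp add: sum_distrib_left sum_distrib_right mult_ac)
  also have "\<dots> = \<chi> \<one> * (\<Sum>w\<in>carrier G. (\<Sum>y\<in>carrier G. f (w \<otimes> inv y) * f' y) * \<chi> (inv w))"
    by (subst sum.swap) (simp add: sum_distrib_left sum_distrib_right)
  finally show ?thesis .
qed

text \<open>Fourier inversion at the unit: the weights \<open>\<chi> \<one>\<close> assemble the
  regular character, which is concentrated there.\<close>

lemma sum_Irr_pairing:
  "(\<Sum>\<chi>\<in>Irr G. \<chi> \<one> * (\<Sum>g\<in>carrier G. f g * \<chi> (inv g))) = of_nat (card (carrier G)) * f \<one>"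
proof -
  have "(\<Sum>\<chi>\<in>Irr G. \<chi> \<one> * (\<Sum>g\<in>carrier G. f g * \<chi> (inv g))) =
    (\<Sum>g\<in>carrier G. f g * (\<Sum>\<chi>\<in>Irr G. \<chi> \<one> * \<chi> (inv g)))"
    unfolding sum_distrib_left by (subst sum.swap) (simp add: mult_ac)
  also have "\<dots> = (\<Sum>g\<in>carrier G. if g = \<one> then f g * of_nat (card (carrier G)) else 0)"
    by (intro sum.cong refl) (simp add: sum_Irr_regular)
  also have "\<dots> = of_nat (card (carrier G)) * f \<one>" by (simp add: sum.delta mult.commute)
  finally show ?thesis .
qed

text \<open>Pairing the sum with \<open>\<psi>\<close> gives \<open>\<psi> \<one>\<close> times the
  group order if \<open>\<psi>\<close> belongs to the set and 0 otherwise, so the sum remembers the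
  set.\<close>

lemma sum_Irr_inj:
  assumes "X \<subseteq> Irr G" "Y \<subseteq> Irr G"
    and eq: "\<And>g. g \<in> carrier G \<Longrightarrow> (\<Sum>\<chi>\<in>X. \<chi> \<one> * \<chi> g) = (\<Sum>\<chi>\<in>Y. \<chi> \<one> * \<chi> g)"
  shows "X = Y"
proof -
  have mem: "(\<Sum>g\<in>carrier G. (\<Sum>\<chi>\<in>Z. \<chi> \<one> * \<chi> g) * \<psi> (inv g)) \<noteq> 0 \<longleftrightarrow> \<psi> \<in> Z"
    if Z: "Z \<subseteq> Irr G" and \<psi>: "\<psi> \<in> Irr G" for Z \<psi>
  proof -
    have fin: "finite Z" using Z finite_Irr finite_subset by blast
    have "(\<Sum>g\<in>carrier G. (\<Sum>\<chi>\<in>Z. \<chi> \<one> * \<chi> g) * \<psi> (inv g)) =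
      (\<Sum>\<chi>\<in>Z. \<chi> \<one> * (\<Sum>g\<in>carrier G. \<chi> g * \<psi> (inv g)))"
      unfolding sum_distrib_left sum_distrib_right by (subst sum.swap) (simp add: mult_ac)
    also have "\<dots> = (\<Sum>\<chi>\<in>Z. if \<chi> = \<psi> then \<psi> \<one> * of_nat (card (carrier G)) else 0)"
      using Z \<psi> by (intro sum.cong refl) (auto simp: Irr_orthogonality)
    also have "\<dots> = (if \<psi> \<in> Z then \<psi> \<one> * of_nat (card (carrier G)) else 0)"
      using fin by (simp add: sum.delta)
    also have "\<dots> \<noteq> 0 \<longleftrightarrow> \<psi> \<in> Z"
    proof -
      obtain n where "n > 0" "\<psi> \<one> = of_nat n" by (rule Irr_degree[OF \<psi>])
      then show ?thesis by simp
    qed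
    finally show ?thesis .
  qed
  have "\<psi> \<in> X \<longleftrightarrow> \<psi> \<in> Y" if "\<psi> \<in> Irr G" for \<psi>
    unfolding mem[OF assms(1) that, symmetric] mem[OF assms(2) that, symmetric] by (simp add: eq)
  then show ?thesis using assms(1,2) by blast
qed

end

lemma (in odd_group_involution) Irr_\<tau>:
  assumes "\<chi> \<in> Irr G"
  shows "(\<lambda>x\<in>carrier G. \<chi> (\<tau> x)) \<in> Irr G"
proof -
  obtain n R where R: "irrep n R" "\<chi> = character_of G n R"
    "\<And>g. g \<in> carrier G \<Longrightarrow> \<chi> g = trace (R g)" using IrrE[OF assms] by metis
  note r = irreducibleD(1)[OF R(1)]
  define R' where "R' x = R (\<tau> x)" for x
  have r': "rep n R'" unfolding R'_def by (rule representation_\<tau>[OF r])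
  have "irrep n R'"
    unfolding irreducible_representation_def
  proof (intro conjI allI impI r')
    show "n > 0" by (rule irreducibleD(2)[OF R(1)])
    fix W assume W: "vec_subspace n W \<and> (\<forall>g\<in>carrier G. \<forall>w\<in>W. R' g *\<^sub>v w \<in> W)"
    have "R g *\<^sub>v w \<in> W" if g: "g \<in> carrier G" "w \<in> W" for g w
      using W that(2) \<tau>_closed[OF g(1)] \<tau>_\<tau>[OF g(1)] unfolding R'_def by metis
    then show "W = {0\<^sub>v n} \<or> W = carrier_vec n"
      using irreducibleD(3)[OF R(1), of W] W by blast
  qed
  moreover have "(\<lambda>x\<in>carrier G. \<chi> (\<tau> x)) = character_of G n R'"
    using R(3) character_of_eq_trace[OF r'] by (intro ext) (auto simp: R'_def character_of_def)
  ultimately show ?thesis unfolding Irr_def by blast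
qed

section \<open>Finite group actions and orbit counting\<close>

locale finite_action = finite_group G for G (structure) +
  fixes E :: "'e set" and act :: "'a \<Rightarrow> 'e \<Rightarrow> 'e"
  assumes finite_E [simp]: "finite E"
    and act_closed [simp]: "\<And>g x. g \<in> carrier G \<Longrightarrow> x \<in> E \<Longrightarrow> act g x \<in> E"
    and act_one [simp]: "\<And>x. x \<in> E \<Longrightarrow> act \<one> x = x"
    and act_mult: "\<And>g h x. g \<in> carrier G \<Longrightarrow> h \<in> carrier G \<Longrightarrow> x \<in> E \<Longrightarrow> act (g \<otimes> h) x = act g (act h x)"
begin

definition orb where "orb x = (\<lambda>g. act g x) ` carrier G"

lemma orb_subset: "x \<in> E \<Longrightarrow> orb x \<subseteq> E"
  by (auto simp: orb_def)

lemma finite_orb [simp]: "finite (orb x)"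
  by (simp add: orb_def)

lemma orb_self: "x \<in> E \<Longrightarrow> x \<in> orb x"
  unfolding orb_def by (metis act_one image_eqI one_closed)

lemma act_inv_cancel:
  assumes "g \<in> carrier G" "x \<in> E"
  shows "act (inv g) (act g x) = x" "act g (act (inv g) x) = x"
  using assms act_mult[of "inv g" g x] act_mult[of g "inv g" x] by simp_all

lemma orb_eq:
  assumes x: "x \<in> E" and y: "y \<in> orb x"
  shows "orb y = orb x"
proof -
  obtain g where g: "g \<in> carrier G" "y = act g x" using y by (auto simp: orb_def)
  have "act h y \<in> orb x" if "h \<in> carrier G" for h
    using that g x act_mult[of h g x] unfolding orb_def by (metis image_eqI m_closed)
  moreover have "act h x \<in> orb y" if "h \<in> carrier G" for h
  proof -
    have "act h x = act (h \<otimes> inv g) y"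
      using that g x by (simp add: act_mult act_inv_cancel)
    then show ?thesis using that g unfolding orb_def by blast
  qed
  ultimately show ?thesis by (auto simp: orb_def)
qed

lemma orb_sym: "x \<in> E \<Longrightarrow> y \<in> orb x \<Longrightarrow> x \<in> orb y"
  using orb_eq orb_self by metis

lemma orb_disjoint:
  assumes "x \<in> E" "y \<in> E" "z \<in> orb x" "z \<in> orb y"
  shows "orb x = orb y"
  using orb_eq[OF assms(1,3)] orb_eq[OF assms(2,4)] by simp

text \<open>Orbit-stabiliser for a coset of the stabiliser: the sets of elements carrying
  \<open>x\<close> to the various points of its orbit are left translates of one another.\<close>

lemma card_transporter:
  assumes x: "x \<in> E" and y: "y \<in> orb x"
  shows "card {g \<in> carrier G. act g x = y} * card (orb x) = card (carrier G)"
proof -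
  have tr: "card {g \<in> carrier G. act g x = z} = card {g \<in> carrier G. act g x = y}" if z: "z \<in> orb x" for z
  proof -
    have "z \<in> orb y" using z orb_eq[OF x y] by simp
    then obtain h where h: "h \<in> carrier G" "z = act h y" by (auto simp: orb_def)
    have yE: "y \<in> E" using orb_subset[OF x] y by auto
    have "bij_betw (\<lambda>g. h \<otimes> g) {g \<in> carrier G. act g x = y} {g \<in> carrier G. act g x = z}"
    proof (rule bij_betwI[where g = "\<lambda>g. inv h \<otimes> g"])
      show "(\<lambda>g. h \<otimes> g) \<in> {g \<in> carrier G. act g x = y} \<rightarrow> {g \<in> carrier G. act g x = z}"
        using h x by (auto simp: act_mult)
      show "(\<lambda>g. inv h \<otimes> g) \<in> {g \<in> carrier G. act g x = z} \<rightarrow> {g \<in> carrier G. act g x = y}"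
        using h x yE by (auto simp: act_mult act_inv_cancel)
    qed (use h in \<open>auto simp: m_assoc[symmetric]\<close>)
    then show ?thesis by (rule bij_betw_same_card[symmetric])
  qed
  have "card (carrier G) = (\<Sum>g\<in>carrier G. 1)" by simp
  also have "\<dots> = (\<Sum>z\<in>orb x. \<Sum>g\<in>{g \<in> carrier G. act g x = z}. 1)"
    unfolding orb_def by (rule sum.image_gen[OF finite_carrier])
  also have "\<dots> = (\<Sum>z\<in>orb x. card {g \<in> carrier G. act g x = y})"
    by (intro sum.cong refl) (simp add: tr)
  finally show ?thesis by (simp add: mult.commute)
qed

lemma odd_card_orb:
  assumes "odd (card (carrier G))" "x \<in> E"
  shows "odd (card (orb x))"
  using assms(1) unfolding card_transporter[OF assms(2) orb_self[OF assms(2)], symmetric] by simp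

lemma sum_orb_act:
  assumes x: "x \<in> E" and g: "g \<in> carrier G"
  shows "(\<Sum>y\<in>orb x. f (act g y)) = (\<Sum>y\<in>orb x. f y)"
proof -
  have cl: "act h y \<in> orb x" if "h \<in> carrier G" "y \<in> orb x" for h y
    using orb_eq[OF x that(2)] that(1) by (auto simp: orb_def)
  have E: "y \<in> E" if "y \<in> orb x" for y using that orb_subset[OF x] by auto
  show ?thesis
    by (rule sum.reindex_bij_witness[of _ "act (inv g)" "act g"]) (use g cl E act_inv_cancel in auto)
qed

text \<open>Burnside's lemma for the coset of \<open>s\<close>.\<close>

lemma sum_card_fixed_eq:
  assumes s: "\<And>x. x \<in> E \<Longrightarrow> s x \<in> E"
    and s_orb: "\<And>g x. g \<in> carrier G \<Longrightarrow> x \<in> E \<Longrightarrow> s (act g x) \<in> orb (s x)"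
  shows "(\<Sum>g\<in>carrier G. card {x \<in> E. act g (s x) = x}) =
    card (carrier G) * card (orb ` {x \<in> E. s x \<in> orb x})"
proof -
  \<comment> \<open>Only points whose orbit is mapped to itself by \<open>s\<close> can satisfy
    \<open>act g (s x) = x\<close>. Each of them does so for \<open>|G| / |orb x|\<close> elements
    \<open>g\<close>, so every such orbit contributes \<open>|G|\<close> in total.\<close>
  define I where "I = {x \<in> E. s x \<in> orb x}"
  have finI: "finite I" by (simp add: I_def)
  have orbI: "{x \<in> I. orb x = orb z} = orb z" if z: "z \<in> I" for z
  proof -
    have zE: "z \<in> E" "s z \<in> orb z" using z by (auto simp: I_def)
    have "x \<in> I" if x: "x \<in> orb z" for x
    proof -
      obtain g where g: "g \<in> carrier G" "x = act g z" using x by (auto simp: orb_def)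
      have "s x \<in> orb (s z)" using s_orb g zE by simp
      then have "s x \<in> orb x" using orb_eq[OF zE] orb_eq[OF zE(1) x] by simp
      then show ?thesis using orb_subset[OF zE(1)] x by (auto simp: I_def)
    qed
    moreover have "x \<in> orb z" if "x \<in> I" "orb x = orb z" for x
      using that orb_self[of x] by (auto simp: I_def)
    ultimately show ?thesis using orb_eq[OF zE(1)] by blast
  qed
  have tr: "card {g \<in> carrier G. act g (s x) = x} * card (orb x) = card (carrier G)" if x: "x \<in> I" for x
  proof -
    have xE: "x \<in> E" "s x \<in> orb x" using x by (auto simp: I_def)
    have "x \<in> orb (s x)" by (rule orb_sym[OF xE])
    from card_transporter[OF s[OF xE(1)] this] show ?thesis using orb_eq[OF xE] by simp
  qed
  have none: "{g \<in> carrier G. act g (s x) = x} = {}" if "x \<in> E - I" for x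
  proof -
    have "x \<notin> orb (s x)" using that orb_sym[OF s, of x x] by (auto simp: I_def)
    then show ?thesis unfolding orb_def by force
  qed
  have "(\<Sum>g\<in>carrier G. card {x \<in> E. act g (s x) = x}) = (\<Sum>x\<in>E. card {g \<in> carrier G. act g (s x) = x})"
    by (simp add: card_filter_eq_sum sum.swap[of _ E])
  also have "\<dots> = (\<Sum>x\<in>I. card {g \<in> carrier G. act g (s x) = x})"
    by (rule sum.mono_neutral_right) (use none in \<open>auto simp: I_def\<close>)
  also have "\<dots> = (\<Sum>U\<in>orb ` I. \<Sum>x\<in>{x \<in> I. orb x = U}. card {g \<in> carrier G. act g (s x) = x})"
    by (rule sum.image_gen[OF finI])
  also have "\<dots> = (\<Sum>U\<in>orb ` I. card (carrier G))"
  proof (rule sum.cong[OF refl])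
    fix U assume "U \<in> orb ` I"
    then obtain z where z: "z \<in> I" "U = orb z" by blast
    have zE: "z \<in> E" using z by (simp add: I_def)
    have c: "card {g \<in> carrier G. act g (s x) = x} = card {g \<in> carrier G. act g (s z) = z}"
      if "x \<in> {x \<in> I. orb x = orb z}" for x
    proof -
      have "card (orb z) > 0" using orb_self[OF zE] by (auto simp: card_gt_0_iff)
      then show ?thesis using tr[of x] tr[OF z(1)] that by (metis (mono_tags, lifting) mem_Collect_eq mult_cancel2 less_irrefl)
    qed
    have "(\<Sum>x\<in>{x \<in> I. orb x = U}. card {g \<in> carrier G. act g (s x) = x}) =
      (\<Sum>x\<in>{x \<in> I. orb x = orb z}. card {g \<in> carrier G. act g (s z) = z})"
      unfolding z(2) by (rule sum.cong[OF refl c])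
    also have "\<dots> = card (carrier G)" unfolding orbI[OF z(1)] using tr[OF z(1)] by (simp add: mult.commute)
    finally show "(\<Sum>x\<in>{x \<in> I. orb x = U}. card {g \<in> carrier G. act g (s x) = x}) = card (carrier G)" .
  qed
  finally show ?thesis by (simp add: I_def mult.commute)
qed

end

context finite_additive_subgroup
begin

lemma J_nonempty: "J \<noteq> {}"
  using zero_J by blast

text \<open>Orthogonality writes the condition that \<open>\<kappa>\<close> is fixed as a sum of
  \<open>\<kappa> (d a - a)\<close> over \<open>a\<close>; summing over \<open>\<kappa>\<close>
  first picks out the \<open>a\<close> with \<open>d a = a\<close>.\<close>

lemma card_dual_fixed:
  assumes d: "\<And>a. a \<in> J \<Longrightarrow> d a \<in> J" and d_add: "\<And>a b. a \<in> J \<Longrightarrow> b \<in> J \<Longrightarrow> d (a + b) = d a + d b"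
  shows "card {\<kappa> \<in> dual_group J. (\<lambda>a\<in>J. \<kappa> (d a)) = \<kappa>} = card {a \<in> J. d a = a}"
proof -
  have cl: "(\<lambda>a\<in>J. \<kappa> (d a)) \<in> dual_group J" if "\<kappa> \<in> dual_group J" for \<kappa>
    using that d d_add dual_nonzero[OF that] dual_add[OF that] by (auto simp: dual_group_def)
  have "of_nat (card J) * of_nat (card {\<kappa> \<in> dual_group J. (\<lambda>a\<in>J. \<kappa> (d a)) = \<kappa>}) =
    (\<Sum>\<kappa>\<in>dual_group J. if (\<lambda>a\<in>J. \<kappa> (d a)) = \<kappa> then of_nat (card J) else 0 :: complex)"
    by (simp add: sum.If_cases Int_def)
  also have "\<dots> = (\<Sum>\<kappa>\<in>dual_group J. \<Sum>a\<in>J. (\<lambda>a\<in>J. \<kappa> (d a)) a * \<kappa> (- a))"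
    by (intro sum.cong refl) (simp only: dual_orthogonality[OF cl])
  also have "\<dots> = (\<Sum>\<kappa>\<in>dual_group J. \<Sum>a\<in>J. \<kappa> (d a - a))"
    by (intro sum.cong refl) (simp add: dual_diff d)
  also have "\<dots> = (\<Sum>a\<in>J. \<Sum>\<kappa>\<in>dual_group J. \<kappa> (d a - a))" by (rule sum.swap)
  also have "\<dots> = (\<Sum>a\<in>J. if d a = a then of_nat (card J) else 0)"
    by (intro sum.cong refl) (simp add: sum_dual d)
  also have "\<dots> = of_nat (card J) * of_nat (card {a \<in> J. d a = a})"
    by (simp add: sum.If_cases Int_def)
  finally show ?thesis using J_nonempty by simp
qed

end


section \<open>Algebra groups with involution\<close>

locale involutive_nilpotent_algebra = finite_dimensional_algebra scale
  for scale :: "'k::{field,finite} \<Rightarrow> 'a::ring_1 \<Rightarrow> 'a" +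
  fixes \<sigma> :: "'a \<Rightarrow> 'a" and J :: "'a set"
  assumes odd_char: "odd CHAR('k)"
    and involution: "algebra_involution scale \<sigma>"
    and subalgebra_J: "subalgebra scale J"
    and nilpotent_J: "nilpotent_set J"
    and \<sigma>_image_J: "\<sigma> ` J = J"
begin

lemma finite_algebra: "finite (UNIV :: 'a set)"
proof -
  obtain B where B: "finite B" "span B = UNIV" using finite_dimensional by blast
  have "UNIV \<subseteq> (\<lambda>u. \<Sum>v\<in>B. scale (u v) v) ` (B \<rightarrow>\<^sub>E UNIV)"
  proof
    fix x :: 'a
    obtain u where "x = (\<Sum>v\<in>B. scale (u v) v)" using B span_finite[OF B(1)] by auto
    then have "x = (\<Sum>v\<in>B. scale (restrict u B v) v)" by simp
    then show "x \<in> (\<lambda>u. \<Sum>v\<in>B. scale (u v) v) ` (B \<rightarrow>\<^sub>E UNIV)"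
      by (rule image_eqI[of _ _ "restrict u B"]) auto
  qed
  moreover have "finite (B \<rightarrow>\<^sub>E (UNIV :: 'k set))" using B(1) by (intro finite_PiE) auto
  ultimately show ?thesis using finite_subset by blast
qed

lemma subspace_J: "subspace J" and mult_J: "a \<in> J \<Longrightarrow> b \<in> J \<Longrightarrow> a * b \<in> J"
  using subalgebra_J by (auto simp: subalgebra_def)

sublocale finite_additive_subgroup J
  using subspace_J finite_subset[OF subset_UNIV finite_algebra, of J]
  by unfold_locales (auto intro: subspace_0 subspace_add subspace_neg)

lemma two_neq_zero: "(2 :: 'k) \<noteq> 0"
proof
  assume "(2 :: 'k) = 0"
  then have "of_nat 2 = (0 :: 'k)" by simp
  then have "CHAR('k) dvd 2" by (simp only: of_nat_eq_0_iff_char_dvd)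
  then have "CHAR('k) = 1 \<or> CHAR('k) = 2" using two_is_prime_nat by (auto simp: prime_nat_iff)
  then show False using odd_char by auto
qed

definition half :: "'a \<Rightarrow> 'a" where "half = scale (1/2)"

lemma half_add_half: "half a + half a = a"
  using two_neq_zero by (simp add: half_def scale_left_distrib[symmetric])

lemma half_add: "half (a + b) = half a + half b"
  by (simp add: half_def scale_right_distrib)

text \<open>Uniqueness of halves makes additive maps commute with \<open>half\<close>. This covers
  \<open>\<sigma>\<close>, which need not be linear over the field.\<close>

lemma half_unique: "b + b = a \<Longrightarrow> b = half a"
  using half_add[of b b] half_add_half[of b] by simp

lemma half_diff: "half (a - b) = half a - half b"
  by (simp add: half_def scale_right_diff_distrib)

lemma half_zero: "half 0 = 0"
  by (simp add: half_def)

lemma half_mult: "half (a * b) = half a * b" "half (a * b) = a * half b"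
  unfolding half_def by (rule scale_mult_left, rule scale_mult_right)

lemma half_J: "a \<in> J \<Longrightarrow> half a \<in> J"
  using subspace_J by (simp add: half_def subspace_scale)

lemma bij_betw_half: "bij_betw half J J"
  by (rule bij_betwI[where g = "\<lambda>a. a + a"]) (auto simp: half_J half_add_half half_add)

text \<open>Negation is an involution on the nonzero elements, and it has no fixed point there
  because 2 is invertible.\<close>

lemma odd_card_J: "odd (card J)"
proof -
  have "even (card (J - {0}))"
  proof (rule ccontr)
    assume "odd (card (J - {0}))"
    then obtain a where a: "a \<in> J - {0}" "- a = a"
      by (rule involution_fixed_point[rotated, where f = uminus]) auto
    then have "a + a = 0" by (metis add.right_inverse)
    then have "a = 0" using half_unique[of a 0] half_zero by simp
    then show False using a by simp
  qed
  moreover have "card J = Suc (card (J - {0}))" by (rule card.remove) auto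
  ultimately show ?thesis by (metis even_Suc)
qed

section \<open>The algebra group \<open>P\<close>\<close>

abbreviation P where "P \<equiv> one_plus J"

lemma P_iff: "x \<in> P \<longleftrightarrow> x - 1 \<in> J"
proof
  assume "x \<in> P"
  then show "x - 1 \<in> J" by (auto simp: one_plus_def)
next
  assume "x - 1 \<in> J"
  moreover have "x = 1 + (x - 1)" by simp
  ultimately show "x \<in> P" unfolding one_plus_def by blast
qed

lemma one_add_P: "a \<in> J \<Longrightarrow> 1 + a \<in> P"
  by (simp add: P_iff)

lemma P_cases:
  assumes "x \<in> P"
  obtains a where "a \<in> J" "x = 1 + a"
  using assms by (auto simp: one_plus_def)

lemma one_P: "1 \<in> P"
  by (simp add: P_iff)

lemma P_mult_J: "x \<in> P \<Longrightarrow> a \<in> J \<Longrightarrow> x * a \<in> J" and J_mult_P: "x \<in> P \<Longrightarrow> a \<in> J \<Longrightarrow> a * x \<in> J"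
  by (auto elim!: P_cases simp: distrib_left distrib_right mult_J)

lemma P_mult: 
  assumes "x \<in> P" "y \<in> P"
  shows "x * y \<in> P"
proof -
  have "x * y - 1 = x * (y - 1) + (x - 1)" by (simp add: right_diff_distrib)
  moreover have "x * (y - 1) + (x - 1) \<in> J"
    using assms P_mult_J[OF assms(1), of "y - 1"] by (intro add_J) (simp_all add: P_iff)
  ultimately show ?thesis unfolding P_iff by (simp only:)
qed

text \<open>With \<open>x = 1 + a\<close> the hypothesis says \<open>d = - a * d\<close>; iterating
  gives \<open>d = (- a) ^ n * d\<close>, which vanishes by nilpotency.\<close>

lemma P_left_cancel:
  assumes x: "x \<in> P" and d: "x * d = 0"
  shows "d = 0"
proof -
  obtain a where a: "a \<in> J" "x = 1 + a" using x by (rule P_cases)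
  have "d = - (a * d)" using d a by (simp add: distrib_right eq_neg_iff_add_eq_0)
  then have step: "- a * d = d" by (metis mult_minus_left)
  have "(- a) ^ n * d = d" for n
    by (induction n) (simp_all add: mult.assoc step del: mult_minus_left)
  moreover obtain n where n: "\<forall>as. length as = n \<and> set as \<subseteq> J \<longrightarrow> prod_list as = 0"
    using nilpotent_J by (auto simp: nilpotent_set_def)
  have "prod_list (replicate n (- a)) = 0"
    using n[rule_format, of "replicate n (- a)"] a(1) by (auto simp: set_replicate_conv_if)
  then have "(- a) ^ n = 0" by (simp only: prod_list_replicate)
  ultimately show ?thesis by (metis mult_zero_left)
qed

lemma finite_P [simp]: "finite P"
  using finite_subset[OF subset_UNIV finite_algebra] .

text \<open>Left multiplication by \<open>x\<close> is injective on the finite set \<open>P\<close>,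
  hence onto, so it attains 1.\<close>

lemma P_right_inverse:
  assumes x: "x \<in> P"
  obtains y where "y \<in> P" "x * y = 1"
proof -
  have "inj_on ((*) x) P"
  proof (rule inj_onI)
    fix y z assume "x * y = x * z"
    then have "x * (y - z) = 0" by (simp add: right_diff_distrib)
    then have "y - z = 0" by (rule P_left_cancel[OF x])
    then show "y = z" by simp
  qed
  then have "(*) x ` P = P" using x P_mult by (intro endo_inj_surj) auto
  then show ?thesis using that one_P by (metis imageE)
qed

lemma unit_inv_eqI: "x * y = 1 \<Longrightarrow> y * x = 1 \<Longrightarrow> unit_inv x = (y :: 'a)"
  unfolding unit_inv_def by (rule the_equality) (auto, metis mult.assoc mult_1_left mult_1_right)

lemma unit_inv_P:
  assumes x: "x \<in> P"
  shows "unit_inv x \<in> P" "x * unit_inv x = 1" "unit_inv x * x = 1"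
proof -
  obtain y where y: "y \<in> P" "x * y = 1" using P_right_inverse[OF x] .
  obtain z where z: "z \<in> P" "y * z = 1" using P_right_inverse[OF y(1)] .
  have "x = x * (y * z)" by (simp add: z)
  also have "\<dots> = z" using y by (simp flip: mult.assoc)
  finally have "y * x = 1" using z by simp
  then have "unit_inv x = y" using y by (intro unit_inv_eqI)
  then show "unit_inv x \<in> P" "x * unit_inv x = 1" "unit_inv x * x = 1" using y \<open>y * x = 1\<close> by auto
qed

lemma unit_inv_unit_inv: "x \<in> P \<Longrightarrow> unit_inv (unit_inv x) = x"
  by (rule unit_inv_eqI) (simp_all add: unit_inv_P)

lemma unit_inv_cancel:
  assumes "x \<in> P"
  shows "x * (unit_inv x * a) = a" "unit_inv x * (x * a) = a" "a * x * unit_inv x = a" "a * unit_inv x * x = a"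
  using unit_inv_P[OF assms] by (metis mult.assoc mult_1_left, metis mult.assoc mult_1_left,
    metis mult.assoc mult_1_right, metis mult.assoc mult_1_right)

lemma unit_inv_mult: "x \<in> P \<Longrightarrow> y \<in> P \<Longrightarrow> unit_inv (x * y) = unit_inv y * unit_inv x"
  by (rule unit_inv_eqI) (simp_all add: mult.assoc unit_inv_P unit_inv_cancel)

lemma unit_inv_one: "unit_inv 1 = (1 :: 'a)"
  by (rule unit_inv_eqI) simp_all

lemma \<sigma>_add: "\<sigma> (a + b) = \<sigma> a + \<sigma> b" and \<sigma>_mult: "\<sigma> (a * b) = \<sigma> b * \<sigma> a" and \<sigma>_\<sigma>: "\<sigma> (\<sigma> a) = a"
  using involution by (auto simp: algebra_involution_def)

lemma \<sigma>_zero: "\<sigma> 0 = 0"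
  using \<sigma>_add[of 0 0] by simp

lemma \<sigma>_minus: "\<sigma> (- a) = - \<sigma> a"
  using \<sigma>_add[of a "- a"] \<sigma>_zero by (simp add: add_eq_0_iff)

lemma \<sigma>_diff: "\<sigma> (a - b) = \<sigma> a - \<sigma> b"
  using \<sigma>_add[of a "- b"] by (simp add: \<sigma>_minus)

lemma \<sigma>_one: "\<sigma> 1 = 1"
  using \<sigma>_mult[of "\<sigma> 1" 1] by (simp add: \<sigma>_\<sigma>)

lemma \<sigma>_J: "a \<in> J \<Longrightarrow> \<sigma> a \<in> J"
  using \<sigma>_image_J by blast

lemma \<sigma>_P: "x \<in> P \<Longrightarrow> \<sigma> x \<in> P"
  using \<sigma>_J[of "x - 1"] by (simp add: P_iff \<sigma>_diff \<sigma>_one)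

lemma \<sigma>_half: "\<sigma> (half a) = half (\<sigma> a)"
  by (rule half_unique) (simp add: \<sigma>_add[symmetric] half_add_half)

lemma \<sigma>_unit_inv: "x \<in> P \<Longrightarrow> \<sigma> (unit_inv x) = unit_inv (\<sigma> x)"
  by (rule unit_inv_eqI[symmetric]) (simp_all add: \<sigma>_mult[symmetric] unit_inv_P \<sigma>_one)

lemma bij_betw_one_add: "bij_betw ((+) 1) J P"
  by (rule bij_betwI[where g = "\<lambda>x. x - 1"]) (auto simp: P_iff)

lemma card_P: "card P = card J"
  using bij_betw_same_card[OF bij_betw_one_add] by simp

lemma group_P: "group (mult_group P)"
  by (rule groupI) (auto simp: mult_group_def P_mult one_P mult.assoc intro: unit_inv_P)

text \<open>Inversion and \<open>\<sigma>\<close> both reverse products, so their composite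
  \<open>act_P \<sigma>\<close> is an automorphism.\<close>

sublocale P: odd_group_involution "mult_group P" "act_P \<sigma>"
  rewrites "carrier (mult_group P) = P" and "monoid.mult (mult_group P) = (*)" and "monoid.one (mult_group P) = 1"
proof -
  show "odd_group_involution (mult_group P) (act_P \<sigma>)"
    unfolding odd_group_involution_def finite_group_def
  proof (intro conjI group_P)
    show "finite_group_axioms (mult_group P)" by (simp add: finite_group_axioms_def mult_group_def)
    show "odd_group_involution_axioms (mult_group P) (act_P \<sigma>)"
      by (simp add: odd_group_involution_axioms_def mult_group_def card_P odd_card_J act_P_def \<sigma>_P unit_inv_P
          unit_inv_mult \<sigma>_mult \<sigma>_unit_inv[symmetric] unit_inv_unit_inv \<sigma>_\<sigma>)
  qed
qed (simp_all add: mult_group_def)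

abbreviation "invP \<equiv> m_inv (mult_group P)"

lemma inv_P: "x \<in> P \<Longrightarrow> invP x = unit_inv x"
  by (rule P.inv_equality) (simp_all add: unit_inv_P)

lemma fixed_P: "P.fixed = C_P \<sigma> J"
  by (simp add: P.fixed_def C_P_def)

lemma fixed_group_P: "P.fixed_group = mult_group (C_P \<sigma> J)"
  by (simp add: P.fixed_group_def fixed_P) (simp add: mult_group_def)

section \<open>The two-sided actions of \<open>P\<close> on \<open>J\<close> and on its dual\<close>

definition pair_group where "pair_group = mult_group P \<times>\<times> mult_group P"

lemma pair_group_simps:
  "carrier pair_group = P \<times> P" "monoid.mult pair_group (x, y) (x', y') = (x * x', y * y')"
  "monoid.one pair_group = (1, 1)"
  by (simp_all add: pair_group_def DirProd_def mult_group_def)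

lemma finite_group_pair: "finite_group pair_group"
  unfolding finite_group_def finite_group_axioms_def
  using DirProd_group[OF group_P group_P] by (simp add: pair_group_simps) (simp add: pair_group_def)

lemma odd_card_pair: "odd (card (carrier pair_group))"
  by (simp add: pair_group_simps card_cartesian_product card_P odd_card_J)

text \<open>The second component acts through its inverse, so that two-sided multiplication becomes
  a left action of a single group; \<open>act_pair_dual\<close> is the contragredient
  action.\<close>

definition act_pair where "act_pair p a = fst p * a * unit_inv (snd p)"

definition act_pair_dual :: "'a \<times> 'a \<Rightarrow> ('a \<Rightarrow> complex) \<Rightarrow> 'a \<Rightarrow> complex"
  where "act_pair_dual p \<kappa> = (\<lambda>a\<in>J. \<kappa> (unit_inv (fst p) * a * snd p))"

lemma P_J_P: "x \<in> P \<Longrightarrow> y \<in> P \<Longrightarrow> a \<in> J \<Longrightarrow> x * a * y \<in> J"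
  by (simp add: P_mult_J J_mult_P)

lemma dual_compose:
  assumes \<kappa>: "\<kappa> \<in> dual_group J" and f: "\<And>a. a \<in> J \<Longrightarrow> f a \<in> J"
    "\<And>a b. a \<in> J \<Longrightarrow> b \<in> J \<Longrightarrow> f (a + b) = f a + f b"
  shows "(\<lambda>a\<in>J. \<kappa> (f a)) \<in> dual_group J"
  using f dual_nonzero[OF \<kappa>] dual_add[OF \<kappa>] by (auto simp: dual_group_def)

sublocale JA: finite_action pair_group J act_pair
  unfolding finite_action_def finite_action_axioms_def
  by (auto simp: finite_group_pair pair_group_simps act_pair_def unit_inv_one P_mult_J J_mult_P unit_inv_P
      unit_inv_mult mult.assoc)

sublocale DA: finite_action pair_group "dual_group J" act_pair_dual
  unfolding finite_action_def finite_action_axioms_def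
proof (intro conjI allI impI finite_group_pair finite_dual)
  fix p \<kappa> assume p: "p \<in> carrier pair_group" and \<kappa>: "\<kappa> \<in> dual_group J"
  show "act_pair_dual p \<kappa> \<in> dual_group J"
    unfolding act_pair_dual_def using p
    by (intro dual_compose[OF \<kappa>]) (auto simp: pair_group_simps P_J_P unit_inv_P distrib_left distrib_right)
next
  fix \<kappa> assume \<kappa>: "\<kappa> \<in> dual_group J"
  show "act_pair_dual \<one>\<^bsub>pair_group\<^esub> \<kappa> = \<kappa>"
    using dual_extensional[OF \<kappa>] by (auto simp: act_pair_dual_def pair_group_simps unit_inv_one extensional_def)
next
  fix p q \<kappa> assume "p \<in> carrier pair_group" "q \<in> carrier pair_group" and \<kappa>: "\<kappa> \<in> dual_group J"
  then show "act_pair_dual (p \<otimes>\<^bsub>pair_group\<^esub> q) \<kappa> = act_pair_dual p (act_pair_dual q \<kappa>)"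
    by (cases p; cases q)
      (auto simp: act_pair_dual_def pair_group_simps unit_inv_mult P_J_P unit_inv_P mult.assoc
        P_mult_J J_mult_P P_mult intro!: restrict_ext)
qed

lemma orb_J: "JA.orb a = {x * a * y | x y. x \<in> P \<and> y \<in> P}"
proof (intro equalityI subsetI)
  fix b assume "b \<in> JA.orb a"
  then obtain x y where "x \<in> P" "y \<in> P" "b = x * a * unit_inv y"
    by (auto simp: JA.orb_def pair_group_simps act_pair_def)
  then show "b \<in> {x * a * y | x y. x \<in> P \<and> y \<in> P}" using unit_inv_P(1) by blast
next
  fix b assume "b \<in> {x * a * y | x y. x \<in> P \<and> y \<in> P}"
  then obtain x y where "x \<in> P" "y \<in> P" "b = x * a * y" by blast
  then show "b \<in> JA.orb a"
    unfolding JA.orb_def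
    by (intro image_eqI[of _ _ "(x, unit_inv y)"]) (auto simp: pair_group_simps act_pair_def unit_inv_P unit_inv_unit_inv)
qed

lemma superclass_eq: "superclass J a = (+) 1 ` JA.orb a"
  unfolding superclass_def orb_J by blast

lemma double_orbit_eq: "double_orbit J \<kappa> = DA.orb \<kappa>"
proof -
  have eq: "right_act J (left_act J x \<kappa>) y = act_pair_dual (x, unit_inv y) \<kappa>" if "x \<in> P" "y \<in> P" for x y
    using that by (auto simp: right_act_def left_act_def act_pair_dual_def J_mult_P unit_inv_P mult.assoc)
  show ?thesis
  proof (intro equalityI subsetI)
    fix \<mu> assume "\<mu> \<in> double_orbit J \<kappa>"
    then obtain x y where "x \<in> P" "y \<in> P" "\<mu> = right_act J (left_act J x \<kappa>) y"
      by (auto simp: double_orbit_def)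
    then show "\<mu> \<in> DA.orb \<kappa>"
      unfolding DA.orb_def by (intro image_eqI[of _ _ "(x, unit_inv y)"]) (auto simp: eq pair_group_simps unit_inv_P)
  next
    fix \<mu> assume "\<mu> \<in> DA.orb \<kappa>"
    then obtain x y where xy: "x \<in> P" "y \<in> P" "\<mu> = act_pair_dual (x, y) \<kappa>"
      by (auto simp: DA.orb_def pair_group_simps)
    then have "\<mu> = right_act J (left_act J x \<kappa>) (unit_inv y)"
      by (simp add: eq unit_inv_P unit_inv_unit_inv)
    then show "\<mu> \<in> double_orbit J \<kappa>" unfolding double_orbit_def using xy unit_inv_P by blast
  qed
qed

section \<open>The involution on orbits\<close>

abbreviation "tJ \<equiv> act_J \<sigma>"

abbreviation "tD \<equiv> act_dual \<sigma> J"

lemma act_J_J: "a \<in> J \<Longrightarrow> tJ a \<in> J"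
  by (simp add: act_J_def \<sigma>_J)

lemma act_J_add: "tJ (a + b) = tJ a + tJ b"
  by (simp add: act_J_def \<sigma>_add)

lemma act_J_act_J: "tJ (tJ a) = a"
  by (simp add: act_J_def \<sigma>_minus \<sigma>_\<sigma>)

lemma act_J_mult: "tJ (x * a * y) = \<sigma> y * tJ a * \<sigma> x"
  by (simp add: act_J_def \<sigma>_mult mult.assoc)

lemma act_J_half: "tJ (half a) = half (tJ a)"
  using half_diff[of 0 "\<sigma> a"] by (simp add: act_J_def \<sigma>_half half_zero)

lemma act_dual_dual: "\<kappa> \<in> dual_group J \<Longrightarrow> tD \<kappa> \<in> dual_group J"
  unfolding act_dual_def by (rule dual_compose) (auto simp: act_J_J act_J_add)

lemma act_dual_act_dual: "\<kappa> \<in> dual_group J \<Longrightarrow> tD (tD \<kappa>) = \<kappa>"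
  using dual_extensional[of \<kappa>] by (auto simp: act_dual_def act_J_J act_J_act_J extensional_def)

lemma act_J_orb: 
  assumes "b \<in> JA.orb a"
  shows "tJ b \<in> JA.orb (tJ a)"
proof -
  obtain x y where "x \<in> P" "y \<in> P" "b = x * a * y" using assms unfolding orb_J by blast
  then have "tJ b = \<sigma> y * tJ a * \<sigma> x" "\<sigma> y \<in> P" "\<sigma> x \<in> P"
    by (simp_all add: act_J_mult \<sigma>_P)
  then show ?thesis unfolding orb_J by blast
qed

text \<open>As \<open>\<sigma>\<close> reverses products, it exchanges the two sides and normalises
  the action of \<open>pair_group\<close> through the automorphism that sends \<open>(x, y)\<close>
  to \<open>(\<sigma> (unit_inv y), \<sigma> (unit_inv x))\<close>. Hence \<open>tD\<close> permutes
  the orbits.\<close>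

lemma act_dual_act_pair_dual:
  assumes "x \<in> P" "y \<in> P"
  shows "tD (act_pair_dual (x, y) \<kappa>) = act_pair_dual (\<sigma> (unit_inv y), \<sigma> (unit_inv x)) (tD \<kappa>)"
proof
  fix a
  have e: "unit_inv (\<sigma> (unit_inv y)) = \<sigma> y" using assms by (simp add: \<sigma>_unit_inv \<sigma>_P unit_inv_unit_inv)
  have "tJ (\<sigma> y * a * \<sigma> (unit_inv x)) = unit_inv x * tJ a * y"
    by (simp add: act_J_mult \<sigma>_\<sigma>)
  then show "tD (act_pair_dual (x, y) \<kappa>) a =
      act_pair_dual (\<sigma> (unit_inv y), \<sigma> (unit_inv x)) (tD \<kappa>) a"
    using assms by (simp add: act_dual_def act_pair_dual_def act_J_J e P_J_P \<sigma>_P unit_inv_P)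
qed

lemma act_dual_orb:
  assumes "\<mu> \<in> DA.orb \<kappa>"
  shows "tD \<mu> \<in> DA.orb (tD \<kappa>)"
proof -
  obtain x y where xy: "x \<in> P" "y \<in> P" "\<mu> = act_pair_dual (x, y) \<kappa>"
    using assms by (auto simp: DA.orb_def pair_group_simps)
  then show ?thesis
    unfolding DA.orb_def by (intro image_eqI[of _ _ "(\<sigma> (unit_inv y), \<sigma> (unit_inv x))"])
      (auto simp: act_dual_act_pair_dual pair_group_simps \<sigma>_P unit_inv_P)
qed

definition stable_J where "stable_J = {a \<in> J. tJ a \<in> JA.orb a}"

definition stable_dual where "stable_dual = {\<kappa> \<in> dual_group J. tD \<kappa> \<in> DA.orb \<kappa>}"

text \<open>Burnside counting on the coset of the involution reduces the claim to single elements
  \<open>p\<close>. On characters, the involution followed by \<open>p\<close> is composition with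
  an additive map of \<open>J\<close>, which fixes as many characters as elements.\<close>

lemma card_stable_orbits: "card (JA.orb ` stable_J) = card (DA.orb ` stable_dual)"
proof -
  have J: "(\<Sum>p\<in>carrier pair_group. card {a \<in> J. act_pair p (tJ a) = a}) =
    card (carrier pair_group) * card (JA.orb ` stable_J)"
    unfolding stable_J_def
    by (rule JA.sum_card_fixed_eq) (auto simp: act_J_J JA.orb_def intro!: act_J_orb[unfolded JA.orb_def])
  have D: "(\<Sum>p\<in>carrier pair_group. card {\<kappa> \<in> dual_group J. act_pair_dual p (tD \<kappa>) = \<kappa>}) =
    card (carrier pair_group) * card (DA.orb ` stable_dual)"
    unfolding stable_dual_def
    by (rule DA.sum_card_fixed_eq) (auto simp: act_dual_dual DA.orb_def intro!: act_dual_orb[unfolded DA.orb_def])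
  have "card {\<kappa> \<in> dual_group J. act_pair_dual p (tD \<kappa>) = \<kappa>} = card {a \<in> J. act_pair p (tJ a) = a}"
    if "p \<in> carrier pair_group" for p
  proof -
    obtain x y where p: "p = (x, y)" and xy: "x \<in> P" "y \<in> P" using \<open>p \<in> carrier pair_group\<close> by (auto simp: pair_group_simps)
    \<comment> \<open>\<open>d\<close> is the inverse of
      \<open>a \<mapsto> act_pair p (tJ a)\<close>, so the two maps have the same fixed
      points.\<close>
    define d where "d a = tJ (unit_inv x * a * y)" for a
    have "act_pair_dual p (tD \<kappa>) = (\<lambda>a\<in>J. \<kappa> (d a))" for \<kappa>
      using xy by (auto simp: act_pair_dual_def act_dual_def p d_def P_J_P unit_inv_P)
    moreover have "card {\<kappa> \<in> dual_group J. (\<lambda>a\<in>J. \<kappa> (d a)) = \<kappa>} = card {a \<in> J. d a = a}"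
      using xy by (intro card_dual_fixed)
        (auto simp: d_def act_J_J P_J_P unit_inv_P distrib_left distrib_right act_J_add)
    moreover have "d a = a \<longleftrightarrow> act_pair p (tJ a) = a" for a
    proof -
      have "d a = a \<longleftrightarrow> unit_inv x * a * y = tJ a" unfolding d_def by (metis act_J_act_J)
      also have "\<dots> \<longleftrightarrow> a = x * tJ a * unit_inv y"
        using unit_inv_cancel[OF xy(1)] unit_inv_cancel[OF xy(2)] by (metis mult.assoc)
      finally show ?thesis by (auto simp: act_pair_def p)
    qed
    ultimately show ?thesis by simp
  qed
  then have "card (carrier pair_group) * card (JA.orb ` stable_J) = card (carrier pair_group) * card (DA.orb ` stable_dual)"
    unfolding J[symmetric] D[symmetric] by simp
  then show ?thesis using JA.card_carrier_pos by simp
qed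

text \<open>The inverse of \<open>z = 1 + b\<close> is \<open>1 - unit_inv z * b\<close>, which
  \<open>\<sigma>\<close> sends to \<open>1 + tJ b * \<sigma> (unit_inv z)\<close>. So the action on
  \<open>P\<close> follows the action on \<open>J\<close> up to a factor from
  \<open>P\<close>.\<close>

lemma act_P_one_add:
  assumes "b \<in> J"
  shows "act_P \<sigma> (1 + b) - 1 \<in> JA.orb (tJ b)"
proof -
  define z where "z = 1 + b"
  have z: "z \<in> P" using assms by (simp add: z_def one_add_P)
  have "unit_inv z * (z - b) = unit_inv z" by (simp add: z_def)
  then have "unit_inv z = 1 - unit_inv z * b" using unit_inv_P(3)[OF z] by (simp add: right_diff_distrib)
  then have e: "\<sigma> (unit_inv z) = 1 - \<sigma> (unit_inv z * b)" by (metis \<sigma>_diff \<sigma>_one)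
  have "\<sigma> (unit_inv z) - 1 = - \<sigma> (unit_inv z * b)" by (subst e) simp
  then have "act_P \<sigma> z - 1 = 1 * tJ b * \<sigma> (unit_inv z)"
    by (simp add: act_P_def act_J_def \<sigma>_mult)
  then show ?thesis unfolding orb_J z_def[symmetric] using one_P \<sigma>_P unit_inv_P(1)[OF z] by blast
qed

lemma superclass_invariant_iff:
  assumes a: "a \<in> J"
  shows "act_P \<sigma> ` superclass J a = superclass J a \<longleftrightarrow> a \<in> stable_J"
proof -
  have sub: "superclass J a \<subseteq> P" using JA.orb_subset[OF a] by (auto simp: superclass_eq one_add_P)
  have im: "act_P \<sigma> ` superclass J a \<subseteq> superclass J (tJ a)"
  proof
    fix x assume "x \<in> act_P \<sigma> ` superclass J a"
    then obtain b where b: "b \<in> JA.orb a" "x = act_P \<sigma> (1 + b)" by (auto simp: superclass_eq)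
    have bJ: "b \<in> J" using b(1) JA.orb_subset[OF a] by auto
    have "x - 1 \<in> JA.orb (tJ b)" using act_P_one_add[OF bJ] b(2) by simp
    also have "JA.orb (tJ b) = JA.orb (tJ a)"
      using JA.orb_eq[OF act_J_J[OF a] act_J_orb[OF b(1)]] .
    finally have "1 + (x - 1) \<in> superclass J (tJ a)" unfolding superclass_eq by (rule imageI)
    then show "x \<in> superclass J (tJ a)" by simp
  qed
  show ?thesis
  proof
    assume eq: "act_P \<sigma> ` superclass J a = superclass J a"
    have "1 + a \<in> superclass J a" using JA.orb_self[OF a] by (simp add: superclass_eq)
    then have "1 + a \<in> superclass J (tJ a)" using im eq by blast
    then have "a \<in> JA.orb (tJ a)" by (auto simp: superclass_eq)
    then have "tJ a \<in> JA.orb a" by (rule JA.orb_sym[OF act_J_J[OF a]])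
    then show "a \<in> stable_J" using a by (simp add: stable_J_def)
  next
    assume "a \<in> stable_J"
    then have "JA.orb (tJ a) = JA.orb a" using JA.orb_eq[OF a] by (auto simp: stable_J_def)
    then have "act_P \<sigma> ` superclass J a \<subseteq> superclass J a" using im by (simp add: superclass_eq)
    moreover have "inj_on (act_P \<sigma>) (superclass J a)"
      using sub P.\<tau>_\<tau> by (metis inj_on_inverseI inj_on_subset)
    ultimately show "act_P \<sigma> ` superclass J a = superclass J a"
      by (intro endo_inj_surj) (auto simp: superclass_eq)
  qed
qed

text \<open>A stable superclass has odd size and is mapped to itself by the involution
  \<open>act_P \<sigma>\<close>, so it meets \<open>C_P \<sigma> J\<close>. Distinct superclasses
  are disjoint, so this nonempty intersection determines the superclass.\<close>

lemma card_SCl_CP: "card (SCl_CP \<sigma> J) = card (JA.orb ` stable_J)"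
proof -
  have SCl: "SCl_inv \<sigma> J = (\<lambda>a. superclass J a) ` stable_J"
    using superclass_invariant_iff by (auto simp: SCl_inv_def stable_J_def)
  have "SCl_CP \<sigma> J = (\<lambda>a. superclass J a \<inter> C_P \<sigma> J) ` stable_J"
    unfolding SCl_CP_def SCl by blast
  also have "card \<dots> = card (JA.orb ` stable_J)"
  proof (rule card_image_eq_of_same_kernel)
    fix a b assume ab: "a \<in> stable_J" "b \<in> stable_J"
    then have abJ: "a \<in> J" "b \<in> J" by (simp_all add: stable_J_def)
    show "superclass J a \<inter> C_P \<sigma> J = superclass J b \<inter> C_P \<sigma> J \<longleftrightarrow> JA.orb a = JA.orb b"
    proof
      assume eq: "superclass J a \<inter> C_P \<sigma> J = superclass J b \<inter> C_P \<sigma> J"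
      have sub: "superclass J a \<subseteq> P" using JA.orb_subset[OF abJ(1)] by (auto simp: superclass_eq one_add_P)
      have "card (superclass J a) = card (JA.orb a)" unfolding superclass_eq by (intro card_image) simp
      then have odd: "odd (card (superclass J a))" using JA.odd_card_orb[OF odd_card_pair abJ(1)] by simp
      have "finite (superclass J a)" by (simp add: superclass_eq)
      then obtain x where x: "x \<in> superclass J a" "act_P \<sigma> x = x"
        using odd
      proof (rule involution_fixed_point)
        fix x assume "x \<in> superclass J a"
        then show "act_P \<sigma> x \<in> superclass J a" "act_P \<sigma> (act_P \<sigma> x) = x"
          using ab(1) superclass_invariant_iff[OF abJ(1)] sub P.\<tau>_\<tau> by blast+
      qed
      then have "x \<in> superclass J a \<inter> C_P \<sigma> J" using sub by (auto simp: C_P_def)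
      then have "x \<in> superclass J a" "x \<in> superclass J b" using eq by auto
      then have "x - 1 \<in> JA.orb a" "x - 1 \<in> JA.orb b" by (auto simp: superclass_eq)
      then show "JA.orb a = JA.orb b" by (rule JA.orb_disjoint[OF abJ])
    qed (simp add: superclass_eq)
  qed
  finally show ?thesis .
qed

text \<open>A stable orbit has odd size, hence contains a character fixed by \<open>tD\<close>. So
  the index set \<open>dual_CJ \<sigma> J\<close> reaches every stable orbit.\<close>

lemma stable_dual_orbits: "DA.orb ` dual_CJ \<sigma> J = DA.orb ` stable_dual"
proof (intro equalityI subsetI)
  fix U assume "U \<in> DA.orb ` dual_CJ \<sigma> J"
  then show "U \<in> DA.orb ` stable_dual" using DA.orb_self by (auto simp: dual_CJ_def stable_dual_def)
next
  fix U assume "U \<in> DA.orb ` stable_dual"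
  then obtain \<kappa> where \<kappa>: "\<kappa> \<in> dual_group J" "tD \<kappa> \<in> DA.orb \<kappa>" "U = DA.orb \<kappa>"
    by (auto simp: stable_dual_def)
  have fin: "finite (DA.orb \<kappa>)" by simp
  obtain \<mu> where \<mu>: "\<mu> \<in> DA.orb \<kappa>" "tD \<mu> = \<mu>"
    using fin DA.odd_card_orb[OF odd_card_pair \<kappa>(1)]
  proof (rule involution_fixed_point)
    fix \<mu> assume \<mu>: "\<mu> \<in> DA.orb \<kappa>"
    show "tD \<mu> \<in> DA.orb \<kappa>" using act_dual_orb[OF \<mu>] DA.orb_eq[OF \<kappa>(1,2)] by simp
    show "tD (tD \<mu>) = \<mu>" using \<mu> DA.orb_subset[OF \<kappa>(1)] act_dual_act_dual by blast
  qed
  have "\<mu> \<in> dual_CJ \<sigma> J" using \<mu> DA.orb_subset[OF \<kappa>(1)] by (auto simp: dual_CJ_def)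
  moreover have "U = DA.orb \<mu>" using DA.orb_eq[OF \<kappa>(1) \<mu>(1)] \<kappa>(3) by simp
  ultimately show "U \<in> DA.orb ` dual_CJ \<sigma> J" by blast
qed

end


section \<open>Supercharacters\<close>

context involutive_nilpotent_algebra
begin

definition orbit_sum :: "('a \<Rightarrow> complex) \<Rightarrow> 'a \<Rightarrow> complex"
  where "orbit_sum \<kappa> a = (\<Sum>\<mu>\<in>DA.orb \<kappa>. \<mu> a)"

text \<open>Passing from \<open>a\<close> to \<open>x * a * y\<close> amounts to acting on the
  characters by \<open>(unit_inv x, y)\<close>, which permutes the orbit.\<close>

lemma orbit_sum_invariant:
  assumes \<kappa>: "\<kappa> \<in> dual_group J" and x: "x \<in> P" and y: "y \<in> P" and a: "a \<in> J"
  shows "orbit_sum \<kappa> (x * a * y) = orbit_sum \<kappa> a"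
proof -
  have "act_pair_dual (unit_inv x, y) \<mu> a = \<mu> (x * a * y)" for \<mu>
    using a x by (simp add: act_pair_dual_def unit_inv_unit_inv)
  then show ?thesis
    unfolding orbit_sum_def
    using DA.sum_orb_act[OF \<kappa>, of "(unit_inv x, y)" "\<lambda>\<mu>. \<mu> a"] x y by (simp add: pair_group_simps unit_inv_P)
qed

text \<open>The shift \<open>half (z - 1)\<close> replaces \<open>Psi z\<close> because differences
  of shifts can be split by additive characters; by \<open>orbit_sum_Psi\<close> the values on
  \<open>P\<close> are the same.\<close>

definition super_sum :: "('a \<Rightarrow> complex) \<Rightarrow> 'a \<Rightarrow> complex"
  where "super_sum \<kappa> z = orbit_sum \<kappa> (half (z - 1))"

lemma super_sum_one:
  assumes \<kappa>: "\<kappa> \<in> dual_group J"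
  shows "super_sum \<kappa> 1 = of_nat (card (DA.orb \<kappa>))"
proof -
  have "orbit_sum \<kappa> 0 = (\<Sum>\<mu>\<in>DA.orb \<kappa>. 1)"
    unfolding orbit_sum_def using DA.orb_subset[OF \<kappa>] by (intro sum.cong refl) (auto simp: dual_zero)
  then show ?thesis by (simp add: super_sum_def half_zero)
qed

lemma super_sum_class_function:
  assumes \<kappa>: "\<kappa> \<in> dual_group J" and z: "z \<in> P" and x: "x \<in> P"
  shows "super_sum \<kappa> (x * z * unit_inv x) = super_sum \<kappa> z"
proof -
  have "x * z * unit_inv x - 1 = x * (z - 1) * unit_inv x"
    by (simp add: right_diff_distrib left_diff_distrib unit_inv_P(2)[OF x])
  then have "half (x * z * unit_inv x - 1) = x * half (z - 1) * unit_inv x"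
    by (simp add: half_mult(1)[of "x * (z - 1)"] half_mult(2)[of x "z - 1"])
  then show ?thesis
    unfolding super_sum_def using orbit_sum_invariant[OF \<kappa> x unit_inv_P(1)[OF x]] z by (simp add: half_J P_iff)
qed

text \<open>\<open>z + 1 = u + u\<close> for \<open>u = 1 + half (z - 1)\<close> in
  \<open>P\<close>, so the inverse of \<open>z + 1\<close> is half the inverse of \<open>u\<close>,
  and \<open>w = unit_inv u\<close> works.\<close>

lemma Psi_P:
  assumes z: "z \<in> P"
  obtains w where "w \<in> P" "Psi z = half (z - 1) * w"
proof -
  define u where "u = 1 + half (z - 1)"
  have u: "u \<in> P" using z by (simp add: u_def one_add_P half_J P_iff)
  have "u + u = 1 + 1 + (half (z - 1) + half (z - 1))" by (simp add: u_def algebra_simps)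
  then have uu: "z + 1 = u + u" unfolding half_add_half by simp
  have "(u + u) * half (unit_inv u) = u * (half (unit_inv u) + half (unit_inv u))"
    by (simp add: distrib_left distrib_right)
  also have "\<dots> = 1" unfolding half_add_half by (rule unit_inv_P(2)[OF u])
  finally have 1: "(z + 1) * half (unit_inv u) = 1" unfolding uu .
  have "half (unit_inv u) * (u + u) = (half (unit_inv u) + half (unit_inv u)) * u"
    by (simp add: distrib_left distrib_right)
  also have "\<dots> = 1" unfolding half_add_half by (rule unit_inv_P(3)[OF u])
  finally have 2: "half (unit_inv u) * (z + 1) = 1" unfolding uu .
  have "Psi z = (z - 1) * half (unit_inv u)"
    unfolding Psi_def using unit_inv_eqI[OF 1 2] by simp
  also have "\<dots> = half (z - 1) * unit_inv u" using half_mult by metis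
  finally show ?thesis using that unit_inv_P(1)[OF u] by blast
qed

lemma orbit_sum_Psi:
  assumes \<kappa>: "\<kappa> \<in> dual_group J" and z: "z \<in> P"
  shows "orbit_sum \<kappa> (Psi z) = super_sum \<kappa> z"
proof -
  obtain w where "w \<in> P" "Psi z = half (z - 1) * w" using Psi_P[OF z] .
  then show ?thesis
    using orbit_sum_invariant[OF \<kappa> one_P, of w "half (z - 1)"] z by (simp add: super_sum_def half_J P_iff)
qed

text \<open>\<open>z * unit_inv y - 1 = ((z - 1) - (y - 1)) * unit_inv y\<close>, and the orbit sum
  ignores the last factor. What remains is a sum over \<open>y\<close> of products of additive
  characters at \<open>half (y - 1)\<close>, and halving permutes \<open>J\<close>, so only pairs of
  equal characters survive.\<close>

lemma super_sum_convolution: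
  assumes \<kappa>: "\<kappa> \<in> dual_group J" and \<mu>: "\<mu> \<in> dual_group J" and z: "z \<in> P"
  shows "(\<Sum>y\<in>P. super_sum \<kappa> (z * unit_inv y) * super_sum \<mu> y) =
    (if DA.orb \<kappa> = DA.orb \<mu> then of_nat (card P) * super_sum \<kappa> z else 0)"
proof -
  let ?z = "half (z - 1)"
  have zJ: "?z \<in> J" using z by (simp add: half_J P_iff)
  have D: "\<nu> \<in> dual_group J" if "\<nu> \<in> DA.orb \<kappa> \<or> \<nu> \<in> DA.orb \<mu>" for \<nu>
    using that DA.orb_subset[OF \<kappa>] DA.orb_subset[OF \<mu>] by auto
  have "super_sum \<kappa> (z * unit_inv y) * super_sum \<mu> y =
    (\<Sum>\<nu>\<in>DA.orb \<kappa>. \<Sum>\<nu>'\<in>DA.orb \<mu>. \<nu> ?z * (\<nu>' (half (y - 1)) * \<nu> (- half (y - 1))))" if y: "y \<in> P" for y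
  proof -
    have yJ: "half (y - 1) \<in> J" using y by (simp add: half_J P_iff)
    have "z * unit_inv y - 1 = ((z - 1) - (y - 1)) * unit_inv y"
      by (simp add: left_diff_distrib unit_inv_P(2)[OF y])
    then have e: "half (z * unit_inv y - 1) = 1 * (?z - half (y - 1)) * unit_inv y"
      by (simp only: half_mult(1) half_diff mult_1)
    have "super_sum \<kappa> (z * unit_inv y) = orbit_sum \<kappa> (?z - half (y - 1))"
      unfolding super_sum_def e by (rule orbit_sum_invariant[OF \<kappa> one_P unit_inv_P(1)[OF y] diff_J[OF zJ yJ]])
    also have "\<dots> = (\<Sum>\<nu>\<in>DA.orb \<kappa>. \<nu> ?z * \<nu> (- half (y - 1)))"
      unfolding orbit_sum_def using D zJ yJ by (intro sum.cong refl) (simp add: dual_diff)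
    finally have e': "super_sum \<kappa> (z * unit_inv y) = (\<Sum>\<nu>\<in>DA.orb \<kappa>. \<nu> ?z * \<nu> (- half (y - 1)))" .
    show ?thesis unfolding e' super_sum_def[of \<mu>] orbit_sum_def sum_product by (simp add: mult_ac)
  qed
  then have "(\<Sum>y\<in>P. super_sum \<kappa> (z * unit_inv y) * super_sum \<mu> y) =
    (\<Sum>y\<in>P. \<Sum>\<nu>\<in>DA.orb \<kappa>. \<Sum>\<nu>'\<in>DA.orb \<mu>. \<nu> ?z * (\<nu>' (half (y - 1)) * \<nu> (- half (y - 1))))"
    by (rule sum.cong[OF refl])
  also have "\<dots> = (\<Sum>\<nu>\<in>DA.orb \<kappa>. \<Sum>\<nu>'\<in>DA.orb \<mu>. \<nu> ?z * (\<Sum>y\<in>P. \<nu>' (half (y - 1)) * \<nu> (- half (y - 1))))"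
    unfolding sum_distrib_left
    by (simp only: sum.swap[where A = P and B = "DA.orb \<kappa>"] sum.swap[where A = P and B = "DA.orb \<mu>"])
  also have "\<dots> = (\<Sum>\<nu>\<in>DA.orb \<kappa>. \<Sum>\<nu>'\<in>DA.orb \<mu>. if \<nu>' = \<nu> then \<nu> ?z * of_nat (card P) else 0)"
  proof (intro sum.cong refl)
    fix \<nu> \<nu>' assume \<nu>: "\<nu> \<in> DA.orb \<kappa>" "\<nu>' \<in> DA.orb \<mu>"
    have "(\<Sum>y\<in>P. \<nu>' (half (y - 1)) * \<nu> (- half (y - 1))) = (\<Sum>a\<in>J. \<nu>' (half a) * \<nu> (- half a))"
      by (rule sum.reindex_bij_witness[of _ "\<lambda>a. 1 + a" "\<lambda>y. y - 1"]) (auto simp: P_iff)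
    also have "\<dots> = (\<Sum>a\<in>J. \<nu>' a * \<nu> (- a))"
      by (rule sum.reindex_bij_betw[OF bij_betw_half])
    also have "\<dots> = (if \<nu>' = \<nu> then of_nat (card P) else 0)"
      using dual_orthogonality[of \<nu>' \<nu>] D \<nu> by (simp add: card_P)
    finally show "\<nu> ?z * (\<Sum>y\<in>P. \<nu>' (half (y - 1)) * \<nu> (- half (y - 1))) =
      (if \<nu>' = \<nu> then \<nu> ?z * of_nat (card P) else 0)" by simp
  qed
  also have "\<dots> = (\<Sum>\<nu>\<in>DA.orb \<kappa>. if \<nu> \<in> DA.orb \<mu> then \<nu> ?z * of_nat (card P) else 0)"
    by (intro sum.cong refl) (simp add: sum.delta)
  also have "\<dots> = (if DA.orb \<kappa> = DA.orb \<mu> then of_nat (card P) * super_sum \<kappa> z else 0)"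
  proof (cases "DA.orb \<kappa> = DA.orb \<mu>")
    case True
    have "(\<Sum>\<nu>\<in>DA.orb \<kappa>. if \<nu> \<in> DA.orb \<mu> then \<nu> ?z * of_nat (card P) else 0) =
      (\<Sum>\<nu>\<in>DA.orb \<kappa>. of_nat (card P) * \<nu> ?z)" using True by (intro sum.cong refl) simp
    also have "\<dots> = of_nat (card P) * super_sum \<kappa> z"
      by (simp add: super_sum_def orbit_sum_def sum_distrib_left)
    finally show ?thesis using True by simp
  next
    case False
    then have "\<nu> \<notin> DA.orb \<mu>" if "\<nu> \<in> DA.orb \<kappa>" for \<nu>
      using DA.orb_disjoint[OF \<kappa> \<mu> that] by blast
    then show ?thesis using False by simp
  qed
  finally show ?thesis .
qed

text \<open>For irreducible \<open>\<chi>\<close> this is, up to nonzero factors, the inner product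
  of \<open>supercharacter J \<kappa>\<close> with \<open>\<chi>\<close>, written without
  conjugation.\<close>

definition pairing :: "('a \<Rightarrow> complex) \<Rightarrow> ('a \<Rightarrow> complex) \<Rightarrow> complex"
  where "pairing \<kappa> \<chi> = (\<Sum>z\<in>P. super_sum \<kappa> z * \<chi> (unit_inv z))"

lemma pairing_eq: "pairing \<kappa> \<chi> = (\<Sum>z\<in>P. super_sum \<kappa> z * \<chi> (invP z))"
  unfolding pairing_def by (intro sum.cong refl) (simp add: inv_P)

text \<open>The scalars by which the two functions act on \<open>\<chi>\<close> multiply under
  convolution. For a single orbit this leaves 0 or \<open>\<chi> 1 * of_nat (card P)\<close> as the
  value of the pairing; for different orbits one of the two pairings is zero.\<close>

lemma pairing_mult:
  assumes \<kappa>: "\<kappa> \<in> dual_group J" and \<mu>: "\<mu> \<in> dual_group J" and \<chi>: "\<chi> \<in> Irr (mult_group P)"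
  shows "pairing \<kappa> \<chi> * pairing \<mu> \<chi> =
    (if DA.orb \<kappa> = DA.orb \<mu> then \<chi> 1 * of_nat (card P) * pairing \<kappa> \<chi> else 0)"
proof -
  have "pairing \<kappa> \<chi> * pairing \<mu> \<chi> = \<chi> 1 *
    (\<Sum>w\<in>P. (\<Sum>y\<in>P. super_sum \<kappa> (w * invP y) * super_sum \<mu> y) * \<chi> (invP w))"
    unfolding pairing_eq
    by (rule P.Irr_pairing_convolution[OF \<chi>]) (simp add: inv_P super_sum_class_function[OF \<kappa>])
  also have "\<dots> = \<chi> 1 * (\<Sum>w\<in>P. (if DA.orb \<kappa> = DA.orb \<mu> then of_nat (card P) * super_sum \<kappa> w else 0) * \<chi> (unit_inv w))"
  proof (intro arg_cong2[where f = "(*)"] sum.cong refl)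
    fix w assume w: "w \<in> P"
    have "(\<Sum>y\<in>P. super_sum \<kappa> (w * invP y) * super_sum \<mu> y) = (\<Sum>y\<in>P. super_sum \<kappa> (w * unit_inv y) * super_sum \<mu> y)"
      by (intro sum.cong refl) (simp add: inv_P)
    then show "(\<Sum>y\<in>P. super_sum \<kappa> (w * invP y) * super_sum \<mu> y) =
      (if DA.orb \<kappa> = DA.orb \<mu> then of_nat (card P) * super_sum \<kappa> w else 0)"
      using super_sum_convolution[OF \<kappa> \<mu> w] by simp
  qed (simp add: inv_P)
  also have "\<dots> = (if DA.orb \<kappa> = DA.orb \<mu> then \<chi> 1 * of_nat (card P) * pairing \<kappa> \<chi> else 0)"
    by (simp add: pairing_def sum_distrib_left mult_ac)
  finally show ?thesis .
qed

text \<open>By \<open>orbit_sum_Psi\<close> the supercharacter is a nonzero multiple of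
  \<open>super_sum \<kappa>\<close> on \<open>P\<close>.\<close>

lemma constituent_supercharacter_iff:
  assumes \<kappa>: "\<kappa> \<in> dual_group J"
  shows "constituent (mult_group P) \<chi> (supercharacter J \<kappa>) \<longleftrightarrow> \<chi> \<in> Irr (mult_group P) \<and> pairing \<kappa> \<chi> \<noteq> 0"
proof -
  define c :: complex where "c = of_nat (card (left_orbit J \<kappa>)) / of_nat (card (DA.orb \<kappa>))"
  have "left_orbit J \<kappa> = (\<lambda>x. left_act J x \<kappa>) ` P" by (auto simp: left_orbit_def)
  then have "card (left_orbit J \<kappa>) \<noteq> 0" using one_P by auto
  moreover have "card (DA.orb \<kappa>) \<noteq> 0" using DA.orb_self[OF \<kappa>] by auto
  ultimately have c: "c \<noteq> 0" by (simp add: c_def)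
  have "supercharacter J \<kappa> z = c * super_sum \<kappa> z" if "z \<in> P" for z
    using that orbit_sum_Psi[OF \<kappa> that]
    by (simp add: supercharacter_def c_def double_orbit_eq orbit_sum_def)
  then have "(\<Sum>z\<in>P. supercharacter J \<kappa> z * \<chi> (invP z)) = c * pairing \<kappa> \<chi>"
    unfolding pairing_eq sum_distrib_left by (intro sum.cong refl) (simp add: mult_ac)
  then have "char_inner (mult_group P) (supercharacter J \<kappa>) \<chi> = c * pairing \<kappa> \<chi> / of_nat (card P)"
    if "\<chi> \<in> Irr (mult_group P)"
    using P.char_inner_Irr[OF that, of "supercharacter J \<kappa>"] by simp
  then show ?thesis using c P.card_carrier_pos by (auto simp: constituent_def)
qed

text \<open>The involution changes \<open>z - 1\<close> into \<open>tJ (z - 1)\<close> up to factors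
  from \<open>P\<close>, which the orbit sum ignores, and \<open>tD\<close> permutes the orbit of
  the fixed character \<open>\<kappa>\<close>.\<close>

lemma super_sum_act_P:
  assumes \<kappa>: "\<kappa> \<in> dual_CJ \<sigma> J" and z: "z \<in> P"
  shows "super_sum \<kappa> (act_P \<sigma> z) = super_sum \<kappa> z"
proof -
  have \<kappa>D: "\<kappa> \<in> dual_group J" and inv: "tD \<kappa> = \<kappa>" using \<kappa> by (auto simp: dual_CJ_def)
  define b where "b = z - 1"
  have b: "b \<in> J" "z = 1 + b" using z by (simp_all add: b_def P_iff)
  obtain x y where xy: "x \<in> P" "y \<in> P" "act_P \<sigma> z - 1 = x * tJ b * y"
    using act_P_one_add[OF b(1)] b(2) unfolding orb_J by blast
  have "half (act_P \<sigma> z - 1) = x * tJ (half b) * y"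
    unfolding xy(3) act_J_half by (simp only: half_mult(1)[of "x * tJ b" y] half_mult(2)[of x])
  then have "super_sum \<kappa> (act_P \<sigma> z) = orbit_sum \<kappa> (tJ (half b))"
    unfolding super_sum_def using orbit_sum_invariant[OF \<kappa>D xy(1,2)] b(1) by (simp add: act_J_J half_J)
  also have "\<dots> = (\<Sum>\<mu>\<in>DA.orb \<kappa>. tD \<mu> (half b))"
    unfolding orbit_sum_def using half_J[OF b(1)] by (simp add: act_dual_def)
  also have "\<dots> = (\<Sum>\<mu>\<in>DA.orb \<kappa>. \<mu> (half b))"
    using DA.orb_subset[OF \<kappa>D] act_dual_orb[of _ \<kappa>] inv
    by (intro sum.reindex_bij_witness[of _ "tD" "tD"]) (auto intro!: act_dual_act_dual)
  finally show ?thesis by (simp add: super_sum_def orbit_sum_def b_def)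
qed

lemma exists_invariant_constituent:
  assumes \<kappa>: "\<kappa> \<in> dual_CJ \<sigma> J"
  obtains \<chi> where "\<chi> \<in> Irr_inv \<sigma> J" "pairing \<kappa> \<chi> \<noteq> 0"
proof -
  let ?I = "Irr (mult_group P)"
  have \<kappa>D: "\<kappa> \<in> dual_group J" using \<kappa> by (simp add: dual_CJ_def)
  have "\<forall>\<chi>\<in>?I. \<exists>n::nat. \<chi> 1 = of_nat n" using P.Irr_degree by metis
  then obtain d :: "('a \<Rightarrow> complex) \<Rightarrow> nat" where d: "\<And>\<chi>. \<chi> \<in> ?I \<Longrightarrow> \<chi> 1 = of_nat (d \<chi>)" by metis
  define S where "S = {\<chi> \<in> ?I. pairing \<kappa> \<chi> \<noteq> 0}"
  have finS: "finite S" using P.finite_Irr by (simp add: S_def)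
  have pS: "pairing \<kappa> \<chi> = of_nat (d \<chi>) * of_nat (card P)" if "\<chi> \<in> S" for \<chi>
    using that pairing_mult[OF \<kappa>D \<kappa>D, of \<chi>] d[of \<chi>] by (simp add: S_def)
  \<comment> \<open>Fourier inversion at the unit. On \<open>S\<close> the pairing is the degree
    times \<open>card P\<close>, and it is 0 elsewhere, so the orbit size is a sum of squared
    degrees.\<close>
  have "of_nat (card P) * of_nat (card (DA.orb \<kappa>)) = (\<Sum>\<chi>\<in>?I. \<chi> 1 * pairing \<kappa> \<chi>)"
    using P.sum_Irr_pairing[of "super_sum \<kappa>"] super_sum_one[OF \<kappa>D] unfolding pairing_eq by simp
  also have "\<dots> = (\<Sum>\<chi>\<in>S. \<chi> 1 * pairing \<kappa> \<chi>)"
    by (rule sum.mono_neutral_right) (auto simp: S_def P.finite_Irr)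
  also have "\<dots> = (\<Sum>\<chi>\<in>S. of_nat (card P) * of_nat (d \<chi> * d \<chi>))"
  proof (intro sum.cong refl)
    fix \<chi> assume \<chi>: "\<chi> \<in> S"
    then have "\<chi> 1 = of_nat (d \<chi>)" by (intro d) (simp add: S_def)
    then show "\<chi> 1 * pairing \<kappa> \<chi> = of_nat (card P) * of_nat (d \<chi> * d \<chi>)"
      unfolding pS[OF \<chi>] by simp
  qed
  also have "\<dots> = of_nat (card P) * of_nat (\<Sum>\<chi>\<in>S. d \<chi> * d \<chi>)"
    by (simp only: sum_distrib_left[symmetric] of_nat_sum)
  finally have "of_nat (card (DA.orb \<kappa>)) = (of_nat (\<Sum>\<chi>\<in>S. d \<chi> * d \<chi>) :: complex)"
    using P.card_carrier_pos by simp
  then have sq: "card (DA.orb \<kappa>) = (\<Sum>\<chi>\<in>S. d \<chi> * d \<chi>)" by (simp only: of_nat_eq_iff)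
  \<comment> \<open>Modulo 2 a squared degree counts exactly when the degree is odd, so
    \<open>A\<close> has odd size. The twist by \<open>act_P \<sigma>\<close> preserves degrees and
    pairings, hence acts on \<open>A\<close>, and its fixed point is the invariant
    constituent.\<close>
  define A where "A = {\<chi> \<in> S. odd (d \<chi>)}"
  have "odd (\<Sum>\<chi>\<in>S. d \<chi> * d \<chi>)" using DA.odd_card_orb[OF odd_card_pair \<kappa>D] sq by simp
  then have oddA: "odd (card A)" using even_sum_iff_card[OF finS, of "\<lambda>\<chi>. d \<chi> * d \<chi>"] by (simp add: A_def)
  define f where "f \<chi> = (\<lambda>x\<in>P. \<chi> (act_P \<sigma> x))" for \<chi> :: "'a \<Rightarrow> complex"
  have fI: "f \<chi> \<in> ?I" if "\<chi> \<in> ?I" for \<chi> using P.Irr_\<tau>[OF that] by (simp add: f_def)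
  have pf: "pairing \<kappa> (f \<chi>) = pairing \<kappa> \<chi>" for \<chi>
  proof -
    have "pairing \<kappa> (f \<chi>) = (\<Sum>z\<in>P. super_sum \<kappa> (act_P \<sigma> z) * \<chi> (invP (act_P \<sigma> z)))"
      unfolding pairing_eq
      by (intro sum.cong refl) (simp add: f_def super_sum_act_P[OF \<kappa>] P.\<tau>_inv)
    also have "\<dots> = (\<Sum>z\<in>P. super_sum \<kappa> z * \<chi> (invP z))"
      by (rule sum.reindex_bij_witness[of _ "act_P \<sigma>" "act_P \<sigma>"]) auto
    finally show ?thesis by (simp add: pairing_eq)
  qed
  have df: "d (f \<chi>) = d \<chi>" if \<chi>: "\<chi> \<in> ?I" for \<chi>
  proof -
    have "f \<chi> 1 = \<chi> 1" using one_P P.\<tau>_one by (simp add: f_def)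
    then show ?thesis using d[OF \<chi>] d[OF fI[OF \<chi>]] by simp
  qed
  have ff: "f (f \<chi>) = \<chi>" if \<chi>: "\<chi> \<in> ?I" for \<chi>
  proof -
    have "\<chi> \<in> extensional P" using \<chi> by (auto simp: Irr_def character_of_def mult_group_def)
    then show ?thesis by (auto simp: f_def extensional_def)
  qed
  have finA: "finite A" using finS by (simp add: A_def)
  obtain \<chi> where \<chi>: "\<chi> \<in> A" "f \<chi> = \<chi>"
    using finA oddA
    by (rule involution_fixed_point[of A f]) (auto simp: A_def S_def fI pf df ff)
  have "\<chi> (act_P \<sigma> x) = \<chi> x" if "x \<in> P" for x
    using fun_cong[OF \<chi>(2), of x] that by (simp add: f_def)
  then show ?thesis using that[of \<chi>] \<chi>(1) by (simp add: A_def S_def Irr_inv_def)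
qed

section \<open>The sets \<open>X(\<lambda>)\<close> and the final count\<close>

lemma glauberman_odd_constituent:
  assumes "\<chi> \<in> Irr_inv \<sigma> J"
  shows "P.odd_constituent \<chi> (glauberman \<sigma> J \<chi>)"
proof -
  have "\<exists>!\<psi>. P.odd_constituent \<chi> \<psi>"
    by (rule P.glauberman_unique) (use assms in \<open>auto simp: Irr_inv_def\<close>)
  moreover have "glauberman \<sigma> J \<chi> = (THE \<psi>. P.odd_constituent \<chi> \<psi>)"
    unfolding glauberman_def P.odd_constituent_def fixed_group_P fixed_P ..
  ultimately show ?thesis using theI'[of "P.odd_constituent \<chi>"] by simp
qed

lemma inj_on_glauberman: "inj_on (glauberman \<sigma> J) (Irr_inv \<sigma> J)"
proof (rule inj_onI)
  fix \<chi> \<chi>' assume \<chi>: "\<chi> \<in> Irr_inv \<sigma> J" "\<chi>' \<in> Irr_inv \<sigma> J" and eq: "glauberman \<sigma> J \<chi> = glauberman \<sigma> J \<chi>'"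
  show "\<chi> = \<chi>'"
    using glauberman_odd_constituent[OF \<chi>(1)] glauberman_odd_constituent[OF \<chi>(2)] \<chi> unfolding eq
    by (intro P.glauberman_injective[of \<chi> \<chi>']) (auto simp: Irr_inv_def)
qed

text \<open>In this form \<open>\<kappa>\<close> enters only through the nonvanishing of
  \<open>pairing \<kappa>\<close> at values of one function of \<open>\<psi>\<close>, which does not
  involve \<open>\<kappa>\<close>. This allows sets for different \<open>\<kappa>\<close> to be
  compared pointwise.\<close>

lemma X_set_eq:
  assumes "\<kappa> \<in> dual_group J"
  shows "X_set \<sigma> J \<kappa> = {\<psi> \<in> Irr (mult_group (C_P \<sigma> J)).
    inv_into (Irr_inv \<sigma> J) (glauberman \<sigma> J) \<psi> \<in> Irr (mult_group P) \<and>
    pairing \<kappa> (inv_into (Irr_inv \<sigma> J) (glauberman \<sigma> J) \<psi>) \<noteq> 0}"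
  by (simp add: X_set_def constituent_supercharacter_iff[OF assms])

lemma X_set_nonempty:
  assumes \<kappa>: "\<kappa> \<in> dual_CJ \<sigma> J"
  shows "X_set \<sigma> J \<kappa> \<noteq> {}"
proof -
  have \<kappa>D: "\<kappa> \<in> dual_group J" using \<kappa> by (simp add: dual_CJ_def)
  obtain \<chi> where \<chi>: "\<chi> \<in> Irr_inv \<sigma> J" "pairing \<kappa> \<chi> \<noteq> 0" using exists_invariant_constituent[OF \<kappa>] .
  have "glauberman \<sigma> J \<chi> \<in> Irr (mult_group (C_P \<sigma> J))"
    using glauberman_odd_constituent[OF \<chi>(1)] by (simp add: P.odd_constituent_def fixed_group_P)
  moreover have "inv_into (Irr_inv \<sigma> J) (glauberman \<sigma> J) (glauberman \<sigma> J \<chi>) = \<chi>"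
    by (rule inv_into_f_f[OF inj_on_glauberman \<chi>(1)])
  ultimately have "glauberman \<sigma> J \<chi> \<in> X_set \<sigma> J \<kappa>"
    using \<chi> by (simp add: X_set_eq[OF \<kappa>D] Irr_inv_def)
  then show ?thesis by blast
qed

text \<open>The pairing depends only on the orbit. For different orbits the product of the pairings
  vanishes, so the two sets are disjoint, and being nonempty they differ.\<close>

lemma X_set_eq_iff:
  assumes "\<kappa> \<in> dual_CJ \<sigma> J" "\<mu> \<in> dual_CJ \<sigma> J"
  shows "X_set \<sigma> J \<kappa> = X_set \<sigma> J \<mu> \<longleftrightarrow> DA.orb \<kappa> = DA.orb \<mu>"
proof
  have D: "\<kappa> \<in> dual_group J" "\<mu> \<in> dual_group J" using assms by (auto simp: dual_CJ_def)
  show "DA.orb \<kappa> = DA.orb \<mu>" if eq: "X_set \<sigma> J \<kappa> = X_set \<sigma> J \<mu>"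
  proof (rule ccontr)
    assume ne: "DA.orb \<kappa> \<noteq> DA.orb \<mu>"
    obtain \<psi> where "\<psi> \<in> X_set \<sigma> J \<kappa>" using X_set_nonempty[OF assms(1)] by blast
    moreover from this have "\<psi> \<in> X_set \<sigma> J \<mu>" using eq by simp
    ultimately show False
      using pairing_mult[OF D] ne by (auto simp: X_set_eq[OF D(1)] X_set_eq[OF D(2)])
  qed
  show "X_set \<sigma> J \<kappa> = X_set \<sigma> J \<mu>" if "DA.orb \<kappa> = DA.orb \<mu>"
    unfolding X_set_eq[OF D(1)] X_set_eq[OF D(2)] pairing_def super_sum_def orbit_sum_def that ..
qed

text \<open>Irreducible characters are independent and have nonzero degree, so the weighted sum
  remembers the set over which it runs.\<close>

lemma sigma_char_eq_iff: "sigma_char \<sigma> J \<kappa> = sigma_char \<sigma> J \<mu> \<longleftrightarrow> X_set \<sigma> J \<kappa> = X_set \<sigma> J \<mu>"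
proof
  assume eq: "sigma_char \<sigma> J \<kappa> = sigma_char \<sigma> J \<mu>"
  show "X_set \<sigma> J \<kappa> = X_set \<sigma> J \<mu>"
  proof (rule P.fixed.sum_Irr_inj)
    fix x assume "x \<in> P.fixed"
    then show "(\<Sum>\<chi>\<in>X_set \<sigma> J \<kappa>. \<chi> 1 * \<chi> x) = (\<Sum>\<chi>\<in>X_set \<sigma> J \<mu>. \<chi> 1 * \<chi> x)"
      using fun_cong[OF eq, of x] by (simp add: sigma_char_def fixed_P)
  qed (auto simp: X_set_def fixed_group_P)
qed (simp add: sigma_char_def)

lemma card_X_sets: "card (X_sets \<sigma> J) = card (SCl_CP \<sigma> J)"
proof -
  have "X_sets \<sigma> J = X_set \<sigma> J ` dual_CJ \<sigma> J" by (auto simp: X_sets_def)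
  then have "card (X_sets \<sigma> J) = card (DA.orb ` dual_CJ \<sigma> J)"
    using card_image_eq_of_same_kernel[of "dual_CJ \<sigma> J" "X_set \<sigma> J" DA.orb] X_set_eq_iff by simp
  then show ?thesis by (simp add: stable_dual_orbits card_stable_orbits card_SCl_CP)
qed

lemma card_SCh_CP: "card (SCh_CP \<sigma> J) = card (X_sets \<sigma> J)"
proof -
  have "X_sets \<sigma> J = X_set \<sigma> J ` dual_CJ \<sigma> J" "SCh_CP \<sigma> J = sigma_char \<sigma> J ` dual_CJ \<sigma> J"
    by (auto simp: X_sets_def SCh_CP_def)
  then show ?thesis
    using card_image_eq_of_same_kernel[of "dual_CJ \<sigma> J" "sigma_char \<sigma> J" "X_set \<sigma> J"] sigma_char_eq_iff by simp
qed

end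

theorem theorem3p7:
  fixes scale :: "'k::{field,finite} \<Rightarrow> 'a::ring_1 \<Rightarrow> 'a"
    and \<sigma> :: "'a \<Rightarrow> 'a"
    and J :: "'a set"
  assumes "odd CHAR('k)"
    and "finite_dimensional_algebra scale"
    and "algebra_involution scale \<sigma>"
    and "subalgebra scale J"
    and "nilpotent_set J"
    and "\<sigma> ` J = J"
  shows "card (X_sets \<sigma> J) = card (SCh_CP \<sigma> J) \<and> card (SCh_CP \<sigma> J) = card (SCl_CP \<sigma> J)"
proof -
  interpret involutive_nilpotent_algebra scale \<sigma> J
    using assms by (intro involutive_nilpotent_algebra.intro involutive_nilpotent_algebra_axioms.intro)
  show ?thesis by (simp add: card_SCh_CP card_X_sets)
qed

end
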